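(* Suppose $W$ is a simplicial set equipped with a (right) action of the simplicial group $G$. Then there are equivalences of categories $$\mathcal{R}(W,G)\cong \mathrm{Fun}\bigl(\mathrm{Simp}_G(W)^{\mathrm{op}},\ \mathrm{Set}_*\bigr)\quad\text{and}\quad \mathcal{R}^{\mathrm{ab}}(W,G)\cong \mathrm{Fun}\bigl(\mathrm{Simp}_G(W)^{\mathrm{op}},\ \mathrm{Ab}\bigr).$$
   Context: $\mathcal{R}(W,G)$ is the category of $G$-equivariant retractive spaces over $W$: objects are triples $(Y,r,s)$ where $Y$ is a simplicial set with a right $G$-action, $r\colon Y\to W$ is a $G$-equivariant map, and $s$ is a $G$-equivariant section of $r$; morphisms are $G$-equivariant maps compatible with the retractions and sections. This category has products (pullback over $W$ along the structural retractions) and terminal object $(W,\mathrm{id},\mathrm{id})$; $\mathcal{R}^{\mathrm{ab}}(W,G)$ is the category of abelian group objects in $\mathcal{R}(W,G)$. The equivariant simplex category $\mathrm{Simp}_G(W)$ has as objects the pairs $(n,w)$ with $n$ a natural number and $w\in W_n$; a morphism $(m,v)\to(n,w)$ is a pair $(\alpha,g)$ with $\alpha\colon[m]\to[n]$ a morphism in $\Delta$ and $g\in G_m$ such that $v=W(\alpha)(w)\cdot g$. Composition is $(\beta,h)\circ(\alpha,g):=(\beta\circ\alpha,\ G(\alpha)(h)\cdot g)$. $\mathrm{Set}_*$ is the category of pointed sets, $\mathrm{Ab}$ the category of abelian groups, and $\mathrm{Fun}$ denotes the category of functors and natural transformations. *)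

theory Defs
  imports Main "HOL-Algebra.Group"
begin

section \<open>Categories, functors, equivalences\<close>

text \<open>
  Hom-sets need not be disjoint, so composition takes the three objects involved as arguments:
  \<open>Comp C x y z g f\<close> is the composite of \<open>f : x \<rightarrow> y\<close> and \<open>g : y \<rightarrow> z\<close>.
\<close>

record ('o, 'm) cat =
  Obj  :: "'o set"
  Hom  :: "'o \<Rightarrow> 'o \<Rightarrow> 'm set"
  Ide  :: "'o \<Rightarrow> 'm"
  Comp :: "'o \<Rightarrow> 'o \<Rightarrow> 'o \<Rightarrow> 'm \<Rightarrow> 'm \<Rightarrow> 'm"

definition category :: "('o, 'm) cat \<Rightarrow> bool" where
  "category C \<longleftrightarrow>
     (\<forall>x\<in>Obj C. Ide C x \<in> Hom C x x) \<and>
     (\<forall>x\<in>Obj C. \<forall>y\<in>Obj C. \<forall>z\<in>Obj C. \<forall>f\<in>Hom C x y. \<forall>g\<in>Hom C y z.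
        Comp C x y z g f \<in> Hom C x z) \<and>
     (\<forall>x\<in>Obj C. \<forall>y\<in>Obj C. \<forall>f\<in>Hom C x y.
        Comp C x x y f (Ide C x) = f \<and> Comp C x y y (Ide C y) f = f) \<and>
     (\<forall>w\<in>Obj C. \<forall>x\<in>Obj C. \<forall>y\<in>Obj C. \<forall>z\<in>Obj C.
        \<forall>f\<in>Hom C w x. \<forall>g\<in>Hom C x y. \<forall>h\<in>Hom C y z.
        Comp C w x z (Comp C x y z h g) f = Comp C w y z h (Comp C w x y g f))"

definition opp :: "('o, 'm) cat \<Rightarrow> ('o, 'm) cat" where
  "opp C = \<lparr>Obj = Obj C,
            Hom = (\<lambda>x y. Hom C y x),
            Ide = Ide C,
            Comp = (\<lambda>x y z g f. Comp C z y x f g)\<rparr>"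

definition isomorphic :: "('o, 'm) cat \<Rightarrow> 'o \<Rightarrow> 'o \<Rightarrow> bool" where
  "isomorphic C x y \<longleftrightarrow>
     x \<in> Obj C \<and> y \<in> Obj C \<and>
     (\<exists>f\<in>Hom C x y. \<exists>g\<in>Hom C y x. Comp C x y x g f = Ide C x \<and> Comp C y x y f g = Ide C y)"

text \<open>
  Functors and natural transformations are required to be \<^const>\<open>undefined\<close> outside their domain,
  so that equality in HOL is equality of functors and of natural transformations.
\<close>

record ('o, 'm, 'p, 'n) fctr =
  FObj :: "'o \<Rightarrow> 'p"
  FMor :: "'o \<Rightarrow> 'o \<Rightarrow> 'm \<Rightarrow> 'n"

definition is_functor :: "('o, 'm) cat \<Rightarrow> ('p, 'n) cat \<Rightarrow> ('o, 'm, 'p, 'n) fctr \<Rightarrow> bool" where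
  "is_functor C D F \<longleftrightarrow>
     FObj F \<in> Obj C \<rightarrow>\<^sub>E Obj D \<and>
     (\<forall>x\<in>Obj C. \<forall>y\<in>Obj C. FMor F x y \<in> Hom C x y \<rightarrow>\<^sub>E Hom D (FObj F x) (FObj F y)) \<and>
     (\<forall>x y. \<not> (x \<in> Obj C \<and> y \<in> Obj C) \<longrightarrow> FMor F x y = (\<lambda>f. undefined)) \<and>
     (\<forall>x\<in>Obj C. FMor F x x (Ide C x) = Ide D (FObj F x)) \<and>
     (\<forall>x\<in>Obj C. \<forall>y\<in>Obj C. \<forall>z\<in>Obj C. \<forall>f\<in>Hom C x y. \<forall>g\<in>Hom C y z.
        FMor F x z (Comp C x y z g f) =
        Comp D (FObj F x) (FObj F y) (FObj F z) (FMor F y z g) (FMor F x y f))"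

definition id_functor :: "('o, 'm) cat \<Rightarrow> ('o, 'm, 'o, 'm) fctr" where
  "id_functor C = \<lparr>FObj = (\<lambda>x\<in>Obj C. x),
     FMor = (\<lambda>x y. if x \<in> Obj C \<and> y \<in> Obj C then (\<lambda>f\<in>Hom C x y. f) else (\<lambda>f. undefined))\<rparr>"

definition comp_functor ::
  "('o, 'm) cat \<Rightarrow> ('p, 'n, 'q, 'k) fctr \<Rightarrow> ('o, 'm, 'p, 'n) fctr \<Rightarrow> ('o, 'm, 'q, 'k) fctr" where
  "comp_functor C G F = \<lparr>FObj = (\<lambda>x\<in>Obj C. FObj G (FObj F x)),
     FMor = (\<lambda>x y. if x \<in> Obj C \<and> y \<in> Obj C
                   then (\<lambda>f\<in>Hom C x y. FMor G (FObj F x) (FObj F y) (FMor F x y f))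
                   else (\<lambda>f. undefined))\<rparr>"

definition nat_trans ::
  "('o, 'm) cat \<Rightarrow> ('p, 'n) cat \<Rightarrow> ('o, 'm, 'p, 'n) fctr \<Rightarrow> ('o, 'm, 'p, 'n) fctr \<Rightarrow> ('o \<Rightarrow> 'n) set" where
  "nat_trans C D F G =
     {\<eta> \<in> (\<Pi>\<^sub>E x\<in>Obj C. Hom D (FObj F x) (FObj G x)).
        \<forall>x\<in>Obj C. \<forall>y\<in>Obj C. \<forall>f\<in>Hom C x y.
          Comp D (FObj F x) (FObj F y) (FObj G y) (\<eta> y) (FMor F x y f) =
          Comp D (FObj F x) (FObj G x) (FObj G y) (FMor G x y f) (\<eta> x)}"

definition Fun_cat :: "('o, 'm) cat \<Rightarrow> ('p, 'n) cat \<Rightarrow> (('o, 'm, 'p, 'n) fctr, 'o \<Rightarrow> 'n) cat" where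
  "Fun_cat C D = \<lparr>Obj = {F. is_functor C D F},
     Hom = nat_trans C D,
     Ide = (\<lambda>F. \<lambda>x\<in>Obj C. Ide D (FObj F x)),
     Comp = (\<lambda>F G H \<theta> \<eta>. \<lambda>x\<in>Obj C. Comp D (FObj F x) (FObj G x) (FObj H x) (\<theta> x) (\<eta> x))\<rparr>"

definition equivalent_categories :: "('o, 'm) cat \<Rightarrow> ('p, 'n) cat \<Rightarrow> bool" where
  "equivalent_categories C D \<longleftrightarrow>
     category C \<and> category D \<and>
     (\<exists>F G. is_functor C D F \<and> is_functor D C G \<and>
        isomorphic (Fun_cat C C) (comp_functor C G F) (id_functor C) \<and>
        isomorphic (Fun_cat D D) (comp_functor D F G) (id_functor D))"


section \<open>Abelian group objects\<close>

definition is_terminal :: "('o, 'm) cat \<Rightarrow> 'o \<Rightarrow> bool" where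
  "is_terminal C T \<longleftrightarrow> T \<in> Obj C \<and> (\<forall>x\<in>Obj C. \<exists>!f. f \<in> Hom C x T)"

definition is_product :: "('o, 'm) cat \<Rightarrow> 'o \<Rightarrow> 'o \<Rightarrow> 'o \<times> 'm \<times> 'm \<Rightarrow> bool" where
  "is_product C A B = (\<lambda>(P, p, q).
     P \<in> Obj C \<and> p \<in> Hom C P A \<and> q \<in> Hom C P B \<and>
     (\<forall>X\<in>Obj C. \<forall>f\<in>Hom C X A. \<forall>g\<in>Hom C X B.
        \<exists>!h. h \<in> Hom C X P \<and> Comp C X P A p h = f \<and> Comp C X P B q h = g))"

text \<open>
  Terminal object and binary products are picked by Hilbert choice; the constants below are
  meaningful only for categories in which these limits exist.
\<close>

definition terminal :: "('o, 'm) cat \<Rightarrow> 'o" where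
  "terminal C = (SOME T. is_terminal C T)"

definition to_terminal :: "('o, 'm) cat \<Rightarrow> 'o \<Rightarrow> 'm" where
  "to_terminal C A = (THE f. f \<in> Hom C A (terminal C))"

definition product :: "('o, 'm) cat \<Rightarrow> 'o \<Rightarrow> 'o \<Rightarrow> 'o \<times> 'm \<times> 'm" where
  "product C A B = (SOME P. is_product C A B P)"

definition prod_obj :: "('o, 'm) cat \<Rightarrow> 'o \<Rightarrow> 'o \<Rightarrow> 'o" where
  "prod_obj C A B = fst (product C A B)"

definition proj1 :: "('o, 'm) cat \<Rightarrow> 'o \<Rightarrow> 'o \<Rightarrow> 'm" where
  "proj1 C A B = fst (snd (product C A B))"

definition proj2 :: "('o, 'm) cat \<Rightarrow> 'o \<Rightarrow> 'o \<Rightarrow> 'm" where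
  "proj2 C A B = snd (snd (product C A B))"

definition pairing :: "('o, 'm) cat \<Rightarrow> 'o \<Rightarrow> 'o \<Rightarrow> 'o \<Rightarrow> 'm \<Rightarrow> 'm \<Rightarrow> 'm" where
  "pairing C X A B f g = (THE h. h \<in> Hom C X (prod_obj C A B) \<and>
     Comp C X (prod_obj C A B) A (proj1 C A B) h = f \<and>
     Comp C X (prod_obj C A B) B (proj2 C A B) h = g)"

text \<open>The composite \<open>m \<circ> \<langle>f, g\<rangle> : X \<rightarrow> A \<times> A \<rightarrow> A\<close>.\<close>

definition mult_pair :: "('o, 'm) cat \<Rightarrow> 'o \<Rightarrow> 'm \<Rightarrow> 'o \<Rightarrow> 'm \<Rightarrow> 'm \<Rightarrow> 'm" where
  "mult_pair C A m X f g = Comp C X (prod_obj C A A) A m (pairing C X A A f g)"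

text \<open>
  Multiplication \<open>m : A \<times> A \<rightarrow> A\<close>, unit \<open>e : 1 \<rightarrow> A\<close>, inverse \<open>i : A \<rightarrow> A\<close>. Associativity is an
  equation between maps \<open>(A \<times> A) \<times> A \<rightarrow> A\<close>, whose three projections to \<open>A\<close> are \<open>a\<close>, \<open>b\<close>, \<open>c\<close>.
\<close>

definition abelian_group_object :: "('o, 'm) cat \<Rightarrow> 'o \<Rightarrow> 'm \<Rightarrow> 'm \<Rightarrow> 'm \<Rightarrow> bool" where
  "abelian_group_object C A m e i \<longleftrightarrow>
     A \<in> Obj C \<and>
     m \<in> Hom C (prod_obj C A A) A \<and> e \<in> Hom C (terminal C) A \<and> i \<in> Hom C A A \<and>
     (let AA = prod_obj C A A; AAA = prod_obj C AA A;
          a = Comp C AAA AA A (proj1 C A A) (proj1 C AA A);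
          b = Comp C AAA AA A (proj2 C A A) (proj1 C AA A);
          c = proj2 C AA A
      in mult_pair C A m AAA (mult_pair C A m AAA a b) c =
         mult_pair C A m AAA a (mult_pair C A m AAA b c)) \<and>
     mult_pair C A m (prod_obj C A A) (proj2 C A A) (proj1 C A A) = m \<and>
     mult_pair C A m A (Comp C A (terminal C) A e (to_terminal C A)) (Ide C A) = Ide C A \<and>
     mult_pair C A m A i (Ide C A) = Comp C A (terminal C) A e (to_terminal C A)"

definition Ab_objects :: "('o, 'm) cat \<Rightarrow> ('o \<times> 'm \<times> 'm \<times> 'm, 'm) cat" where
  "Ab_objects C = \<lparr>Obj = {(A, m, e, i). abelian_group_object C A m e i},
     Hom = (\<lambda>(A, m, _, _) (B, n, _, _).
       {f \<in> Hom C A B. Comp C (prod_obj C A A) A B f m =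
          mult_pair C B n (prod_obj C A A)
            (Comp C (prod_obj C A A) A B f (proj1 C A A))
            (Comp C (prod_obj C A A) A B f (proj2 C A A))}),
     Ide = (\<lambda>(A, _). Ide C A),
     Comp = (\<lambda>(A, _) (B, _) (D, _). Comp C A B D)\<rparr>"


section \<open>Sets, pointed sets, groups\<close>

text \<open>
  The category of sets consists of the members of a universe \<open>U\<close> of subsets of a fixed type.
  Only two closure properties are required: subsets, and (up to bijection) disjoint unions indexed
  by members of \<open>U\<close>. Every Grothendieck universe has them, and so does the collection of all
  subsets of an infinite type.
\<close>

definition set_universe :: "'u set set \<Rightarrow> bool" where
  "set_universe U \<longleftrightarrow>
     (\<forall>A\<in>U. \<forall>B. B \<subseteq> A \<longrightarrow> B \<in> U) \<and>
     (\<forall>I\<in>U. \<forall>A. (\<forall>i\<in>I. A i \<in> U) \<longrightarrow> (\<exists>S\<in>U. \<exists>f. bij_betw f (SIGMA i:I. A i) S))"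

lemma set_universe_UNIV:
  assumes "infinite (UNIV :: 'u set)"
  shows "set_universe (UNIV :: 'u set set)"
proof -
  obtain h :: "'u \<times> 'u \<Rightarrow> 'u" where h: "bij_betw h (UNIV \<times> UNIV) UNIV"
    using card_of_Times_same_infinite[OF assms] card_of_ordIso by blast
  have "bij_betw h (SIGMA i:I. A i) (h ` (SIGMA i:I. A i))" for I and A :: "'u \<Rightarrow> 'u set"
    using bij_betw_subset[OF h, of "SIGMA i:I. A i"] by auto
  then show ?thesis
    unfolding set_universe_def by blast
qed

definition Set_cat :: "'u set set \<Rightarrow> ('u set, 'u \<Rightarrow> 'u) cat" where
  "Set_cat U = \<lparr>Obj = U,
     Hom = (\<lambda>A B. A \<rightarrow>\<^sub>E B),
     Ide = (\<lambda>A. \<lambda>x\<in>A. x),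
     Comp = (\<lambda>A B D g f. compose A g f)\<rparr>"

definition Pointed_set_cat :: "'u set set \<Rightarrow> ('u set \<times> 'u, 'u \<Rightarrow> 'u) cat" where
  "Pointed_set_cat U = \<lparr>Obj = {(A, a). A \<in> U \<and> a \<in> A},
     Hom = (\<lambda>(A, a) (B, b). {f \<in> A \<rightarrow>\<^sub>E B. f a = b}),
     Ide = (\<lambda>(A, _). \<lambda>x\<in>A. x),
     Comp = (\<lambda>(A, _) _ _ g f. compose A g f)\<rparr>"

definition Groups_in :: "'g monoid set \<Rightarrow> ('g monoid, 'g \<Rightarrow> 'g) cat" where
  "Groups_in K = \<lparr>Obj = K,
     Hom = (\<lambda>G H. hom G H \<inter> extensional (carrier G)),
     Ide = (\<lambda>G. \<lambda>x\<in>carrier G. x),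
     Comp = (\<lambda>G H K g f. compose (carrier G) g f)\<rparr>"

definition Grp_cat :: "('g monoid, 'g \<Rightarrow> 'g) cat" where
  "Grp_cat = Groups_in {G. group G}"

definition Ab_cat :: "'u set set \<Rightarrow> ('u monoid, 'u \<Rightarrow> 'u) cat" where
  "Ab_cat U = Groups_in {A. comm_group A \<and> carrier A \<in> U}"


section \<open>Simplicial sets and simplicial groups\<close>

text \<open>The natural number \<open>n\<close> stands for the ordinal \<open>[n] = {0, \<dots>, n}\<close>.\<close>

definition Delta :: "(nat, nat \<Rightarrow> nat) cat" where
  "Delta = \<lparr>Obj = UNIV,
     Hom = (\<lambda>m n. {\<alpha> \<in> {..m} \<rightarrow>\<^sub>E {..n}. mono_on {..m} \<alpha>}),
     Ide = (\<lambda>n. \<lambda>i\<in>{..n}. i),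
     Comp = (\<lambda>l m n \<beta> \<alpha>. compose {..l} \<beta> \<alpha>)\<rparr>"

text \<open>
  For \<open>\<alpha> : [m] \<rightarrow> [n]\<close> the operator \<open>X(\<alpha>) : X\<^sub>n \<rightarrow> X\<^sub>m\<close> of a simplicial object \<open>X\<close> is
  \<open>FMor X n m \<alpha>\<close>, as \<open>\<alpha>\<close> is a morphism from \<open>n\<close> to \<open>m\<close> in the opposite category.
\<close>

type_synonym 'u sset = "(nat, nat \<Rightarrow> nat, 'u set, 'u \<Rightarrow> 'u) fctr"
type_synonym 'g sgroup = "(nat, nat \<Rightarrow> nat, 'g monoid, 'g \<Rightarrow> 'g) fctr"

definition sSet_cat :: "'u set set \<Rightarrow> ('u sset, nat \<Rightarrow> 'u \<Rightarrow> 'u) cat" where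
  "sSet_cat U = Fun_cat (opp Delta) (Set_cat U)"

definition simplicial_group :: "'g sgroup \<Rightarrow> bool" where
  "simplicial_group G \<longleftrightarrow> is_functor (opp Delta) Grp_cat G"


section \<open>Equivariant retractive spaces and the equivariant simplex category\<close>

record ('u, 'g) gspace =
  Under :: "'u sset"
  Act   :: "nat \<Rightarrow> 'u \<Rightarrow> 'g \<Rightarrow> 'u"

definition right_action :: "'g sgroup \<Rightarrow> 'u sset \<Rightarrow> (nat \<Rightarrow> 'u \<Rightarrow> 'g \<Rightarrow> 'u) \<Rightarrow> bool" where
  "right_action G X a \<longleftrightarrow>
     (\<forall>n. \<forall>x\<in>FObj X n. \<forall>g\<in>carrier (FObj G n). a n x g \<in> FObj X n) \<and>
     (\<forall>n x g. \<not> (x \<in> FObj X n \<and> g \<in> carrier (FObj G n)) \<longrightarrow> a n x g = undefined) \<and>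
     (\<forall>n. \<forall>x\<in>FObj X n. a n x \<one>\<^bsub>FObj G n\<^esub> = x) \<and>
     (\<forall>n. \<forall>x\<in>FObj X n. \<forall>g\<in>carrier (FObj G n). \<forall>h\<in>carrier (FObj G n).
        a n (a n x g) h = a n x (g \<otimes>\<^bsub>FObj G n\<^esub> h)) \<and>
     (\<forall>m n. \<forall>\<alpha>\<in>Hom Delta m n. \<forall>x\<in>FObj X n. \<forall>g\<in>carrier (FObj G n).
        FMor X n m \<alpha> (a n x g) = a m (FMor X n m \<alpha> x) (FMor G n m \<alpha> g))"

definition GsSet_cat ::
  "'u set set \<Rightarrow> 'g sgroup \<Rightarrow> (('u, 'g) gspace, nat \<Rightarrow> 'u \<Rightarrow> 'u) cat" where
  "GsSet_cat U G = \<lparr>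
     Obj = {X. Under X \<in> Obj (sSet_cat U) \<and> right_action G (Under X) (Act X)},
     Hom = (\<lambda>X Y. {f \<in> Hom (sSet_cat U) (Under X) (Under Y).
       \<forall>n. \<forall>x\<in>FObj (Under X) n. \<forall>g\<in>carrier (FObj G n). f n (Act X n x g) = Act Y n (f n x) g}),
     Ide = (\<lambda>X. Ide (sSet_cat U) (Under X)),
     Comp = (\<lambda>X Y Z. Comp (sSet_cat U) (Under X) (Under Y) (Under Z))\<rparr>"

definition Retractive :: "('o, 'm) cat \<Rightarrow> 'o \<Rightarrow> ('o \<times> 'm \<times> 'm, 'm) cat" where
  "Retractive C W = \<lparr>
     Obj = {(Y, r, s). Y \<in> Obj C \<and> r \<in> Hom C Y W \<and> s \<in> Hom C W Y \<and> Comp C W Y W r s = Ide C W},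
     Hom = (\<lambda>(Y, r, s) (Y', r', s').
       {f \<in> Hom C Y Y'. Comp C Y Y' W r' f = r \<and> Comp C W Y Y' f s = s'}),
     Ide = (\<lambda>(Y, _). Ide C Y),
     Comp = (\<lambda>(X, _) (Y, _) (Z, _). Comp C X Y Z)\<rparr>"

definition R_cat ::
  "'u set set \<Rightarrow> ('u, 'g) gspace \<Rightarrow> 'g sgroup
    \<Rightarrow> (('u, 'g) gspace \<times> (nat \<Rightarrow> 'u \<Rightarrow> 'u) \<times> (nat \<Rightarrow> 'u \<Rightarrow> 'u), nat \<Rightarrow> 'u \<Rightarrow> 'u) cat" where
  "R_cat U W G = Retractive (GsSet_cat U G) W"

definition Simp_cat ::
  "'g sgroup \<Rightarrow> ('u, 'g) gspace \<Rightarrow> (nat \<times> 'u, (nat \<Rightarrow> nat) \<times> 'g) cat" where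
  "Simp_cat G W = \<lparr>
     Obj = {(n, w). w \<in> FObj (Under W) n},
     Hom = (\<lambda>(m, v) (n, w). {(\<alpha>, g). \<alpha> \<in> Hom Delta m n \<and> g \<in> carrier (FObj G m) \<and>
       v = Act W m (FMor (Under W) n m \<alpha> w) g}),
     Ide = (\<lambda>(n, w). (Ide Delta n, \<one>\<^bsub>FObj G n\<^esub>)),
     Comp = (\<lambda>(l, _) (m, _) (n, _) (\<beta>, h) (\<alpha>, g).
       (Comp Delta l m n \<beta> \<alpha>, FMor G m l \<alpha> h \<otimes>\<^bsub>FObj G l\<^esub> g))\<rparr>"

end

theory Submission
  imports Defs
begin

text \<open>
  The simplicial operators of a \<open>G\<close>-space and its action combine into operators
  \<open>x \<mapsto> X(\<alpha>)(x) \<cdot> g\<close>, which compose by the composition law of the equivariant simplex category. Hence the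
  fibres \<open>r\<^sub>n\<^sup>-\<^sup>1(w)\<close> of a retractive space, pointed by \<open>s\<^sub>n(w)\<close>, form a presheaf of pointed sets, and
  conversely a presheaf \<open>K\<close> is realised by the disjoint unions of the \<open>K(n, w)\<close> over \<open>w \<in> W\<^sub>n\<close>. The
  resulting functor is fully faithful and essentially surjective. Products of retractive spaces are
  fibrewise, and \<open>(W, id, id)\<close> is a zero object, so an abelian group object is the same as a
  compatible family of abelian group structures on the fibres whose units are the base points.
\<close>

section \<open>Functors and equivalences\<close>

text \<open>Two obstacles shape the details. First, the levels of a space must be members of
  \<open>U\<close>, subsets of one fixed type, whereas a disjoint union or a set of pairs has
  another type. Every total space is therefore a coded copy, carried along a bijection onto a member
  of \<open>U\<close>; the same device produces fibre products. Second, \<open>terminal\<close> and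
  \<open>product\<close> are Hilbert choices, known only through their universal properties. One
  product is built by hand and any other one is compared with it, after which \<open>pr\<close> and
  \<open>mul\<close> allow calculation with elements. That units are base points is forced: every
  cell of a terminal object lies in its section, so a morphism out of it can only hit base points.
  Conversely, a homomorphism between fibre groups respects base points of its own accord, so the
  morphisms of the abelian case are cut out of those of the pointed case by additivity.\<close>

lemma cat_ide: "category C \<Longrightarrow> x \<in> Obj C \<Longrightarrow> Ide C x \<in> Hom C x x"
  by (simp add: category_def)

lemma cat_comp:
  "category C \<Longrightarrow> x \<in> Obj C \<Longrightarrow> y \<in> Obj C \<Longrightarrow> z \<in> Obj C \<Longrightarrow> f \<in> Hom C x y \<Longrightarrow> g \<in> Hom C y z \<Longrightarrow>
    Comp C x y z g f \<in> Hom C x z"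
  by (simp add: category_def)

lemma cat_ide_right:
  "category C \<Longrightarrow> x \<in> Obj C \<Longrightarrow> y \<in> Obj C \<Longrightarrow> f \<in> Hom C x y \<Longrightarrow> Comp C x x y f (Ide C x) = f"
  by (simp add: category_def)

lemma cat_ide_left:
  "category C \<Longrightarrow> x \<in> Obj C \<Longrightarrow> y \<in> Obj C \<Longrightarrow> f \<in> Hom C x y \<Longrightarrow> Comp C x y y (Ide C y) f = f"
  by (simp add: category_def)

lemma cat_assoc:
  "category C \<Longrightarrow> w \<in> Obj C \<Longrightarrow> x \<in> Obj C \<Longrightarrow> y \<in> Obj C \<Longrightarrow> z \<in> Obj C \<Longrightarrow>
    f \<in> Hom C w x \<Longrightarrow> g \<in> Hom C x y \<Longrightarrow> h \<in> Hom C y z \<Longrightarrow>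
    Comp C w x z (Comp C x y z h g) f = Comp C w y z h (Comp C w x y g f)"
  by (simp add: category_def)

lemma categoryI:
  assumes "\<And>x. x \<in> Obj C \<Longrightarrow> Ide C x \<in> Hom C x x"
    and "\<And>x y z f g. x \<in> Obj C \<Longrightarrow> y \<in> Obj C \<Longrightarrow> z \<in> Obj C \<Longrightarrow> f \<in> Hom C x y \<Longrightarrow> g \<in> Hom C y z \<Longrightarrow>
      Comp C x y z g f \<in> Hom C x z"
    and "\<And>x y f. x \<in> Obj C \<Longrightarrow> y \<in> Obj C \<Longrightarrow> f \<in> Hom C x y \<Longrightarrow> Comp C x x y f (Ide C x) = f"
    and "\<And>x y f. x \<in> Obj C \<Longrightarrow> y \<in> Obj C \<Longrightarrow> f \<in> Hom C x y \<Longrightarrow> Comp C x y y (Ide C y) f = f"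
    and "\<And>w x y z f g h. w \<in> Obj C \<Longrightarrow> x \<in> Obj C \<Longrightarrow> y \<in> Obj C \<Longrightarrow> z \<in> Obj C \<Longrightarrow>
      f \<in> Hom C w x \<Longrightarrow> g \<in> Hom C x y \<Longrightarrow> h \<in> Hom C y z \<Longrightarrow>
      Comp C w x z (Comp C x y z h g) f = Comp C w y z h (Comp C w x y g f)"
  shows "category C"
  unfolding category_def by (intro conjI ballI; rule assms; assumption)

section \<open>Functors, natural transformations and functor categories\<close>

lemma functor_obj: "is_functor C D F \<Longrightarrow> x \<in> Obj C \<Longrightarrow> FObj F x \<in> Obj D"
  by (auto simp: is_functor_def)

lemma functor_mor:
  "is_functor C D F \<Longrightarrow> x \<in> Obj C \<Longrightarrow> y \<in> Obj C \<Longrightarrow> f \<in> Hom C x y \<Longrightarrow>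
    FMor F x y f \<in> Hom D (FObj F x) (FObj F y)"
  by (auto simp: is_functor_def)

lemma functor_ide:
  "is_functor C D F \<Longrightarrow> x \<in> Obj C \<Longrightarrow> FMor F x x (Ide C x) = Ide D (FObj F x)"
  by (auto simp: is_functor_def)

lemma functor_comp:
  "is_functor C D F \<Longrightarrow> x \<in> Obj C \<Longrightarrow> y \<in> Obj C \<Longrightarrow> z \<in> Obj C \<Longrightarrow>
    f \<in> Hom C x y \<Longrightarrow> g \<in> Hom C y z \<Longrightarrow>
    FMor F x z (Comp C x y z g f) =
      Comp D (FObj F x) (FObj F y) (FObj F z) (FMor F y z g) (FMor F x y f)"
  by (auto simp: is_functor_def)

text \<open>Values off the domain are set to \<open>undefined\<close> once and for all, as
  \<open>is_functor\<close> requires; \<open>id_functor\<close> and \<open>comp_functor\<close>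
  unfold to instances.\<close>

definition mk_functor ::
  "('o, 'm) cat \<Rightarrow> ('o \<Rightarrow> 'p) \<Rightarrow> ('o \<Rightarrow> 'o \<Rightarrow> 'm \<Rightarrow> 'n) \<Rightarrow> ('o, 'm, 'p, 'n) fctr" where
  "mk_functor C a b = \<lparr>FObj = (\<lambda>x\<in>Obj C. a x),
     FMor = (\<lambda>x y. if x \<in> Obj C \<and> y \<in> Obj C then (\<lambda>f\<in>Hom C x y. b x y f) else (\<lambda>f. undefined))\<rparr>"

lemma mk_functor_simps [simp]:
  "x \<in> Obj C \<Longrightarrow> FObj (mk_functor C a b) x = a x"
  "x \<in> Obj C \<Longrightarrow> y \<in> Obj C \<Longrightarrow> f \<in> Hom C x y \<Longrightarrow> FMor (mk_functor C a b) x y f = b x y f"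
  by (simp_all add: mk_functor_def)

text \<open>The two closure premises on \<open>C\<close> place identities and composites inside the
  hom-sets on which \<open>b\<close> survives the restriction.\<close>

lemma is_functor_mk_functor:
  assumes "\<And>x. x \<in> Obj C \<Longrightarrow> Ide C x \<in> Hom C x x"
    and "\<And>x y z f g. x \<in> Obj C \<Longrightarrow> y \<in> Obj C \<Longrightarrow> z \<in> Obj C \<Longrightarrow> f \<in> Hom C x y \<Longrightarrow> g \<in> Hom C y z \<Longrightarrow>
      Comp C x y z g f \<in> Hom C x z"
    and "\<And>x. x \<in> Obj C \<Longrightarrow> a x \<in> Obj D"
    and "\<And>x y f. x \<in> Obj C \<Longrightarrow> y \<in> Obj C \<Longrightarrow> f \<in> Hom C x y \<Longrightarrow> b x y f \<in> Hom D (a x) (a y)"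
    and "\<And>x. x \<in> Obj C \<Longrightarrow> b x x (Ide C x) = Ide D (a x)"
    and "\<And>x y z f g. x \<in> Obj C \<Longrightarrow> y \<in> Obj C \<Longrightarrow> z \<in> Obj C \<Longrightarrow> f \<in> Hom C x y \<Longrightarrow> g \<in> Hom C y z \<Longrightarrow>
      b x z (Comp C x y z g f) = Comp D (a x) (a y) (a z) (b y z g) (b x y f)"
  shows "is_functor C D (mk_functor C a b)"
  using assms unfolding is_functor_def by (auto simp: mk_functor_def)

lemma is_functor_id: "category C \<Longrightarrow> is_functor C C (id_functor C)"
  using is_functor_mk_functor[of C "\<lambda>x. x" C "\<lambda>x y f. f"]
  by (simp add: id_functor_def mk_functor_def category_def)

lemma is_functor_comp:
  assumes "category C" "is_functor C D F" "is_functor D E G"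
  shows "is_functor C E (comp_functor C G F)"
proof -
  have "is_functor C E (mk_functor C (\<lambda>x. FObj G (FObj F x))
      (\<lambda>x y f. FMor G (FObj F x) (FObj F y) (FMor F x y f)))"
    using assms
    by (intro is_functor_mk_functor)
      (auto simp: cat_ide cat_comp functor_obj functor_mor functor_ide functor_comp)
  then show ?thesis by (simp add: comp_functor_def mk_functor_def)
qed

lemma nat_trans_mor:
  "\<eta> \<in> nat_trans C D F G \<Longrightarrow> x \<in> Obj C \<Longrightarrow> \<eta> x \<in> Hom D (FObj F x) (FObj G x)"
  by (auto simp: nat_trans_def)

lemma nat_trans_natural:
  "\<eta> \<in> nat_trans C D F G \<Longrightarrow> x \<in> Obj C \<Longrightarrow> y \<in> Obj C \<Longrightarrow> f \<in> Hom C x y \<Longrightarrow>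
    Comp D (FObj F x) (FObj F y) (FObj G y) (\<eta> y) (FMor F x y f) =
    Comp D (FObj F x) (FObj G x) (FObj G y) (FMor G x y f) (\<eta> x)"
  by (auto simp: nat_trans_def)

lemma nat_trans_extensional: "\<eta> \<in> nat_trans C D F G \<Longrightarrow> \<eta> \<in> extensional (Obj C)"
  by (auto simp: nat_trans_def PiE_def)

lemma nat_transI:
  assumes "\<eta> \<in> extensional (Obj C)"
    and "\<And>x. x \<in> Obj C \<Longrightarrow> \<eta> x \<in> Hom D (FObj F x) (FObj G x)"
    and "\<And>x y f. x \<in> Obj C \<Longrightarrow> y \<in> Obj C \<Longrightarrow> f \<in> Hom C x y \<Longrightarrow>
      Comp D (FObj F x) (FObj F y) (FObj G y) (\<eta> y) (FMor F x y f) =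
      Comp D (FObj F x) (FObj G x) (FObj G y) (FMor G x y f) (\<eta> x)"
  shows "\<eta> \<in> nat_trans C D F G"
  using assms by (auto simp: nat_trans_def PiE_def)

lemma Fun_cat_simps [simp]:
  "Obj (Fun_cat C D) = {F. is_functor C D F}"
  "Hom (Fun_cat C D) = nat_trans C D"
  "Ide (Fun_cat C D) F = (\<lambda>x\<in>Obj C. Ide D (FObj F x))"
  "Comp (Fun_cat C D) F G H \<theta> \<eta> = (\<lambda>x\<in>Obj C. Comp D (FObj F x) (FObj G x) (FObj H x) (\<theta> x) (\<eta> x))"
  by (simp_all add: Fun_cat_def)

text \<open>All laws hold pointwise in \<open>D\<close>. The one real step is that a composite is
  natural, by pasting the two naturality squares.\<close>

lemma category_Fun_cat:
  assumes D: "category D"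
  shows "category (Fun_cat C D)"
proof (rule categoryI, goal_cases)
  case (1 F)
  then show ?case
    by (auto intro!: nat_transI simp: functor_obj functor_mor cat_ide[OF D] cat_ide_left[OF D]
        cat_ide_right[OF D])
next
  case (2 F G H \<eta> \<theta>)
  then have F: "is_functor C D F" "is_functor C D G" "is_functor C D H"
    and n: "\<eta> \<in> nat_trans C D F G" "\<theta> \<in> nat_trans C D G H" by simp_all
  note o = functor_obj[OF F(1)] functor_obj[OF F(2)] functor_obj[OF F(3)]
  note m = functor_mor[OF F(1)] functor_mor[OF F(2)] functor_mor[OF F(3)]
    nat_trans_mor[OF n(1)] nat_trans_mor[OF n(2)]
  show ?case
  proof (clarsimp, rule nat_transI)
    fix x y f assume x: "x \<in> Obj C" "y \<in> Obj C" "f \<in> Hom C x y"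
    let ?c = "Comp D"
    have "?c (FObj F x) (FObj F y) (FObj H y) (?c (FObj F y) (FObj G y) (FObj H y) (\<theta> y) (\<eta> y)) (FMor F x y f)
      = ?c (FObj F x) (FObj G y) (FObj H y) (\<theta> y) (?c (FObj F x) (FObj F y) (FObj G y) (\<eta> y) (FMor F x y f))"
      using x by (simp add: cat_assoc[OF D] o m)
    also have "\<dots> = ?c (FObj F x) (FObj G y) (FObj H y) (\<theta> y) (?c (FObj F x) (FObj G x) (FObj G y) (FMor G x y f) (\<eta> x))"
      using x by (simp add: nat_trans_natural[OF n(1)])
    also have "\<dots> = ?c (FObj F x) (FObj G x) (FObj H y) (?c (FObj G x) (FObj G y) (FObj H y) (\<theta> y) (FMor G x y f)) (\<eta> x)"
      using x by (simp add: cat_assoc[OF D] o m)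
    also have "\<dots> = ?c (FObj F x) (FObj G x) (FObj H y) (?c (FObj G x) (FObj H x) (FObj H y) (FMor H x y f) (\<theta> x)) (\<eta> x)"
      using x by (simp add: nat_trans_natural[OF n(2)])
    also have "\<dots> = ?c (FObj F x) (FObj H x) (FObj H y) (FMor H x y f) (?c (FObj F x) (FObj G x) (FObj H x) (\<theta> x) (\<eta> x))"
      using x by (simp add: cat_assoc[OF D] o m)
    finally show "?c (FObj F x) (FObj F y) (FObj H y) ((\<lambda>x\<in>Obj C. ?c (FObj F x) (FObj G x) (FObj H x) (\<theta> x) (\<eta> x)) y) (FMor F x y f) =
       ?c (FObj F x) (FObj H x) (FObj H y) (FMor H x y f) ((\<lambda>x\<in>Obj C. ?c (FObj F x) (FObj G x) (FObj H x) (\<theta> x) (\<eta> x)) x)"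
      using x by simp
  qed (auto intro!: cat_comp[OF D] o m)
next
  case (3 F G \<eta>)
  then show ?case
    by (auto intro!: extensionalityI[OF _ nat_trans_extensional] simp: cat_ide_right[OF D] functor_obj nat_trans_mor)
next
  case (4 F G \<eta>)
  then show ?case
    by (auto intro!: extensionalityI[OF _ nat_trans_extensional] simp: cat_ide_left[OF D] functor_obj nat_trans_mor)
next
  case (5 F G H K \<eta> \<theta> \<kappa>)
  then show ?case
    by (auto intro!: restrict_ext cat_assoc[OF D] functor_obj nat_trans_mor)
qed

text \<open>Naturality is required of \<open>a\<close> only: composing its square with the pointwise
  inverses on both sides yields the square of \<open>b\<close>.\<close>

lemma isomorphic_Fun_catI:
  assumes D: "category D" and F: "is_functor C D F" and G: "is_functor C D G"
    and a: "\<And>x. x \<in> Obj C \<Longrightarrow> a x \<in> Hom D (FObj F x) (FObj G x)"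
    and b: "\<And>x. x \<in> Obj C \<Longrightarrow> b x \<in> Hom D (FObj G x) (FObj F x)"
    and ba: "\<And>x. x \<in> Obj C \<Longrightarrow> Comp D (FObj F x) (FObj G x) (FObj F x) (b x) (a x) = Ide D (FObj F x)"
    and ab: "\<And>x. x \<in> Obj C \<Longrightarrow> Comp D (FObj G x) (FObj F x) (FObj G x) (a x) (b x) = Ide D (FObj G x)"
    and nat: "\<And>x y f. x \<in> Obj C \<Longrightarrow> y \<in> Obj C \<Longrightarrow> f \<in> Hom C x y \<Longrightarrow>
      Comp D (FObj F x) (FObj F y) (FObj G y) (a y) (FMor F x y f) =
      Comp D (FObj F x) (FObj G x) (FObj G y) (FMor G x y f) (a x)"
  shows "isomorphic (Fun_cat C D) F G"
proof -
  let ?c = "Comp D"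
  note o = functor_obj[OF F] functor_obj[OF G]
  note m = functor_mor[OF F] functor_mor[OF G] a b
  have "(\<lambda>x\<in>Obj C. a x) \<in> nat_trans C D F G"
    by (rule nat_transI) (auto simp: a nat)
  moreover have "(\<lambda>x\<in>Obj C. b x) \<in> nat_trans C D G F"
  proof (rule nat_transI)
    fix x y f assume x: "x \<in> Obj C" "y \<in> Obj C" "f \<in> Hom C x y"
    \<comment> \<open>The identity, written as \<open>a x\<close> after \<open>b x\<close>, is
      inserted so that naturality of \<open>a\<close> applies; afterwards \<open>b y\<close> cancels
      \<open>a y\<close>.\<close>
    have "?c (FObj G x) (FObj G y) (FObj F y) (b y) (FMor G x y f) =
      ?c (FObj G x) (FObj G y) (FObj F y) (b y)
       (?c (FObj G x) (FObj G x) (FObj G y) (FMor G x y f) (?c (FObj G x) (FObj F x) (FObj G x) (a x) (b x)))"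
      using x by (simp add: ab cat_ide_right[OF D] o m)
    also have "\<dots> = ?c (FObj G x) (FObj G y) (FObj F y) (b y)
       (?c (FObj G x) (FObj F x) (FObj G y) (?c (FObj F x) (FObj G x) (FObj G y) (FMor G x y f) (a x)) (b x))"
      using x by (simp add: cat_assoc[OF D] o m)
    also have "\<dots> = ?c (FObj G x) (FObj G y) (FObj F y) (b y)
       (?c (FObj G x) (FObj F x) (FObj G y) (?c (FObj F x) (FObj F y) (FObj G y) (a y) (FMor F x y f)) (b x))"
      using x by (simp add: nat)
    also have "\<dots> = ?c (FObj G x) (FObj F x) (FObj F y) (?c (FObj F x) (FObj F y) (FObj F y)
       (?c (FObj F y) (FObj G y) (FObj F y) (b y) (a y)) (FMor F x y f)) (b x)"
      using x by (simp add: cat_assoc[OF D] cat_comp[OF D] o m del: ba)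
    also have "\<dots> = ?c (FObj G x) (FObj F x) (FObj F y) (FMor F x y f) (b x)"
      using x by (simp add: ba cat_ide_left[OF D] o m)
    finally show "?c (FObj G x) (FObj G y) (FObj F y) ((\<lambda>x\<in>Obj C. b x) y) (FMor G x y f) =
       ?c (FObj G x) (FObj F x) (FObj F y) (FMor F x y f) ((\<lambda>x\<in>Obj C. b x) x)"
      using x by simp
  qed (auto simp: b)
  moreover have "Comp (Fun_cat C D) F G F (\<lambda>x\<in>Obj C. b x) (\<lambda>x\<in>Obj C. a x) = Ide (Fun_cat C D) F"
    "Comp (Fun_cat C D) G F G (\<lambda>x\<in>Obj C. a x) (\<lambda>x\<in>Obj C. b x) = Ide (Fun_cat C D) G"
    by (auto intro!: restrict_ext simp: ab ba)
  ultimately show ?thesis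
    unfolding isomorphic_def using F G by (simp only: Fun_cat_simps(1,2) mem_Collect_eq) blast
qed

text \<open>A quasi-inverse picks for each \<open>d\<close> an object \<open>g d\<close> whose image
  is isomorphic to \<open>d\<close>, transports morphisms along these isomorphisms, and lifts the
  result through the hom-set bijections. Faithfulness turns every equation needed in
  \<open>C\<close> into one in \<open>D\<close>.\<close>

theorem equivalent_categories_if_fully_faithful_surj:
  assumes C: "category C" and D: "category D" and F: "is_functor C D F"
    and ff: "\<And>x y. x \<in> Obj C \<Longrightarrow> y \<in> Obj C \<Longrightarrow>
      bij_betw (FMor F x y) (Hom C x y) (Hom D (FObj F x) (FObj F y))"
    and es: "\<And>d. d \<in> Obj D \<Longrightarrow> \<exists>c\<in>Obj C. isomorphic D (FObj F c) d"
  shows "equivalent_categories C D"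
proof -
  let ?c = "Comp D"
  have "\<forall>d\<in>Obj D. \<exists>c e e'. c \<in> Obj C \<and> e \<in> Hom D (FObj F c) d \<and> e' \<in> Hom D d (FObj F c) \<and>
     ?c (FObj F c) d (FObj F c) e' e = Ide D (FObj F c) \<and> ?c d (FObj F c) d e e' = Ide D d"
    using es unfolding isomorphic_def by metis
  then obtain g e e' where g: "\<And>d. d \<in> Obj D \<Longrightarrow> g d \<in> Obj C"
    and e: "\<And>d. d \<in> Obj D \<Longrightarrow> e d \<in> Hom D (FObj F (g d)) d"
    and e': "\<And>d. d \<in> Obj D \<Longrightarrow> e' d \<in> Hom D d (FObj F (g d))"
    and e'e: "\<And>d. d \<in> Obj D \<Longrightarrow> ?c (FObj F (g d)) d (FObj F (g d)) (e' d) (e d) = Ide D (FObj F (g d))"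
    and ee': "\<And>d. d \<in> Obj D \<Longrightarrow> ?c d (FObj F (g d)) d (e d) (e' d) = Ide D d"
    by (simp only: bchoice_iff) metis
  note o = functor_obj[OF F] g
  note m = functor_mor[OF F] e e'
  define lift where "lift x y h = inv_into (Hom C x y) (FMor F x y) h" for x y h
  have lift: "lift x y h \<in> Hom C x y" "FMor F x y (lift x y h) = h"
    if "x \<in> Obj C" "y \<in> Obj C" "h \<in> Hom D (FObj F x) (FObj F y)" for x y h
    using that ff[of x y] unfolding lift_def bij_betw_def
    by (auto intro: inv_into_into f_inv_into_f)
  have faithful: "f = f'"
    if "FMor F x y f = FMor F x y f'" "x \<in> Obj C" "y \<in> Obj C" "f \<in> Hom C x y" "f' \<in> Hom C x y" for x y f f'
    using that ff[of x y] by (auto simp: bij_betw_def inj_on_def)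
  \<comment> \<open>Conjugation by the chosen isomorphisms makes \<open>h\<close> a morphism between
    images of \<open>F\<close>, to which \<open>lift\<close> applies.\<close>
  define conj where "conj d d' h = ?c (FObj F (g d)) d' (FObj F (g d')) (e' d') (?c (FObj F (g d)) d d' h (e d))" for d d' h
  have conj: "conj d d' h \<in> Hom D (FObj F (g d)) (FObj F (g d'))"
    if "d \<in> Obj D" "d' \<in> Obj D" "h \<in> Hom D d d'" for d d' h
    unfolding conj_def using that by (intro cat_comp[OF D]) (auto simp: o m intro: cat_comp[OF D])
  have e_conj: "?c (FObj F (g d)) (FObj F (g d')) d' (e d') (conj d d' h) = ?c (FObj F (g d)) d d' h (e d)"
    if "d \<in> Obj D" "d' \<in> Obj D" "h \<in> Hom D d d'" for d d' h
  proof -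
    have "?c (FObj F (g d)) (FObj F (g d')) d' (e d') (conj d d' h) =
      ?c (FObj F (g d)) d' d' (?c d' (FObj F (g d')) d' (e d') (e' d')) (?c (FObj F (g d)) d d' h (e d))"
      unfolding conj_def using that by (simp add: cat_assoc[OF D] cat_comp[OF D] o m)
    then show ?thesis using that by (simp add: ee' cat_ide_left[OF D] cat_comp[OF D] o m)
  qed
  \<comment> \<open>\<open>conj d d' h\<close> is the only morphism that closes the square formed by
    \<open>h\<close>, \<open>e d\<close> and \<open>e d'\<close>, so preservation of identities and
    composites follows by exhibiting commuting squares.\<close>
  have conj_unique: "k = conj d d' h"
    if d: "d \<in> Obj D" "d' \<in> Obj D" "h \<in> Hom D d d'" and k: "k \<in> Hom D (FObj F (g d)) (FObj F (g d'))"
      and eq: "?c (FObj F (g d)) (FObj F (g d')) d' (e d') k = ?c (FObj F (g d)) d d' h (e d)" for d d' h k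
  proof -
    have "conj d d' h = ?c (FObj F (g d)) d' (FObj F (g d')) (e' d') (?c (FObj F (g d)) (FObj F (g d')) d' (e d') k)"
      by (simp add: conj_def eq)
    also have "\<dots> = ?c (FObj F (g d)) (FObj F (g d')) (FObj F (g d')) (?c (FObj F (g d')) d' (FObj F (g d')) (e' d') (e d')) k"
      using d k by (simp add: cat_assoc[OF D] o m)
    also have "\<dots> = k" using d k by (simp add: e'e cat_ide_left[OF D] o)
    finally show ?thesis by simp
  qed
  have conj_ide: "conj d d (Ide D d) = Ide D (FObj F (g d))" if "d \<in> Obj D" for d
    using that by (intro conj_unique[symmetric])
      (auto simp: cat_ide[OF D] cat_ide_left[OF D] cat_ide_right[OF D] o m)
  have conj_comp: "conj d d'' (?c d d' d'' k h) =
      ?c (FObj F (g d)) (FObj F (g d')) (FObj F (g d'')) (conj d' d'' k) (conj d d' h)"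
    if d: "d \<in> Obj D" "d' \<in> Obj D" "d'' \<in> Obj D" "h \<in> Hom D d d'" "k \<in> Hom D d' d''" for d d' d'' h k
  proof (rule conj_unique[symmetric])
    have "?c (FObj F (g d)) (FObj F (g d'')) d'' (e d'')
        (?c (FObj F (g d)) (FObj F (g d')) (FObj F (g d'')) (conj d' d'' k) (conj d d' h))
      = ?c (FObj F (g d)) (FObj F (g d')) d''
        (?c (FObj F (g d')) (FObj F (g d'')) d'' (e d'') (conj d' d'' k)) (conj d d' h)"
      using d by (simp add: cat_assoc[OF D] o m conj)
    also have "\<dots> = ?c (FObj F (g d)) d' d'' k (?c (FObj F (g d)) (FObj F (g d')) d' (e d') (conj d d' h))"
      using d by (subst e_conj) (simp_all add: cat_assoc[OF D] o m conj)
    also have "\<dots> = ?c (FObj F (g d)) d d'' (?c d d' d'' k h) (e d)"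
      using d by (subst e_conj) (simp_all add: cat_assoc[OF D] o m)
    finally show "?c (FObj F (g d)) (FObj F (g d'')) d'' (e d'')
        (?c (FObj F (g d)) (FObj F (g d')) (FObj F (g d'')) (conj d' d'' k) (conj d d' h))
      = ?c (FObj F (g d)) d d'' (?c d d' d'' k h) (e d)" .
  qed (use d in \<open>auto intro!: cat_comp[OF D] simp: o conj\<close>)
  define G where "G = mk_functor D g (\<lambda>d d' h. lift (g d) (g d') (conj d d' h))"
  have G: "is_functor D C G"
    unfolding G_def
  proof (rule is_functor_mk_functor, goal_cases)
    case (5 d)
    then show ?case
      by (intro faithful[of "g d" "g d"])
        (simp_all add: lift conj_ide cat_ide[OF D] cat_ide[OF C] o functor_ide[OF F])
  next
    case (6 d d' d'' h k)
    then show ?case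
      by (intro faithful[of "g d" "g d''"])
        (auto simp: lift conj conj_comp cat_comp[OF D] o functor_comp[OF F] intro!: cat_comp[OF C])
  qed (auto simp: cat_ide[OF D] cat_comp[OF D] g lift conj)
  have GO: "FObj G d = g d" if "d \<in> Obj D" for d using that by (simp add: G_def)
  have GM: "FMor G d d' h = lift (g d) (g d') (conj d d' h)"
    if "d \<in> Obj D" "d' \<in> Obj D" "h \<in> Hom D d d'" for d d' h using that by (simp add: G_def)
  have "isomorphic (Fun_cat D D) (comp_functor D F G) (id_functor D)"
    by (rule isomorphic_Fun_catI[OF D is_functor_comp[OF D G F] is_functor_id[OF D], where a = e and b = e'])
      (auto simp: comp_functor_def id_functor_def GO GM e e' ee' e'e lift conj e_conj g)
  \<comment> \<open>At \<open>FObj F c\<close> the isomorphism \<open>e\<close> and its inverse join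
    two objects in the image of \<open>F\<close>, so both lift to \<open>C\<close>; their equations
    are tested after applying \<open>F\<close>.\<close>
  moreover have "isomorphic (Fun_cat C C) (comp_functor C G F) (id_functor C)"
  proof (rule isomorphic_Fun_catI[OF C is_functor_comp[OF C F G] is_functor_id[OF C],
        where a = "\<lambda>c. lift (g (FObj F c)) c (e (FObj F c))" and b = "\<lambda>c. lift c (g (FObj F c)) (e' (FObj F c))"],
        goal_cases)
    case (3 c)
    then show ?case
      by (simp add: comp_functor_def id_functor_def GO o)
        (rule faithful[of "g (FObj F c)" "g (FObj F c)"];
          simp add: cat_comp[OF C] cat_ide[OF C] o m lift functor_comp[OF F] functor_ide[OF F] e'e)
  next
    case (4 c)
    then show ?case
      by (simp add: comp_functor_def id_functor_def GO o)
        (rule faithful[of c c];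
          simp add: cat_comp[OF C] cat_ide[OF C] o m lift functor_comp[OF F] functor_ide[OF F] ee')
  next
    case (5 c c' f)
    then show ?case
      by (simp add: comp_functor_def id_functor_def GO GM o m)
        (rule faithful[of "g (FObj F c)" c'];
          simp add: cat_comp[OF C] o m lift conj functor_comp[OF F] e_conj)
  qed (auto simp: comp_functor_def id_functor_def GO o m lift)
  ultimately show ?thesis
    unfolding equivalent_categories_def using C D F G by blast
qed

section \<open>Simplicial sets with an action\<close>

lemma opp_simps [simp]:
  "Obj (opp C) = Obj C" "Hom (opp C) x y = Hom C y x" "Ide (opp C) = Ide C"
  "Comp (opp C) x y z g f = Comp C z y x f g"
  by (simp_all add: opp_def)

lemma Set_cat_simps [simp]:
  "Obj (Set_cat U) = U" "Hom (Set_cat U) A B = A \<rightarrow>\<^sub>E B" "Ide (Set_cat U) A = (\<lambda>x\<in>A. x)"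
  "Comp (Set_cat U) A B D g f = compose A g f"
  by (simp_all add: Set_cat_def)

lemma Pointed_set_cat_simps [simp]:
  "x \<in> Obj (Pointed_set_cat U) \<longleftrightarrow> fst x \<in> U \<and> snd x \<in> fst x"
  "Hom (Pointed_set_cat U) x y = {f \<in> fst x \<rightarrow>\<^sub>E fst y. f (snd x) = snd y}"
  "Ide (Pointed_set_cat U) x = (\<lambda>a\<in>fst x. a)"
  "Comp (Pointed_set_cat U) x y z g f = compose (fst x) g f"
  by (auto simp: Pointed_set_cat_def split_beta)

lemma Ab_cat_simps [simp]:
  "Obj (Ab_cat U) = {A. comm_group A \<and> carrier A \<in> U}"
  "Hom (Ab_cat U) A B = hom A B \<inter> extensional (carrier A)"
  "Ide (Ab_cat U) A = (\<lambda>x\<in>carrier A. x)"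
  "Comp (Ab_cat U) A B D g f = compose (carrier A) g f"
  by (simp_all add: Ab_cat_def Groups_in_def)

lemma compose_in_PiE: "f \<in> A \<rightarrow>\<^sub>E B \<Longrightarrow> g \<in> B \<rightarrow>\<^sub>E D \<Longrightarrow> compose A g f \<in> A \<rightarrow>\<^sub>E D"
  by (auto simp: compose_def PiE_iff)

lemma compose_restrict_id_right: "f \<in> A \<rightarrow>\<^sub>E B \<Longrightarrow> compose A f (\<lambda>x\<in>A. x) = f"
  by (rule extensionalityI[of _ A]) (auto simp: compose_def PiE_def)

lemma compose_restrict_id_left: "f \<in> A \<rightarrow>\<^sub>E B \<Longrightarrow> compose A (\<lambda>x\<in>B. x) f = f"
  by (rule extensionalityI[of _ A]) (auto simp: compose_def PiE_def)

lemma compose_compose: "f \<in> A \<rightarrow>\<^sub>E B \<Longrightarrow> compose A (compose B h g) f = compose A h (compose A g f)"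
  by (rule extensionalityI[of _ A]) (auto simp: compose_def)

lemma compose_in_hom:
  "group A \<Longrightarrow> f \<in> hom A B \<Longrightarrow> g \<in> hom B D \<Longrightarrow> compose (carrier A) g f \<in> hom A D"
  by (auto simp: hom_def compose_def Pi_iff group.is_monoid monoid.m_closed)

lemma category_Pointed_set_cat: "category (Pointed_set_cat U)"
proof (rule categoryI, goal_cases)
  case (2 x y z f g)
  then show ?case
    using compose_in_PiE[of f "fst x" "fst y" g "fst z"] by (simp add: compose_eq)
qed (auto simp: compose_restrict_id_left compose_restrict_id_right compose_compose)

lemma category_Ab_cat: "category (Ab_cat U)"
proof (rule categoryI, goal_cases)
  case (1 A)
  then show ?case
    by (auto simp: hom_def comm_group.axioms(2) group.is_monoid monoid.m_closed)
next
  case (2 A B D f g)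
  then show ?case
    by (auto intro!: compose_in_hom simp: comm_group.axioms(2))
next
  case (3 A B f)
  then show ?case
    using compose_restrict_id_right[of f "carrier A" "carrier B"] by (simp add: hom_def PiE_def)
next
  case (4 A B f)
  then show ?case
    using compose_restrict_id_left[of f "carrier A" "carrier B"] by (simp add: hom_def PiE_def)
next
  case (5 A B D E f g h)
  then show ?case
    using compose_compose[of f "carrier A" "carrier B" h g] by (simp add: hom_def PiE_def)
qed

lemma Delta_simps [simp]:
  "Obj Delta = UNIV"
  "Hom Delta m n = {\<alpha> \<in> {..m} \<rightarrow>\<^sub>E {..n}. mono_on {..m} \<alpha>}"
  "Ide Delta n = (\<lambda>i\<in>{..n}. i)"
  "Comp Delta l m n \<beta> \<alpha> = compose {..l} \<beta> \<alpha>"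
  by (simp_all add: Delta_def)

lemma category_Delta: "category Delta"
proof (rule categoryI, goal_cases)
  case (2 l m n \<alpha> \<beta>)
  then have "compose {..l} \<beta> \<alpha> \<in> {..l} \<rightarrow>\<^sub>E {..n}"
    using compose_in_PiE[of \<alpha> "{..l}" "{..m}" \<beta> "{..n}"] by simp
  moreover have "mono_on {..l} (compose {..l} \<beta> \<alpha>)"
    using 2 by (auto simp: mono_on_def compose_def PiE_iff)
  ultimately show ?case by simp
qed (auto simp: compose_restrict_id_left compose_restrict_id_right compose_compose mono_on_def)

text \<open>From here on \<open>Delta\<close> enters through its category laws, so its hom-sets and
  composites stay folded.\<close>

declare Delta_simps(2-4) [simp del]

lemma category_Retractive:
  assumes C: "category C" and W: "W \<in> Obj C"
  shows "category (Retractive C W)"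
proof (rule categoryI, goal_cases)
  case (2 A B D f g)
  obtain X r s Y r' s' Z r'' s'' where [simp]: "A = (X, r, s)" "B = (Y, r', s')" "D = (Z, r'', s'')"
    by (metis prod_cases3)
  note * = 2[unfolded Retractive_def, simplified]
  have "Comp C X Z W r'' (Comp C X Y Z g f) = Comp C X Y W (Comp C Y Z W r'' g) f"
    using * W by (intro cat_assoc[OF C, symmetric]) auto
  moreover have "Comp C W X Z (Comp C X Y Z g f) s = Comp C W Y Z g (Comp C W X Y f s)"
    using * W by (intro cat_assoc[OF C]) auto
  ultimately show ?case
    using * by (simp add: Retractive_def cat_comp[OF C])
next
  case (5 A B D E f g h)
  then show ?case by (auto simp: Retractive_def cat_assoc[OF C])
qed (use W in \<open>auto simp: Retractive_def cat_ide[OF C] cat_ide_left[OF C] cat_ide_right[OF C]\<close>)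

section \<open>Spaces with an action of a simplicial group\<close>

abbreviation cells :: "('u, 'g) gspace \<Rightarrow> nat \<Rightarrow> 'u set" where
  "cells X \<equiv> FObj (Under X)"

locale simplicial_group_action =
  fixes U :: "'u set set" and G :: "'g sgroup"
  assumes simplicial_group: "simplicial_group G"
begin

abbreviation Gn :: "nat \<Rightarrow> 'g monoid" where "Gn \<equiv> FObj G"

lemma group_Gn: "group (Gn n)"
  using simplicial_group functor_obj[of "opp Delta" Grp_cat G n]
  by (simp add: simplicial_group_def Grp_cat_def Groups_in_def)

lemma monoid_Gn: "monoid (Gn n)"
  using group_Gn group.is_monoid by blast

lemma hom_Gn: "\<alpha> \<in> Hom Delta m n \<Longrightarrow> FMor G n m \<alpha> \<in> hom (Gn n) (Gn m)"
  using simplicial_group functor_mor[of "opp Delta" Grp_cat G n m \<alpha>]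
  by (simp add: simplicial_group_def Grp_cat_def Groups_in_def)

lemma mor_Gn [simp]:
  "\<alpha> \<in> Hom Delta m n \<Longrightarrow> g \<in> carrier (Gn n) \<Longrightarrow> FMor G n m \<alpha> g \<in> carrier (Gn m)"
  "\<alpha> \<in> Hom Delta m n \<Longrightarrow> FMor G n m \<alpha> \<one>\<^bsub>Gn n\<^esub> = \<one>\<^bsub>Gn m\<^esub>"
  using hom_Gn[of \<alpha> m n] group_Gn by (auto simp: hom_def Pi_iff hom_one)

lemma mor_Ide_Gn [simp]: "g \<in> carrier (Gn n) \<Longrightarrow> FMor G n n (Ide Delta n) g = g"
  using simplicial_group functor_ide[of "opp Delta" Grp_cat G n]
  by (simp add: simplicial_group_def Grp_cat_def Groups_in_def)

lemma Gn_simps [simp]: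
  "\<one>\<^bsub>Gn n\<^esub> \<in> carrier (Gn n)"
  "g \<in> carrier (Gn n) \<Longrightarrow> h \<in> carrier (Gn n) \<Longrightarrow> g \<otimes>\<^bsub>Gn n\<^esub> h \<in> carrier (Gn n)"
  "g \<in> carrier (Gn n) \<Longrightarrow> g \<otimes>\<^bsub>Gn n\<^esub> \<one>\<^bsub>Gn n\<^esub> = g"
  "g \<in> carrier (Gn n) \<Longrightarrow> \<one>\<^bsub>Gn n\<^esub> \<otimes>\<^bsub>Gn n\<^esub> g = g"
  using monoid_Gn by (auto simp: monoid.m_closed monoid.r_one monoid.l_one)

lemma Delta_comps [simp]:
  "Ide Delta n \<in> Hom Delta n n"
  "\<alpha> \<in> Hom Delta l m \<Longrightarrow> \<beta> \<in> Hom Delta m n \<Longrightarrow> Comp Delta l m n \<beta> \<alpha> \<in> Hom Delta l n"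
  "\<alpha> \<in> Hom Delta m n \<Longrightarrow> Comp Delta m m n \<alpha> (Ide Delta m) = \<alpha>"
  "\<alpha> \<in> Hom Delta m n \<Longrightarrow> Comp Delta m n n (Ide Delta n) \<alpha> = \<alpha>"
  using category_Delta
  by (auto simp: cat_ide cat_comp cat_ide_left cat_ide_right)

text \<open>Both kinds of structure are special cases: the pair \<open>(\<alpha>, 1)\<close> gives
  the simplicial operator of \<open>\<alpha>\<close>, and \<open>(id, g)\<close> gives the action of
  \<open>g\<close>.\<close>

definition pull :: "('u, 'g) gspace \<Rightarrow> nat \<Rightarrow> nat \<Rightarrow> (nat \<Rightarrow> nat) \<times> 'g \<Rightarrow> 'u \<Rightarrow> 'u" where
  "pull X n m \<phi> x = Act X m (FMor (Under X) n m (fst \<phi>) x) (snd \<phi>)"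

text \<open>The morphisms \<open>(\<alpha>, g)\<close> of the simplex category with the simplices of \<open>W\<close> they connect forgotten.\<close>

definition ops :: "nat \<Rightarrow> nat \<Rightarrow> ((nat \<Rightarrow> nat) \<times> 'g) set" where
  "ops m n = Hom Delta m n \<times> carrier (Gn m)"

definition ops_ide :: "nat \<Rightarrow> (nat \<Rightarrow> nat) \<times> 'g" where
  "ops_ide n = (Ide Delta n, \<one>\<^bsub>Gn n\<^esub>)"

definition ops_comp ::
  "nat \<Rightarrow> nat \<Rightarrow> nat \<Rightarrow> (nat \<Rightarrow> nat) \<times> 'g \<Rightarrow> (nat \<Rightarrow> nat) \<times> 'g \<Rightarrow> (nat \<Rightarrow> nat) \<times> 'g" where
  "ops_comp l m n \<psi> \<phi> =
    (Comp Delta l m n (fst \<psi>) (fst \<phi>), FMor G m l (fst \<phi>) (snd \<psi>) \<otimes>\<^bsub>Gn l\<^esub> snd \<phi>)"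

lemma ops_ide [simp]: "ops_ide n \<in> ops n n"
  by (simp add: ops_ide_def ops_def)

lemma ops_comp [simp]: "\<phi> \<in> ops l m \<Longrightarrow> \<psi> \<in> ops m n \<Longrightarrow> ops_comp l m n \<psi> \<phi> \<in> ops l n"
  by (auto simp: ops_comp_def ops_def)

abbreviation GS where "GS \<equiv> GsSet_cat U G"

lemma sSet_cat_simps [simp]:
  "Obj (sSet_cat U) = {X. is_functor (opp Delta) (Set_cat U) X}"
  "Hom (sSet_cat U) = nat_trans (opp Delta) (Set_cat U)"
  "Ide (sSet_cat U) X = (\<lambda>n. \<lambda>x\<in>FObj X n. x)"
  "Comp (sSet_cat U) X Y Z g f = (\<lambda>n. compose (FObj X n) (g n) (f n))"
  by (simp_all add: sSet_cat_def fun_eq_iff)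

lemma GS_simps [simp]:
  "X \<in> Obj GS \<longleftrightarrow> is_functor (opp Delta) (Set_cat U) (Under X) \<and> right_action G (Under X) (Act X)"
  "Ide GS X = (\<lambda>n. \<lambda>x\<in>cells X n. x)"
  "Comp GS X Y Z g f = (\<lambda>n. compose (cells X n) (g n) (f n))"
  by (simp_all add: GsSet_cat_def)

declare GS_simps(1) [simp del]

lemma GS_D:
  assumes "X \<in> Obj GS"
  shows "cells X n \<in> U"
    and "\<alpha> \<in> Hom Delta m n \<Longrightarrow> x \<in> cells X n \<Longrightarrow> FMor (Under X) n m \<alpha> x \<in> cells X m"
    and "x \<in> cells X n \<Longrightarrow> FMor (Under X) n n (Ide Delta n) x = x"
    and "\<alpha> \<in> Hom Delta l m \<Longrightarrow> \<beta> \<in> Hom Delta m n \<Longrightarrow> x \<in> cells X n \<Longrightarrow>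
      FMor (Under X) n l (Comp Delta l m n \<beta> \<alpha>) x = FMor (Under X) m l \<alpha> (FMor (Under X) n m \<beta> x)"
    and "x \<in> cells X n \<Longrightarrow> g \<in> carrier (Gn n) \<Longrightarrow> Act X n x g \<in> cells X n"
    and "x \<in> cells X n \<Longrightarrow> Act X n x \<one>\<^bsub>Gn n\<^esub> = x"
    and "x \<in> cells X n \<Longrightarrow> g \<in> carrier (Gn n) \<Longrightarrow> h \<in> carrier (Gn n) \<Longrightarrow>
      Act X n (Act X n x g) h = Act X n x (g \<otimes>\<^bsub>Gn n\<^esub> h)"
    and "\<alpha> \<in> Hom Delta m n \<Longrightarrow> x \<in> cells X n \<Longrightarrow> g \<in> carrier (Gn n) \<Longrightarrow>
      FMor (Under X) n m \<alpha> (Act X n x g) = Act X m (FMor (Under X) n m \<alpha> x) (FMor G n m \<alpha> g)"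
proof -
  have F: "is_functor (opp Delta) (Set_cat U) (Under X)" and R: "right_action G (Under X) (Act X)"
    using assms by (simp_all add: GS_simps(1))
  show "cells X n \<in> U" using functor_obj[OF F, of n] by simp
  show "\<alpha> \<in> Hom Delta m n \<Longrightarrow> x \<in> cells X n \<Longrightarrow> FMor (Under X) n m \<alpha> x \<in> cells X m"
    using functor_mor[OF F, of n m \<alpha>] by auto
  show "x \<in> cells X n \<Longrightarrow> FMor (Under X) n n (Ide Delta n) x = x"
    using functor_ide[OF F, of n] by simp
  show "\<alpha> \<in> Hom Delta l m \<Longrightarrow> \<beta> \<in> Hom Delta m n \<Longrightarrow> x \<in> cells X n \<Longrightarrow>
      FMor (Under X) n l (Comp Delta l m n \<beta> \<alpha>) x = FMor (Under X) m l \<alpha> (FMor (Under X) n m \<beta> x)"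
    using functor_comp[OF F, of n m l \<beta> \<alpha>] by (simp add: compose_eq)
qed (use assms in \<open>simp_all add: GS_simps(1) right_action_def\<close>)

lemma pull_in [simp]:
  "X \<in> Obj GS \<Longrightarrow> \<phi> \<in> ops m n \<Longrightarrow> x \<in> cells X n \<Longrightarrow> pull X n m \<phi> x \<in> cells X m"
  by (auto simp: pull_def ops_def GS_D)

lemma pull_ide [simp]: "X \<in> Obj GS \<Longrightarrow> x \<in> cells X n \<Longrightarrow> pull X n n (ops_ide n) x = x"
  by (simp add: pull_def ops_ide_def GS_D)

text \<open>The operator of \<open>\<phi>\<close> is moved past the group element of
  \<open>\<psi>\<close> by equivariance, X(\<alpha>)(y h) = X(\<alpha>)(y) G(\<alpha>)(h); this is
  where the twisted product in \<open>ops_comp\<close> comes from.\<close>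

lemma pull_pull:
  "X \<in> Obj GS \<Longrightarrow> \<phi> \<in> ops l m \<Longrightarrow> \<psi> \<in> ops m n \<Longrightarrow> x \<in> cells X n \<Longrightarrow>
    pull X m l \<phi> (pull X n m \<psi> x) = pull X n l (ops_comp l m n \<psi> \<phi>) x"
  by (auto simp: pull_def ops_comp_def ops_def GS_D)

text \<open>Simpliciality and equivariance become a single condition, naturality under
  \<open>ops\<close>. They are recovered from it by testing on \<open>(\<alpha>, 1)\<close> and on
  \<open>(id, g)\<close>.\<close>

lemma GS_hom_iff:
  assumes X: "X \<in> Obj GS" and Y: "Y \<in> Obj GS"
  shows "f \<in> Hom GS X Y \<longleftrightarrow> (\<forall>n. f n \<in> cells X n \<rightarrow>\<^sub>E cells Y n) \<and>
    (\<forall>m n. \<forall>\<phi>\<in>ops m n. \<forall>x\<in>cells X n. f m (pull X n m \<phi> x) = pull Y n m \<phi> (f n x))"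
    (is "?L \<longleftrightarrow> ?P \<and> ?Q")
proof
  assume L: ?L
  then have n: "f \<in> nat_trans (opp Delta) (Set_cat U) (Under X) (Under Y)"
    and eq: "\<And>n x g. x \<in> cells X n \<Longrightarrow> g \<in> carrier (Gn n) \<Longrightarrow> f n (Act X n x g) = Act Y n (f n x) g"
    by (simp_all add: GsSet_cat_def)
  have P: ?P using nat_trans_mor[OF n] by simp
  have "f m (FMor (Under X) n m \<alpha> x) = FMor (Under Y) n m \<alpha> (f n x)"
    if "\<alpha> \<in> Hom Delta m n" "x \<in> cells X n" for m n \<alpha> x
    using nat_trans_natural[OF n, of n m \<alpha>] that by (auto simp: compose_def dest!: fun_cong[of _ _ x])
  then have ?Q using X by (auto simp: pull_def ops_def eq GS_D)
  with P show "?P \<and> ?Q" by blast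
next
  assume PQ: "?P \<and> ?Q"
  then have fx: "f n x \<in> cells Y n" if "x \<in> cells X n" for n x using that by (meson PiE_mem)
  have "f m (FMor (Under X) n m \<alpha> x) = FMor (Under Y) n m \<alpha> (f n x)"
    if "\<alpha> \<in> Hom Delta m n" "x \<in> cells X n" for m n \<alpha> x
  proof -
    have "(\<alpha>, \<one>\<^bsub>Gn m\<^esub>) \<in> ops m n" using that by (simp add: ops_def)
    from PQ[THEN conjunct2, rule_format, OF this that(2)] show ?thesis
      using that X Y fx by (simp add: pull_def GS_D)
  qed
  then have "f \<in> nat_trans (opp Delta) (Set_cat U) (Under X) (Under Y)"
    using PQ by (intro nat_transI) (auto simp: compose_def fun_eq_iff)
  moreover have "f n (Act X n x g) = Act Y n (f n x) g"
    if "x \<in> cells X n" "g \<in> carrier (Gn n)" for n x g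
  proof -
    have "(Ide Delta n, g) \<in> ops n n" using that by (simp add: ops_def)
    from PQ[THEN conjunct2, rule_format, OF this that(1)] show ?thesis
      using that X Y fx by (simp add: pull_def GS_D)
  qed
  ultimately show ?L by (simp add: GsSet_cat_def)
qed

lemma category_GS: "category GS"
proof (rule categoryI, goal_cases)
  case (2 X Y Z f g)
  then have "f n x \<in> cells Y n" if "x \<in> cells X n" for n x
    using that by (simp add: GS_hom_iff) (meson PiE_mem)
  moreover have "g n y \<in> cells Z n" if "y \<in> cells Y n" for n y
    using 2 that by (simp add: GS_hom_iff) (meson PiE_mem)
  ultimately show ?case
    using 2 by (auto simp: GS_hom_iff compose_eq intro!: compose_in_PiE[of "f n" _ "cells Y n" for n])
next
  case (3 X Y f)
  then show ?case
    by (simp add: GS_hom_iff compose_restrict_id_right[of "f n" "cells X n" "cells Y n" for n])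
next
  case (4 X Y f)
  then show ?case
    by (simp add: GS_hom_iff compose_restrict_id_left[of "f n" "cells X n" "cells Y n" for n])
next
  case (5 X Y Z V f g h)
  then show ?case
    by (simp add: GS_hom_iff compose_compose[of "f n" "cells X n" "cells Y n" for n])
qed (auto simp: GS_hom_iff)

text \<open>A converse to \<open>pull\<close>: of an action \<open>P\<close> by all operators, only
  the values at \<open>(\<alpha>, 1)\<close> and \<open>(id, g)\<close> are recorded.\<close>

definition gspace_of ::
  "(nat \<Rightarrow> 'u set) \<Rightarrow> (nat \<Rightarrow> nat \<Rightarrow> (nat \<Rightarrow> nat) \<times> 'g \<Rightarrow> 'u \<Rightarrow> 'u) \<Rightarrow> ('u, 'g) gspace" where
  "gspace_of S P = \<lparr>
     Under = mk_functor (opp Delta) S (\<lambda>n m \<alpha>. \<lambda>x\<in>S n. P n m (\<alpha>, \<one>\<^bsub>Gn m\<^esub>) x),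
     Act = (\<lambda>n x g. if x \<in> S n \<and> g \<in> carrier (Gn n) then P n n (Ide Delta n, g) x else undefined)\<rparr>"

text \<open>An operator \<open>(\<alpha>, g)\<close> acts as \<open>(\<alpha>, 1)\<close> followed
  by \<open>(id, g)\<close>, so \<open>P_comp\<close> recovers \<open>P\<close> from the recorded
  part. Evaluating \<open>(id, g)\<close> followed by \<open>(\<alpha>, 1)\<close> by the same law
  gives equivariance.\<close>

lemma gspace_of:
  assumes S: "\<And>n. S n \<in> U"
    and P: "\<And>m n \<phi> x. \<phi> \<in> ops m n \<Longrightarrow> x \<in> S n \<Longrightarrow> P n m \<phi> x \<in> S m"
    and P_ide: "\<And>n x. x \<in> S n \<Longrightarrow> P n n (ops_ide n) x = x"
    and P_comp: "\<And>l m n \<phi> \<psi> x. \<phi> \<in> ops l m \<Longrightarrow> \<psi> \<in> ops m n \<Longrightarrow> x \<in> S n \<Longrightarrow>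
      P m l \<phi> (P n m \<psi> x) = P n l (ops_comp l m n \<psi> \<phi>) x"
  shows "gspace_of S P \<in> Obj GS"
    and "cells (gspace_of S P) = S"
    and "\<phi> \<in> ops m n \<Longrightarrow> x \<in> S n \<Longrightarrow> pull (gspace_of S P) n m \<phi> x = P n m \<phi> x"
proof -
  have o: "(\<alpha>, g) \<in> ops m n" if "\<alpha> \<in> Hom Delta m n" "g \<in> carrier (Gn m)" for \<alpha> g m n
    using that by (simp add: ops_def)
  show C: "cells (gspace_of S P) = S"
    by (auto simp: gspace_of_def)
  show pull: "pull (gspace_of S P) n m \<phi> x = P n m \<phi> x" if "\<phi> \<in> ops m n" "x \<in> S n" for \<phi> m n x
    using that by (auto simp: pull_def gspace_of_def ops_def P o P_comp ops_comp_def)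
  have "is_functor (opp Delta) (Set_cat U) (Under (gspace_of S P))"
    unfolding gspace_of_def gspace.simps
  proof (rule is_functor_mk_functor, goal_cases)
    case (5 n)
    then show ?case using P_ide by (auto simp: ops_ide_def)
  next
    case (6 n m l \<beta> \<alpha>)
    then show ?case by (auto simp: fun_eq_iff compose_def P P_comp o ops_comp_def)
  qed (auto simp: S P o)
  moreover have "right_action G (Under (gspace_of S P)) (Act (gspace_of S P))"
    unfolding right_action_def C
    using P_ide by (auto simp: gspace_of_def P P_comp o ops_comp_def ops_ide_def)
  ultimately show "gspace_of S P \<in> Obj GS" by (simp add: GS_simps(1))
qed

end

section \<open>Retractive spaces and presheaves on the simplex category\<close>

abbreviation cell where "cell A \<equiv> cells (fst A)"
abbreviation ret where "ret A \<equiv> fst (snd A)"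
abbreviation sec where "sec A \<equiv> snd (snd A)"

locale retractive_spaces = simplicial_group_action U G
  for U :: "'u set set" and G :: "'g sgroup" +
  fixes W :: "('u, 'g) gspace"
  assumes set_universe: "set_universe U" and W: "W \<in> Obj GS"
begin

abbreviation "RC \<equiv> Retractive GS W"
abbreviation "Simp \<equiv> Simp_cat G W"
abbreviation "res A \<equiv> pull (fst A)"

lemma universe_subset: "A \<in> U \<Longrightarrow> B \<subseteq> A \<Longrightarrow> B \<in> U"
  using set_universe by (simp add: set_universe_def)

lemma universe_Sigma:
  "I \<in> U \<Longrightarrow> (\<And>i. i \<in> I \<Longrightarrow> A i \<in> U) \<Longrightarrow> \<exists>S\<in>U. \<exists>f. bij_betw f (SIGMA i:I. A i) S"
  using set_universe unfolding set_universe_def by blast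

lemma category_RC: "category RC"
  by (rule category_Retractive[OF category_GS W])

lemma GS_homD:
  assumes "X \<in> Obj GS" "Y \<in> Obj GS" "f \<in> Hom GS X Y"
  shows "f n \<in> extensional (cells X n)"
    and "x \<in> cells X n \<Longrightarrow> f n x \<in> cells Y n"
    and "\<phi> \<in> ops m n \<Longrightarrow> x \<in> cells X n \<Longrightarrow> f m (pull X n m \<phi> x) = pull Y n m \<phi> (f n x)"
  using assms by (auto simp: GS_hom_iff PiE_iff)

lemma RC_objI:
  assumes "X \<in> Obj GS"
    and "\<And>n. r n \<in> cells X n \<rightarrow>\<^sub>E cells W n" "\<And>n. s n \<in> cells W n \<rightarrow>\<^sub>E cells X n"
    and "\<And>m n \<phi> x. \<phi> \<in> ops m n \<Longrightarrow> x \<in> cells X n \<Longrightarrow> r m (pull X n m \<phi> x) = pull W n m \<phi> (r n x)"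
    and "\<And>m n \<phi> w. \<phi> \<in> ops m n \<Longrightarrow> w \<in> cells W n \<Longrightarrow> s m (pull W n m \<phi> w) = pull X n m \<phi> (s n w)"
    and "\<And>n w. w \<in> cells W n \<Longrightarrow> r n (s n w) = w"
  shows "(X, r, s) \<in> Obj RC"
  using assms W by (auto simp: Retractive_def GS_hom_iff fun_eq_iff compose_def)

lemma RC_objD:
  assumes "A \<in> Obj RC"
  shows "fst A \<in> Obj GS"
    and "y \<in> cell A n \<Longrightarrow> ret A n y \<in> cells W n"
    and "w \<in> cells W n \<Longrightarrow> sec A n w \<in> cell A n"
    and "\<phi> \<in> ops m n \<Longrightarrow> y \<in> cell A n \<Longrightarrow> ret A m (res A n m \<phi> y) = pull W n m \<phi> (ret A n y)"
    and "\<phi> \<in> ops m n \<Longrightarrow> w \<in> cells W n \<Longrightarrow> res A n m \<phi> (sec A n w) = sec A m (pull W n m \<phi> w)"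
    and "w \<in> cells W n \<Longrightarrow> ret A n (sec A n w) = w"
    and "ret A n \<in> extensional (cell A n)" "sec A n \<in> extensional (cells W n)"
proof -
  obtain Y r s where A: "A = (Y, r, s)" by (metis prod_cases3)
  have Y: "Y \<in> Obj GS" and r: "r \<in> Hom GS Y W" and s: "s \<in> Hom GS W Y"
    and rs: "(\<lambda>n. compose (cells W n) (r n) (s n)) = (\<lambda>n. \<lambda>x\<in>cells W n. x)"
    using assms by (simp_all add: A Retractive_def)
  show "w \<in> cells W n \<Longrightarrow> ret A n (sec A n w) = w"
    using fun_cong[OF fun_cong[OF rs, of n], of w] by (simp add: A compose_eq)
  show "fst A \<in> Obj GS" using Y by (simp add: A)
  note r = GS_homD[OF Y W r] and s = GS_homD[OF W Y s]
  show "y \<in> cell A n \<Longrightarrow> ret A n y \<in> cells W n"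
    "\<phi> \<in> ops m n \<Longrightarrow> y \<in> cell A n \<Longrightarrow> ret A m (res A n m \<phi> y) = pull W n m \<phi> (ret A n y)"
    "ret A n \<in> extensional (cell A n)"
    using r by (simp_all add: A)
  show "w \<in> cells W n \<Longrightarrow> sec A n w \<in> cell A n"
    "\<phi> \<in> ops m n \<Longrightarrow> w \<in> cells W n \<Longrightarrow> res A n m \<phi> (sec A n w) = sec A m (pull W n m \<phi> w)"
    "sec A n \<in> extensional (cells W n)"
    using s by (simp_all add: A)
qed

lemma RC_homI:
  assumes "A \<in> Obj RC" "B \<in> Obj RC"
    and "\<And>n. f n \<in> cell A n \<rightarrow>\<^sub>E cell B n"
    and "\<And>m n \<phi> y. \<phi> \<in> ops m n \<Longrightarrow> y \<in> cell A n \<Longrightarrow> f m (res A n m \<phi> y) = res B n m \<phi> (f n y)"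
    and "\<And>n y. y \<in> cell A n \<Longrightarrow> ret B n (f n y) = ret A n y"
    and "\<And>n w. w \<in> cells W n \<Longrightarrow> f n (sec A n w) = sec B n w"
  shows "f \<in> Hom RC A B"
proof -
  obtain Y r s where A: "A = (Y, r, s)" by (metis prod_cases3)
  obtain Z r' s' where B: "B = (Z, r', s')" by (metis prod_cases3)
  have "Y \<in> Obj GS" "Z \<in> Obj GS"
    using RC_objD(1)[OF assms(1)] RC_objD(1)[OF assms(2)] by (simp_all add: A B)
  then have "f \<in> Hom GS Y Z" using assms(3,4) by (simp add: GS_hom_iff A B)
  moreover have "compose (cells Y n) (r' n) (f n) = r n" for n
    using assms(5) RC_objD(7)[OF assms(1), of n]
    by (intro extensionalityI[of _ "cells Y n"]) (auto simp: A B compose_eq)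
  moreover have "compose (cells W n) (f n) (s n) = s' n" for n
    using assms(6) RC_objD(8)[OF assms(2), of n]
    by (intro extensionalityI[of _ "cells W n"]) (auto simp: A B compose_eq)
  ultimately show ?thesis by (simp add: Retractive_def A B)
qed

lemma RC_homD:
  assumes A: "A \<in> Obj RC" and B: "B \<in> Obj RC" and f: "f \<in> Hom RC A B"
  shows "f n \<in> extensional (cell A n)"
    and "y \<in> cell A n \<Longrightarrow> f n y \<in> cell B n"
    and "\<phi> \<in> ops m n \<Longrightarrow> y \<in> cell A n \<Longrightarrow> f m (res A n m \<phi> y) = res B n m \<phi> (f n y)"
    and "y \<in> cell A n \<Longrightarrow> ret B n (f n y) = ret A n y"
    and "w \<in> cells W n \<Longrightarrow> f n (sec A n w) = sec B n w"
proof -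
  obtain Y r s where A': "A = (Y, r, s)" by (metis prod_cases3)
  obtain Z r' s' where B': "B = (Z, r', s')" by (metis prod_cases3)
  have Y: "Y \<in> Obj GS" and Z: "Z \<in> Obj GS"
    using RC_objD(1)[OF A] RC_objD(1)[OF B] by (simp_all add: A' B')
  have h: "f \<in> Hom GS Y Z" and r: "(\<lambda>n. compose (cells Y n) (r' n) (f n)) = r"
    and s: "(\<lambda>n. compose (cells W n) (f n) (s n)) = s'"
    using f by (simp_all add: A' B' Retractive_def)
  show "f n \<in> extensional (cell A n)" "y \<in> cell A n \<Longrightarrow> f n y \<in> cell B n"
    "\<phi> \<in> ops m n \<Longrightarrow> y \<in> cell A n \<Longrightarrow> f m (res A n m \<phi> y) = res B n m \<phi> (f n y)"
    using GS_homD[OF Y Z h] by (simp_all add: A' B')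
  show "y \<in> cell A n \<Longrightarrow> ret B n (f n y) = ret A n y"
    using fun_cong[OF fun_cong[OF r, of n], of y] by (simp add: A' B' compose_eq)
  show "w \<in> cells W n \<Longrightarrow> f n (sec A n w) = sec B n w"
    using fun_cong[OF fun_cong[OF s, of n], of w] by (simp add: A' B' compose_eq)
qed

lemma RC_hom_eqI:
  assumes "A \<in> Obj RC" "B \<in> Obj RC" "f \<in> Hom RC A B" "f' \<in> Hom RC A B"
    and "\<And>n y. y \<in> cell A n \<Longrightarrow> f n y = f' n y"
  shows "f = f'"
proof
  fix n show "f n = f' n"
    using assms(5) RC_homD(1)[OF assms(1-3), of n] RC_homD(1)[OF assms(1,2,4), of n]
    by (rule extensionalityI[rotated 2])
qed

lemma RC_Ide: "Ide RC A = (\<lambda>n. \<lambda>y\<in>cell A n. y)"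
  by (cases A) (simp add: Retractive_def)

lemma RC_Comp: "Comp RC A B D g f = (\<lambda>n. compose (cell A n) (g n) (f n))"
  by (cases A; cases B; cases D) (simp add: Retractive_def)

text \<open>In this form a morphism into \<open>x\<close> is any operator ending in the degree of
  \<open>x\<close>, and its source is forced: it is the simplex to which the operator sends
  \<open>snd x\<close>.\<close>

lemma Simp_simps [simp]:
  "x \<in> Obj Simp \<longleftrightarrow> snd x \<in> cells W (fst x)"
  "\<phi> \<in> Hom Simp y x \<longleftrightarrow> \<phi> \<in> ops (fst y) (fst x) \<and> snd y = pull W (fst x) (fst y) \<phi> (snd x)"
  "Ide Simp x = ops_ide (fst x)"
  "Comp Simp z y x \<psi> \<phi> = ops_comp (fst z) (fst y) (fst x) \<psi> \<phi>"
  by (auto simp: Simp_cat_def ops_def pull_def ops_ide_def ops_comp_def split_beta mem_Times_iff)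

section \<open>Fibres and fibrewise maps\<close>

definition fib where "fib A x = {y \<in> cell A (fst x). ret A (fst x) y = snd x}"

lemma fib_in_universe: "A \<in> Obj RC \<Longrightarrow> fib A x \<in> U"
  using universe_subset[of "cell A (fst x)" "fib A x"] GS_D(1)[OF RC_objD(1)] by (auto simp: fib_def)

lemma fib_cell: "A \<in> Obj RC \<Longrightarrow> y \<in> cell A n \<Longrightarrow> y \<in> fib A (n, ret A n y)"
  by (simp add: fib_def)

lemma res_fib:
  "A \<in> Obj RC \<Longrightarrow> \<phi> \<in> Hom Simp y x \<Longrightarrow> z \<in> fib A x \<Longrightarrow> res A (fst x) (fst y) \<phi> z \<in> fib A y"
  by (auto simp: fib_def RC_objD)

lemma sec_fib: "A \<in> Obj RC \<Longrightarrow> x \<in> Obj Simp \<Longrightarrow> sec A (fst x) (snd x) \<in> fib A x"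
  by (simp add: fib_def RC_objD)

lemma res_sec:
  "A \<in> Obj RC \<Longrightarrow> x \<in> Obj Simp \<Longrightarrow> \<phi> \<in> Hom Simp y x \<Longrightarrow>
    res A (fst x) (fst y) \<phi> (sec A (fst x) (snd x)) = sec A (fst y) (snd y)"
  by (simp add: RC_objD)

definition fibrewise where
  "fibrewise A f = (\<lambda>x\<in>Obj Simp. \<lambda>z\<in>fib A x. f (fst x) z)"

text \<open>Natural transformations between the pointed fibre presheaves, stated without the functor
  records, so that the pointed and the abelian case can share the comparison with
  \<open>Hom RC A B\<close>.\<close>

definition fib_maps where
  "fib_maps A B = {\<theta> \<in> \<Pi>\<^sub>E x\<in>Obj Simp. fib A x \<rightarrow>\<^sub>E fib B x.
     (\<forall>x\<in>Obj Simp. \<forall>y\<in>Obj Simp. \<forall>\<phi>\<in>Hom Simp y x. \<forall>z\<in>fib A x.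
       \<theta> y (res A (fst x) (fst y) \<phi> z) = res B (fst x) (fst y) \<phi> (\<theta> x z)) \<and>
     (\<forall>x\<in>Obj Simp. \<theta> x (sec A (fst x) (snd x)) = sec B (fst x) (snd x))}"

text \<open>The fibres partition the cells, so a morphism over \<open>W\<close> is glued in exactly
  one way from maps of fibres: the inverse applies to \<open>y\<close> the component at the simplex
  below \<open>y\<close>.\<close>

lemma bij_betw_fibrewise:
  assumes A: "A \<in> Obj RC" and B: "B \<in> Obj RC"
  shows "bij_betw (fibrewise A) (Hom RC A B) (fib_maps A B)"
proof (rule bij_betw_byWitness[where f' = "\<lambda>\<theta> n. \<lambda>y\<in>cell A n. \<theta> (n, ret A n y) y"])
  note f = RC_homD[OF A B]
  show "\<forall>f\<in>Hom RC A B. (\<lambda>n. \<lambda>y\<in>cell A n. fibrewise A f (n, ret A n y) y) = f"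
  proof
    fix h assume h: "h \<in> Hom RC A B"
    have "(\<lambda>y\<in>cell A n. fibrewise A h (n, ret A n y) y) = h n" for n
      using f(1)[OF h, of n]
      by (intro extensionalityI[of _ "cell A n"]) (auto simp: fibrewise_def fib_def RC_objD[OF A])
    then show "(\<lambda>n. \<lambda>y\<in>cell A n. fibrewise A h (n, ret A n y) y) = h" by blast
  qed
  show "\<forall>\<theta>\<in>fib_maps A B. fibrewise A (\<lambda>n. \<lambda>y\<in>cell A n. \<theta> (n, ret A n y) y) = \<theta>"
  proof
    fix \<theta> assume \<theta>: "\<theta> \<in> fib_maps A B"
    then have ext: "\<theta> \<in> extensional (Obj Simp)" "\<And>x. x \<in> Obj Simp \<Longrightarrow> \<theta> x \<in> extensional (fib A x)"
      by (auto simp: fib_maps_def PiE_iff)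
    show "fibrewise A (\<lambda>n. \<lambda>y\<in>cell A n. \<theta> (n, ret A n y) y) = \<theta>"
    proof (rule extensionalityI[of _ "Obj Simp"])
      fix x assume x: "x \<in> Obj Simp"
      show "fibrewise A (\<lambda>n. \<lambda>y\<in>cell A n. \<theta> (n, ret A n y) y) x = \<theta> x"
        using x ext(2)[OF x] by (intro extensionalityI[of _ "fib A x"]) (auto simp: fibrewise_def fib_def)
    qed (use ext in \<open>simp_all add: fibrewise_def\<close>)
  qed
  show "fibrewise A ` Hom RC A B \<subseteq> fib_maps A B"
  proof (rule image_subsetI)
    fix h assume h: "h \<in> Hom RC A B"
    show "fibrewise A h \<in> fib_maps A B"
      using f[OF h] RC_objD[OF A] RC_objD[OF B]
      by (auto simp: fib_maps_def fibrewise_def fib_def)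
  qed
  show "(\<lambda>\<theta> n. \<lambda>y\<in>cell A n. \<theta> (n, ret A n y) y) ` fib_maps A B \<subseteq> Hom RC A B"
  proof (rule image_subsetI)
    fix \<theta> assume \<theta>: "\<theta> \<in> fib_maps A B"
    have in_fib: "\<theta> (n, ret A n y) y \<in> fib B (n, ret A n y)" if "y \<in> cell A n" for n y
      using \<theta> that RC_objD(2)[OF A that] fib_cell[OF A that] by (auto simp: fib_maps_def PiE_iff)
    have nat: "\<theta> (m, pull W n m \<phi> (ret A n z)) (res A n m \<phi> z) = res B n m \<phi> (\<theta> (n, ret A n z) z)"
      if "\<phi> \<in> ops m n" "z \<in> cell A n" for m n \<phi> z
    proof -
      \<comment> \<open>Relative to the simplex below \<open>z\<close> every operator is a morphism
        of \<open>Simp\<close>, so naturality of \<open>\<theta>\<close> yields compatibility with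
        all of \<open>ops\<close>.\<close>
      have "(n, ret A n z) \<in> Obj Simp" "(m, pull W n m \<phi> (ret A n z)) \<in> Obj Simp"
        "\<phi> \<in> Hom Simp (m, pull W n m \<phi> (ret A n z)) (n, ret A n z)" "z \<in> fib A (n, ret A n z)"
        using that W A by (simp_all add: RC_objD fib_cell)
      then show ?thesis using \<theta> unfolding fib_maps_def by fastforce
    qed
    have sec: "\<theta> (n, w) (sec A n w) = sec B n w" if "w \<in> cells W n" for n w
    proof -
      have "(n, w) \<in> Obj Simp" using that by simp
      then have "\<theta> (n, w) (sec A (fst (n, w)) (snd (n, w))) = sec B (fst (n, w)) (snd (n, w))"
        using \<theta> unfolding fib_maps_def by blast
      then show ?thesis by simp
    qed
    show "(\<lambda>n. \<lambda>y\<in>cell A n. \<theta> (n, ret A n y) y) \<in> Hom RC A B"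
      using in_fib by (intro RC_homI[OF A B]) (auto simp: RC_objD[OF A] sec nat fib_def)
  qed
qed

text \<open>The object part is a parameter because the pointed and the group-valued presheaf have
  the same restriction maps and differ only in the structure placed on
  \<open>fib A x\<close>.\<close>

definition fibre_functor where
  "fibre_functor k A = mk_functor (opp Simp) k
     (\<lambda>x y \<phi>. \<lambda>z\<in>fib A x. res A (fst x) (fst y) \<phi> z)"

lemma Simp_comps:
  "x \<in> Obj Simp \<Longrightarrow> Ide Simp x \<in> Hom Simp x x"
  "x \<in> Obj Simp \<Longrightarrow> \<phi> \<in> Hom Simp z y \<Longrightarrow> \<psi> \<in> Hom Simp y x \<Longrightarrow> Comp Simp z y x \<psi> \<phi> \<in> Hom Simp z x"
  using W by (auto simp: pull_pull)

definition pointed_fibres where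
  "pointed_fibres A = fibre_functor (\<lambda>x. (fib A x, sec A (fst x) (snd x))) A"

text \<open>The last two premises say that \<open>D\<close> is concrete on the values of
  \<open>k\<close>; functoriality is then \<open>pull_ide\<close> and \<open>pull_pull\<close> for
  the total space.\<close>

lemma is_functor_fibre_functor:
  assumes A: "A \<in> Obj RC"
    and "\<And>x. x \<in> Obj Simp \<Longrightarrow> k x \<in> Obj D"
    and "\<And>x y \<phi>. x \<in> Obj Simp \<Longrightarrow> y \<in> Obj Simp \<Longrightarrow> \<phi> \<in> Hom Simp y x \<Longrightarrow>
      (\<lambda>z\<in>fib A x. res A (fst x) (fst y) \<phi> z) \<in> Hom D (k x) (k y)"
    and "\<And>x. Ide D (k x) = (\<lambda>z\<in>fib A x. z)"
    and "\<And>x y z f g. Comp D (k x) (k y) (k z) g f = compose (fib A x) g f"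
  shows "is_functor (opp Simp) D (fibre_functor k A)"
  unfolding fibre_functor_def
proof (rule is_functor_mk_functor, goal_cases)
  case (5 x)
  then show ?case by (auto simp: assms(4) fib_def RC_objD[OF A] intro!: restrict_ext)
next
  case (6 x y z \<psi> \<phi>)
  then show ?case
    by (auto simp: assms(5) compose_def fib_def RC_objD[OF A] pull_pull intro!: restrict_ext)
qed (use Simp_comps assms in \<open>simp_all del: Simp_simps\<close>)

lemma is_functor_pointed_fibres:
  "A \<in> Obj RC \<Longrightarrow> is_functor (opp Simp) (Pointed_set_cat U) (pointed_fibres A)"
  unfolding pointed_fibres_def
  by (rule is_functor_fibre_functor)
    (auto simp: fib_in_universe sec_fib res_fib res_sec simp del: Simp_simps)

lemma nat_trans_pointed_fibres:
  assumes A: "A \<in> Obj RC" and B: "B \<in> Obj RC"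
  shows "nat_trans (opp Simp) (Pointed_set_cat U) (pointed_fibres A) (pointed_fibres B) = fib_maps A B"
proof -
  have *: "compose (fib A x) (\<theta> y) (\<lambda>z\<in>fib A x. res A (fst x) (fst y) \<phi> z) =
      compose (fib A x) (\<lambda>z\<in>fib B x. res B (fst x) (fst y) \<phi> z) (\<theta> x) \<longleftrightarrow>
     (\<forall>z\<in>fib A x. \<theta> y (res A (fst x) (fst y) \<phi> z) = res B (fst x) (fst y) \<phi> (\<theta> x z))"
    if "\<theta> x \<in> fib A x \<rightarrow>\<^sub>E fib B x" for \<theta> x y \<phi>
    using that by (auto simp: compose_def fun_eq_iff PiE_iff)
  show ?thesis
    by (simp add: nat_trans_def fib_maps_def pointed_fibres_def fibre_functor_def PiE_iff *
        cong: conj_cong ball_cong del: Simp_simps) blast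
qed

text \<open>The cells of degree \<open>n\<close> are codes for pairs of a simplex \<open>w\<close>
  and an element of \<open>F (n, w)\<close>; an operator moves \<open>w\<close> by
  \<open>pull\<close> and the element by \<open>T\<close>. The premise \<open>emb\<close> leaves the
  type of the elements open, which lets fibre products, whose elements are pairs, be realised
  too.\<close>

lemma realization:
  assumes emb: "\<And>n. \<exists>S\<in>U. \<exists>f. bij_betw f (SIGMA w:cells W n. F (n, w)) S"
    and T: "\<And>x y \<phi> k. x \<in> Obj Simp \<Longrightarrow> y \<in> Obj Simp \<Longrightarrow> \<phi> \<in> Hom Simp y x \<Longrightarrow> k \<in> F x \<Longrightarrow> T x y \<phi> k \<in> F y"
    and T_ide: "\<And>x k. x \<in> Obj Simp \<Longrightarrow> k \<in> F x \<Longrightarrow> T x x (Ide Simp x) k = k"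
    and T_comp: "\<And>x y z \<phi> \<psi> k. x \<in> Obj Simp \<Longrightarrow> y \<in> Obj Simp \<Longrightarrow> z \<in> Obj Simp \<Longrightarrow>
      \<psi> \<in> Hom Simp y x \<Longrightarrow> \<phi> \<in> Hom Simp z y \<Longrightarrow> k \<in> F x \<Longrightarrow>
      T y z \<phi> (T x y \<psi> k) = T x z (Comp Simp z y x \<psi> \<phi>) k"
    and pt: "\<And>x. x \<in> Obj Simp \<Longrightarrow> pt x \<in> F x"
    and T_pt: "\<And>x y \<phi>. x \<in> Obj Simp \<Longrightarrow> y \<in> Obj Simp \<Longrightarrow> \<phi> \<in> Hom Simp y x \<Longrightarrow> T x y \<phi> (pt x) = pt y"
  obtains A \<theta> where "A \<in> Obj RC"
    and "\<And>x. x \<in> Obj Simp \<Longrightarrow> bij_betw (\<theta> x) (fib A x) (F x)"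
    and "\<And>x. x \<in> Obj Simp \<Longrightarrow> \<theta> x (sec A (fst x) (snd x)) = pt x"
    and "\<And>x y \<phi> z. x \<in> Obj Simp \<Longrightarrow> y \<in> Obj Simp \<Longrightarrow> \<phi> \<in> Hom Simp y x \<Longrightarrow> z \<in> fib A x \<Longrightarrow>
      \<theta> y (res A (fst x) (fst y) \<phi> z) = T x y \<phi> (\<theta> x z)"
proof -
  obtain S b where S: "\<And>n. S n \<in> U" and b: "\<And>n. bij_betw (b n) (SIGMA w:cells W n. F (n, w)) (S n)"
    using emb by metis
  \<comment> \<open>\<open>b\<close> codes a pair of simplex and element as a cell, and
    \<open>c\<close> decodes it.\<close>
  define c where "c n = inv_into (SIGMA w:cells W n. F (n, w)) (b n)" for n
  have b_in: "b n (w, k) \<in> S n" if "w \<in> cells W n" "k \<in> F (n, w)" for n w k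
    using b[of n] that by (auto simp: bij_betw_def)
  have cb: "c n (b n (w, k)) = (w, k)" if "w \<in> cells W n" "k \<in> F (n, w)" for n w k
    using b[of n] that unfolding c_def bij_betw_def by (auto intro: inv_into_f_f)
  have c_in: "fst (c n z) \<in> cells W n" "snd (c n z) \<in> F (n, fst (c n z))" "b n (c n z) = z"
    if "z \<in> S n" for n z
  proof -
    have "c n z \<in> (SIGMA w:cells W n. F (n, w))"
      unfolding c_def using b[of n] that by (intro inv_into_into) (auto simp: bij_betw_def)
    then show "fst (c n z) \<in> cells W n" "snd (c n z) \<in> F (n, fst (c n z))" by auto
    show "b n (c n z) = z"
      unfolding c_def using b[of n] that by (intro f_inv_into_f) (auto simp: bij_betw_def)
  qed
  \<comment> \<open>Decode, move the simplex in \<open>W\<close>, move the element along the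
    morphism of \<open>Simp\<close> that this determines, and encode again.\<close>
  define P where "P n m \<phi> z = b m (pull W n m \<phi> (fst (c n z)),
     T (n, fst (c n z)) (m, pull W n m \<phi> (fst (c n z))) \<phi> (snd (c n z)))" for n m \<phi> z
  have T': "T (n, w) (m, pull W n m \<phi> w) \<phi> k \<in> F (m, pull W n m \<phi> w)"
    if "\<phi> \<in> ops m n" "w \<in> cells W n" "k \<in> F (n, w)" for m n \<phi> w k
    using that W by (intro T) auto
  have cP: "c m (P n m \<phi> z) = (pull W n m \<phi> (fst (c n z)),
     T (n, fst (c n z)) (m, pull W n m \<phi> (fst (c n z))) \<phi> (snd (c n z)))"
    if "\<phi> \<in> ops m n" "z \<in> S n" for m n \<phi> z
    unfolding P_def using that W by (intro cb T') (auto simp: c_in)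
  have P1: "P n m \<phi> z \<in> S m" if "\<phi> \<in> ops m n" "z \<in> S n" for m n \<phi> z
    unfolding P_def using that W by (intro b_in T') (auto simp: c_in)
  have P2: "P n n (ops_ide n) z = z" if "z \<in> S n" for n z
    using that W T_ide[of "(n, fst (c n z))" "snd (c n z)"] by (simp add: P_def c_in)
  \<comment> \<open>The simplices compose by \<open>pull_pull\<close> in \<open>W\<close>, the
    elements by \<open>T_comp\<close> for the two morphisms lying over them.\<close>
  have P3: "P m l \<phi> (P n m \<psi> z) = P n l (ops_comp l m n \<psi> \<phi>) z"
    if "\<phi> \<in> ops l m" "\<psi> \<in> ops m n" "z \<in> S n" for l m n \<phi> \<psi> z
  proof -
    let ?w = "fst (c n z)" let ?v = "pull W n m \<psi> ?w" let ?u = "pull W m l \<phi> ?v"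
    have "T (m, ?v) (l, ?u) \<phi> (T (n, ?w) (m, ?v) \<psi> (snd (c n z))) =
      T (n, ?w) (l, ?u) (Comp Simp (l, ?u) (m, ?v) (n, ?w) \<psi> \<phi>) (snd (c n z))"
      using that W by (intro T_comp) (auto simp: c_in)
    then show ?thesis
      using that W by (simp add: P_def[of m l] P_def[of n l] cP pull_pull c_in)
  qed
  define X where "X = gspace_of S P"
  have X: "X \<in> Obj GS" "cells X = S"
    "\<And>m n \<phi> z. \<phi> \<in> ops m n \<Longrightarrow> z \<in> S n \<Longrightarrow> pull X n m \<phi> z = P n m \<phi> z"
    unfolding X_def by (rule gspace_of(1) gspace_of(2) gspace_of(3); use S P1 P2 P3 in blast)+
  \<comment> \<open>The retraction reads off the simplex of a code; the section codes the base point
    \<open>pt\<close> over each simplex.\<close>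
  define A where "A = (X, (\<lambda>n. \<lambda>z\<in>S n. fst (c n z)), (\<lambda>n. \<lambda>w\<in>cells W n. b n (w, pt (n, w))))"
  have pt': "pt (n, w) \<in> F (n, w)" if "w \<in> cells W n" for n w
    using that by (intro pt) simp
  have T_pt': "T (n, w) (m, pull W n m \<phi> w) \<phi> (pt (n, w)) = pt (m, pull W n m \<phi> w)"
    if "\<phi> \<in> ops m n" "w \<in> cells W n" for n w m \<phi>
    using that W by (intro T_pt) auto
  have A: "A \<in> Obj RC"
    unfolding A_def
  proof (rule RC_objI[OF X(1)], goal_cases)
    case (4 m n \<phi> w)
    then have "P n m \<phi> (b n (w, pt (n, w))) = b m (pull W n m \<phi> w, pt (m, pull W n m \<phi> w))"
      by (simp add: P_def cb pt' T_pt')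
    with 4 W show ?case by (simp add: X b_in pt')
  qed (use W in \<open>auto simp: X c_in cP P1 cb b_in pt'\<close>)
  have fibA: "fib A x = {z \<in> S (fst x). fst (c (fst x) z) = snd x}" for x
    by (auto simp: fib_def A_def X)
  show ?thesis
  \<comment> \<open>Within a fixed fibre the simplex of a code is known, so dropping it loses
    nothing.\<close>
  proof (rule that[of A "\<lambda>x z. snd (c (fst x) z)"])
    fix x assume x: "x \<in> Obj Simp"
    show "bij_betw (\<lambda>z. snd (c (fst x) z)) (fib A x) (F x)"
    proof (rule bij_betw_byWitness[where f' = "\<lambda>k. b (fst x) (snd x, k)"])
      show "\<forall>z\<in>fib A x. b (fst x) (snd x, snd (c (fst x) z)) = z"
        using x by (auto simp: fibA) (metis c_in(3) prod.collapse)
      show "(\<lambda>z. snd (c (fst x) z)) ` fib A x \<subseteq> F x"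
        using x c_in(2) by (fastforce simp: fibA)
    qed (use x in \<open>auto simp: fibA cb b_in\<close>)
    show "snd (c (fst x) (sec A (fst x) (snd x))) = pt x"
      using x pt[OF x] by (simp add: A_def cb)
  next
    fix x y \<phi> z
    assume *: "x \<in> Obj Simp" "y \<in> Obj Simp" "\<phi> \<in> Hom Simp y x" "z \<in> fib A x"
    then have "z \<in> S (fst x)" "fst (c (fst x) z) = snd x" by (simp_all add: fibA)
    with *(3) show "snd (c (fst y) (res A (fst x) (fst y) \<phi> z)) = T x y \<phi> (snd (c (fst x) z))"
      by (cases x; cases y) (simp add: A_def X cP)
  qed (rule A)
qed

section \<open>The equivalence in the pointed case\<close>

lemma fibrewise_Ide:
  "A \<in> Obj RC \<Longrightarrow> fibrewise A (Ide RC A) = (\<lambda>x\<in>Obj Simp. \<lambda>z\<in>fib A x. z)"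
  by (auto simp: fibrewise_def RC_Ide fib_def intro!: restrict_ext)

lemma fibrewise_Comp:
  assumes "A \<in> Obj RC" "B \<in> Obj RC" "f \<in> Hom RC A B"
  shows "fibrewise A (Comp RC A B D g f) =
    (\<lambda>x\<in>Obj Simp. compose (fib A x) (fibrewise B g x) (fibrewise A f x))"
  using RC_homD[OF assms]
  by (auto simp: fibrewise_def RC_Comp fib_def compose_def intro!: restrict_ext)

text \<open>For values in \<open>U\<close> the codes come from closure of \<open>U\<close> under
  disjoint unions, here indexed by \<open>cells W n\<close>, itself a member of
  \<open>U\<close>.\<close>

lemma functor_realization:
  assumes "\<And>x. x \<in> Obj Simp \<Longrightarrow> F x \<in> U"
    and "\<And>x y \<phi> k. x \<in> Obj Simp \<Longrightarrow> y \<in> Obj Simp \<Longrightarrow> \<phi> \<in> Hom Simp y x \<Longrightarrow> k \<in> F x \<Longrightarrow> T x y \<phi> k \<in> F y"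
    and "\<And>x k. x \<in> Obj Simp \<Longrightarrow> k \<in> F x \<Longrightarrow> T x x (Ide Simp x) k = k"
    and "\<And>x y z \<phi> \<psi> k. x \<in> Obj Simp \<Longrightarrow> y \<in> Obj Simp \<Longrightarrow> z \<in> Obj Simp \<Longrightarrow>
      \<psi> \<in> Hom Simp y x \<Longrightarrow> \<phi> \<in> Hom Simp z y \<Longrightarrow> k \<in> F x \<Longrightarrow>
      T y z \<phi> (T x y \<psi> k) = T x z (Comp Simp z y x \<psi> \<phi>) k"
    and "\<And>x. x \<in> Obj Simp \<Longrightarrow> pt x \<in> F x"
    and "\<And>x y \<phi>. x \<in> Obj Simp \<Longrightarrow> y \<in> Obj Simp \<Longrightarrow> \<phi> \<in> Hom Simp y x \<Longrightarrow> T x y \<phi> (pt x) = pt y"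
  obtains A \<theta> where "A \<in> Obj RC"
    and "\<And>x. x \<in> Obj Simp \<Longrightarrow> bij_betw (\<theta> x) (fib A x) (F x)"
    and "\<And>x. x \<in> Obj Simp \<Longrightarrow> \<theta> x (sec A (fst x) (snd x)) = pt x"
    and "\<And>x y \<phi> z. x \<in> Obj Simp \<Longrightarrow> y \<in> Obj Simp \<Longrightarrow> \<phi> \<in> Hom Simp y x \<Longrightarrow> z \<in> fib A x \<Longrightarrow>
      \<theta> y (res A (fst x) (fst y) \<phi> z) = T x y \<phi> (\<theta> x z)"
proof -
  have "\<exists>S\<in>U. \<exists>f. bij_betw f (SIGMA w:cells W n. F (n, w)) S" for n
    using assms(1) GS_D(1)[OF W] by (intro universe_Sigma) auto
  from realization[where F = F and T = T and pt = pt, OF this assms(2-6)] that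
  show thesis by blast
qed

definition pointed_fibres_functor where
  "pointed_fibres_functor = mk_functor RC pointed_fibres (\<lambda>A B. fibrewise A)"

lemma is_functor_pointed_fibres_functor:
  "is_functor RC (Fun_cat (opp Simp) (Pointed_set_cat U)) pointed_fibres_functor"
  unfolding pointed_fibres_functor_def
proof (rule is_functor_mk_functor, goal_cases)
  case (4 A B f)
  then show ?case
    using bij_betw_fibrewise[of A B] by (auto simp: nat_trans_pointed_fibres bij_betw_def)
next
  case (5 A)
  then show ?case
    by (auto simp: fibrewise_Ide pointed_fibres_def fibre_functor_def simp del: Simp_simps intro!: restrict_ext)
next
  case (6 A B D f g)
  then show ?case
    by (auto simp: fibrewise_Comp pointed_fibres_def fibre_functor_def simp del: Simp_simps intro!: restrict_ext)
qed (simp_all add: cat_ide[OF category_RC] cat_comp[OF category_RC] is_functor_pointed_fibres)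

text \<open>\<open>K\<close> is realised with its own transition maps and base points; the
  bijections \<open>\<theta>\<close> from the fibres are then the components of an
  isomorphism.\<close>

lemma ess_surj_pointed:
  assumes K: "is_functor (opp Simp) (Pointed_set_cat U) K"
  shows "\<exists>A\<in>Obj RC. isomorphic (Fun_cat (opp Simp) (Pointed_set_cat U)) (pointed_fibres A) K"
proof -
  note K_obj = functor_obj[OF K, simplified Pointed_set_cat_simps opp_simps]
  have K_mor: "FMor K x y \<phi> \<in> fst (FObj K x) \<rightarrow>\<^sub>E fst (FObj K y)"
    "FMor K x y \<phi> (snd (FObj K x)) = snd (FObj K y)"
    if "x \<in> Obj Simp" "y \<in> Obj Simp" "\<phi> \<in> Hom Simp y x" for x y \<phi>
    using functor_mor[OF K, of x y \<phi>] that by (simp_all del: Simp_simps)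
  have K_ide: "FMor K x x (Ide Simp x) = (\<lambda>k\<in>fst (FObj K x). k)" if "x \<in> Obj Simp" for x
    using functor_ide[OF K, of x] that by (simp del: Simp_simps)
  have K_comp: "FMor K x z (Comp Simp z y x \<psi> \<phi>) = compose (fst (FObj K x)) (FMor K y z \<phi>) (FMor K x y \<psi>)"
    if "x \<in> Obj Simp" "y \<in> Obj Simp" "z \<in> Obj Simp" "\<psi> \<in> Hom Simp y x" "\<phi> \<in> Hom Simp z y" for x y z \<psi> \<phi>
    using functor_comp[OF K, of x y z \<psi> \<phi>] that by (simp del: Simp_simps)
  obtain A \<theta> where A: "A \<in> Obj RC"
    and bij: "\<And>x. x \<in> Obj Simp \<Longrightarrow> bij_betw (\<theta> x) (fib A x) (fst (FObj K x))"
    and pt: "\<And>x. x \<in> Obj Simp \<Longrightarrow> \<theta> x (sec A (fst x) (snd x)) = snd (FObj K x)"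
    and nat: "\<And>x y \<phi> z. x \<in> Obj Simp \<Longrightarrow> y \<in> Obj Simp \<Longrightarrow> \<phi> \<in> Hom Simp y x \<Longrightarrow> z \<in> fib A x \<Longrightarrow>
      \<theta> y (res A (fst x) (fst y) \<phi> z) = FMor K x y \<phi> (\<theta> x z)"
  proof (rule functor_realization[where F = "\<lambda>x. fst (FObj K x)" and pt = "\<lambda>x. snd (FObj K x)"
        and T = "\<lambda>x y \<phi>. FMor K x y \<phi>"], goal_cases)
    case (2 x y \<phi> k)
    then show ?case using K_mor(1)[of x y \<phi>] by blast
  qed (auto simp: K_obj K_mor K_ide K_comp compose_eq simp del: Simp_simps)
  have inv: "inv_into (fib A x) (\<theta> x) k \<in> fib A x" "\<theta> x (inv_into (fib A x) (\<theta> x) k) = k"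
    if "x \<in> Obj Simp" "k \<in> fst (FObj K x)" for x k
    using bij[OF that(1)] that(2) by (auto simp: bij_betw_def intro: inv_into_into f_inv_into_f)
  have inv': "inv_into (fib A x) (\<theta> x) (\<theta> x z) = z" if "x \<in> Obj Simp" "z \<in> fib A x" for x z
    using bij[OF that(1)] that(2) by (auto simp: bij_betw_def)
  have \<theta>: "\<theta> x z \<in> fst (FObj K x)" if "x \<in> Obj Simp" "z \<in> fib A x" for x z
    using bij[OF that(1)] that(2) by (auto simp: bij_betw_def)
  have "isomorphic (Fun_cat (opp Simp) (Pointed_set_cat U)) (pointed_fibres A) K"
  proof (rule isomorphic_Fun_catI[OF category_Pointed_set_cat is_functor_pointed_fibres[OF A] K,
        where a = "\<lambda>x. \<lambda>z\<in>fib A x. \<theta> x z" and b = "\<lambda>x. \<lambda>k\<in>fst (FObj K x). inv_into (fib A x) (\<theta> x) k"],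
        goal_cases)
    case (2 x)
    \<comment> \<open>The inverse is pointed as well, since \<open>\<theta>\<close> sends the
      section value to the base point and is injective on the fibre.\<close>
    then have "inv_into (fib A x) (\<theta> x) (snd (FObj K x)) = sec A (fst x) (snd x)"
      using inv'[of x "sec A (fst x) (snd x)"] sec_fib[OF A, of x] pt by (simp del: Simp_simps)
    with 2 show ?case
      by (auto simp: pointed_fibres_def fibre_functor_def inv K_obj simp del: Simp_simps)
  next
    case (5 x y \<phi>)
    then show ?case
      by (simp add: pointed_fibres_def fibre_functor_def compose_def \<theta> nat res_fib[OF A]
          cong: restrict_cong del: Simp_simps)
  qed (auto simp: pointed_fibres_def fibre_functor_def compose_def \<theta> inv inv' pt sec_fib[OF A] K_obj
      simp del: Simp_simps intro!: restrict_ext)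
  with A show ?thesis by blast
qed

theorem equivalent_pointed:
  "equivalent_categories RC (Fun_cat (opp Simp) (Pointed_set_cat U))"
proof (rule equivalent_categories_if_fully_faithful_surj[OF category_RC
      category_Fun_cat[OF category_Pointed_set_cat] is_functor_pointed_fibres_functor])
  fix A B assume AB: "A \<in> Obj RC" "B \<in> Obj RC"
  \<comment> \<open>The two maps agree on the hom-set, where the restriction inside
    \<open>mk_functor\<close> is invisible.\<close>
  have "bij_betw (FMor pointed_fibres_functor A B) (Hom RC A B) (fib_maps A B) =
    bij_betw (fibrewise A) (Hom RC A B) (fib_maps A B)"
    by (rule bij_betw_cong) (simp add: pointed_fibres_functor_def AB)
  with bij_betw_fibrewise[OF AB] AB
  show "bij_betw (FMor pointed_fibres_functor A B) (Hom RC A B)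
      (Hom (Fun_cat (opp Simp) (Pointed_set_cat U)) (FObj pointed_fibres_functor A) (FObj pointed_fibres_functor B))"
    by (simp add: pointed_fibres_functor_def nat_trans_pointed_fibres)
next
  fix K assume "K \<in> Obj (Fun_cat (opp Simp) (Pointed_set_cat U))"
  then show "\<exists>A\<in>Obj RC. isomorphic (Fun_cat (opp Simp) (Pointed_set_cat U)) (FObj pointed_fibres_functor A) K"
    using ess_surj_pointed[of K] by (simp add: pointed_fibres_functor_def cong: bex_cong)
qed

section \<open>Products and abelian group objects\<close>

text \<open>The levelwise fibre product over \<open>W\<close>. Its elements have the wrong type to
  be cells, so it serves as the model with which products are compared.\<close>

definition pairs where
  "pairs A B n = {(a, b). a \<in> cell A n \<and> b \<in> cell B n \<and> ret A n a = ret B n b}"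

text \<open>Surjectivity onto \<open>pairs\<close> lifts two maps to \<open>E\<close> cell by cell.
  Injectivity makes the lift unique, and also makes it a morphism: each compatibility is checked
  after both projections.\<close>

lemma is_product_if_bij:
  assumes A: "A \<in> Obj RC" and B: "B \<in> Obj RC" and E: "E \<in> Obj RC"
    and p: "p \<in> Hom RC E A" and q: "q \<in> Hom RC E B"
    and bij: "\<And>n. bij_betw (\<lambda>z. (p n z, q n z)) (cell E n) (pairs A B n)"
  shows "is_product RC A B (E, p, q)"
proof -
  note pD = RC_homD[OF E A p] and qD = RC_homD[OF E B q]
  have uniq: "z = z'" if "z \<in> cell E n" "z' \<in> cell E n" "p n z = p n z'" "q n z = q n z'" for n z z'
    using bij[of n] that by (auto simp: bij_betw_def inj_on_def)
  have "\<exists>!h. h \<in> Hom RC X E \<and> Comp RC X E A p h = f \<and> Comp RC X E B q h = g"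
    if X: "X \<in> Obj RC" and f: "f \<in> Hom RC X A" and g: "g \<in> Hom RC X B" for X f g
  proof -
    note fD = RC_homD[OF X A f] and gD = RC_homD[OF X B g]
    have ex: "\<exists>z. z \<in> cell E n \<and> p n z = f n x \<and> q n z = g n x" if "x \<in> cell X n" for n x
    proof -
      have "(f n x, g n x) \<in> (\<lambda>z. (p n z, q n z)) ` cell E n"
        using bij[of n] that by (auto simp: bij_betw_def pairs_def fD gD)
      then show ?thesis by auto
    qed
    \<comment> \<open>The choice is harmless: by \<open>uniq\<close> at most one cell has the
      prescribed projections.\<close>
    define h where "h n x = (SOME z. z \<in> cell E n \<and> p n z = f n x \<and> q n z = g n x)" for n x
    have h: "h n x \<in> cell E n" "p n (h n x) = f n x" "q n (h n x) = g n x" if "x \<in> cell X n" for n x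
      using someI_ex[OF ex[OF that]] by (simp_all add: h_def)
    have hom: "(\<lambda>n. \<lambda>x\<in>cell X n. h n x) \<in> Hom RC X E"
    proof (rule RC_homI[OF X E], goal_cases)
      case (2 m n \<phi> y)
      have "h m (res X n m \<phi> y) = res E n m \<phi> (h n y)"
        by (rule uniq[of _ m, rotated 2], insert 2, simp_all add: RC_objD[OF X] RC_objD[OF E] h fD gD pD qD)
      with 2 show ?case by (simp add: RC_objD[OF X])
    next
      case (3 n y)
      then show ?case using pD(4)[of "h n y" n] by (simp add: h fD)
    next
      case (4 n w)
      have "h n (sec X n w) = sec E n w"
        by (rule uniq[of _ n, rotated 2], insert 4, simp_all add: RC_objD[OF X] RC_objD[OF E] h fD gD pD qD)
      with 4 show ?case by (simp add: RC_objD[OF X])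
    qed (auto simp: h)
    show ?thesis
    proof (rule ex1I[of _ "\<lambda>n. \<lambda>x\<in>cell X n. h n x"], intro conjI hom)
      show "Comp RC X E A p (\<lambda>n. \<lambda>x\<in>cell X n. h n x) = f"
        by (rule RC_hom_eqI[OF X A cat_comp[OF category_RC X E A hom p] f]) (simp add: RC_Comp compose_eq h)
      show "Comp RC X E B q (\<lambda>n. \<lambda>x\<in>cell X n. h n x) = g"
        by (rule RC_hom_eqI[OF X B cat_comp[OF category_RC X E B hom q] g]) (simp add: RC_Comp compose_eq h)
    next
      fix k assume k: "k \<in> Hom RC X E \<and> Comp RC X E A p k = f \<and> Comp RC X E B q k = g"
      then have pqk: "p n (k n x) = f n x" "q n (k n x) = g n x" if "x \<in> cell X n" for n x
        using that by (auto simp: RC_Comp compose_eq)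
      have "k n x = h n x" if "x \<in> cell X n" for n x
        using that RC_homD(2)[OF X E conjunct1[OF k] that] by (simp add: uniq pqk h)
      then show "k = (\<lambda>n. \<lambda>x\<in>cell X n. h n x)"
        by (intro RC_hom_eqI[OF X E conjunct1[OF k] hom]) simp
    qed
  qed
  then show ?thesis
    using E p q by (simp add: is_product_def)
qed

text \<open>The presheaf of products of fibres is realised, and its two coordinates are turned back
  into morphisms by \<open>bij_betw_fibrewise\<close>.\<close>

lemma fibre_product:
  assumes A: "A \<in> Obj RC" and B: "B \<in> Obj RC"
  obtains E p q where "E \<in> Obj RC" "p \<in> Hom RC E A" "q \<in> Hom RC E B"
    "\<And>n. bij_betw (\<lambda>z. (p n z, q n z)) (cell E n) (pairs A B n)"
proof -
  \<comment> \<open>A product of fibres is not a set of the right type, so the union is reindexed by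
    the first coordinate \<open>a\<close>, which determines \<open>w\<close>. It becomes a disjoint
    union, over the cells of \<open>A\<close>, of fibres of \<open>B\<close>, and these lie in
    \<open>U\<close>.\<close>
  have emb: "\<exists>S\<in>U. \<exists>f. bij_betw f (SIGMA w:cells W n. fib A (n, w) \<times> fib B (n, w)) S" for n
  proof -
    obtain S f where S: "S \<in> U" and f: "bij_betw f (SIGMA a:cell A n. fib B (n, ret A n a)) S"
      using universe_Sigma[OF GS_D(1)[OF RC_objD(1)[OF A]], of n "\<lambda>a. fib B (n, ret A n a)"]
        fib_in_universe[OF B] by blast
    have "bij_betw (\<lambda>(w, a, b). (a, b)) (SIGMA w:cells W n. fib A (n, w) \<times> fib B (n, w))
      (SIGMA a:cell A n. fib B (n, ret A n a))"
      by (rule bij_betw_byWitness[where f' = "\<lambda>(a, b). (ret A n a, a, b)"])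
        (auto simp: fib_def RC_objD[OF A])
    from bij_betw_trans[OF this f] S show ?thesis by blast
  qed
  obtain E \<theta> where E: "E \<in> Obj RC"
    and bij: "\<And>x. x \<in> Obj Simp \<Longrightarrow> bij_betw (\<theta> x) (fib E x) (fib A x \<times> fib B x)"
    and pt: "\<And>x. x \<in> Obj Simp \<Longrightarrow> \<theta> x (sec E (fst x) (snd x)) = (sec A (fst x) (snd x), sec B (fst x) (snd x))"
    and nat: "\<And>x y \<phi> z. x \<in> Obj Simp \<Longrightarrow> y \<in> Obj Simp \<Longrightarrow> \<phi> \<in> Hom Simp y x \<Longrightarrow> z \<in> fib E x \<Longrightarrow>
      \<theta> y (res E (fst x) (fst y) \<phi> z) = map_prod (res A (fst x) (fst y) \<phi>) (res B (fst x) (fst y) \<phi>) (\<theta> x z)"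
  proof (rule realization[where F = "\<lambda>x. fib A x \<times> fib B x"
        and pt = "\<lambda>x. (sec A (fst x) (snd x), sec B (fst x) (snd x))"
        and T = "\<lambda>x y \<phi>. map_prod (res A (fst x) (fst y) \<phi>) (res B (fst x) (fst y) \<phi>)"], goal_cases)
    case (1 n)
    show ?case by (rule emb)
  next
    case (2 x y \<phi> k)
    then show ?case by (simp add: mem_Times_iff res_fib A B del: Simp_simps)
  next
    case (3 x k)
    then show ?case by (auto simp: fib_def RC_objD[OF A] RC_objD[OF B])
  next
    case (4 x y z \<phi> \<psi> k)
    then show ?case by (auto simp: fib_def RC_objD[OF A] RC_objD[OF B] pull_pull)
  qed (auto simp: A B res_fib sec_fib res_sec simp del: Simp_simps)
  have \<theta>: "\<theta> x z \<in> fib A x \<times> fib B x" if "x \<in> Obj Simp" "z \<in> fib E x" for x z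
    using bij[OF that(1)] that(2) by (auto simp: bij_betw_def)
  have \<theta>12: "fst (\<theta> x z) \<in> fib A x" "snd (\<theta> x z) \<in> fib B x" if "x \<in> Obj Simp" "z \<in> fib E x" for x z
    using \<theta>[OF that] by auto
  note simps = PiE_iff \<theta>12 res_fib[OF E] sec_fib[OF E] pt nat
  \<comment> \<open>The coordinates of \<open>\<theta>\<close> are fibrewise maps, hence of the form
    \<open>fibrewise E p\<close> and \<open>fibrewise E q\<close> for morphisms \<open>p\<close> and
    \<open>q\<close>.\<close>
  have "(\<lambda>x\<in>Obj Simp. \<lambda>z\<in>fib E x. fst (\<theta> x z)) \<in> fib_maps E A"
    by (simp add: fib_maps_def simps del: Simp_simps)
  then have "(\<lambda>x\<in>Obj Simp. \<lambda>z\<in>fib E x. fst (\<theta> x z)) \<in> fibrewise E ` Hom RC E A"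
    unfolding bij_betw_imp_surj_on[OF bij_betw_fibrewise[OF E A]] .
  then obtain p where p_eq: "(\<lambda>x\<in>Obj Simp. \<lambda>z\<in>fib E x. fst (\<theta> x z)) = fibrewise E p" and p: "p \<in> Hom RC E A"
    by (rule imageE)
  have "(\<lambda>x\<in>Obj Simp. \<lambda>z\<in>fib E x. snd (\<theta> x z)) \<in> fib_maps E B"
    by (simp add: fib_maps_def simps del: Simp_simps)
  then have "(\<lambda>x\<in>Obj Simp. \<lambda>z\<in>fib E x. snd (\<theta> x z)) \<in> fibrewise E ` Hom RC E B"
    unfolding bij_betw_imp_surj_on[OF bij_betw_fibrewise[OF E B]] .
  then obtain q where q_eq: "(\<lambda>x\<in>Obj Simp. \<lambda>z\<in>fib E x. snd (\<theta> x z)) = fibrewise E q" and q: "q \<in> Hom RC E B"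
    by (rule imageE)
  have pq: "(p n z, q n z) = \<theta> (n, w) z" if "w \<in> cells W n" "z \<in> fib E (n, w)" for n w z
    using fun_cong[OF fun_cong[OF p_eq], of "(n, w)" z] fun_cong[OF fun_cong[OF q_eq], of "(n, w)" z] that
    by (simp add: fibrewise_def prod_eq_iff)
  note pD = RC_homD[OF E A p] and qD = RC_homD[OF E B q]
  have "bij_betw (\<lambda>z. (p n z, q n z)) (cell E n) (pairs A B n)" for n
    unfolding bij_betw_def
  proof
    show "inj_on (\<lambda>z. (p n z, q n z)) (cell E n)"
    proof (rule inj_onI)
      fix z z' assume z: "z \<in> cell E n" "z' \<in> cell E n" and eq: "(p n z, q n z) = (p n z', q n z')"
      \<comment> \<open>Equal images under \<open>p\<close> put \<open>z\<close> and
        \<open>z'\<close> into one fibre, where \<open>\<theta>\<close> is injective.\<close>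
      have "ret E n z = ret E n z'" using pD(4)[OF z(1)] pD(4)[OF z(2)] eq by simp
      then have "z \<in> fib E (n, ret E n z)" "z' \<in> fib E (n, ret E n z)" "ret E n z \<in> cells W n"
        using z E by (simp_all add: fib_def RC_objD)
      with eq bij[of "(n, ret E n z)"] show "z = z'"
        by (simp add: pq bij_betw_def inj_on_def)
    qed
    show "(\<lambda>z. (p n z, q n z)) ` cell E n = pairs A B n"
    proof (intro equalityI subsetI)
      fix ab assume "ab \<in> (\<lambda>z. (p n z, q n z)) ` cell E n"
      then show "ab \<in> pairs A B n" by (auto simp: pairs_def pD qD)
    next
      fix ab assume "ab \<in> pairs A B n"
      then have w: "ret A n (fst ab) \<in> cells W n" "ab \<in> fib A (n, ret A n (fst ab)) \<times> fib B (n, ret A n (fst ab))"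
        using RC_objD(2)[OF B] by (auto simp: pairs_def fib_def)
      then obtain z where "z \<in> fib E (n, ret A n (fst ab))" "ab = \<theta> (n, ret A n (fst ab)) z"
        using bij_betw_imp_surj_on[OF bij[of "(n, ret A n (fst ab))"]] by auto
      with pq[OF w(1)] show "ab \<in> (\<lambda>z. (p n z, q n z)) ` cell E n" by (force simp: fib_def)
    qed
  qed
  with E p q that show thesis by blast
qed

text \<open>Of an arbitrary product only the universal property is known. It is compared with a
  fibre product by mutually inverse morphisms \<open>h\<close> and \<open>k\<close>, and the
  bijection is carried over along \<open>h\<close>.\<close>

lemma product_bij:
  assumes A: "A \<in> Obj RC" and B: "B \<in> Obj RC" and P: "is_product RC A B (P, p, q)"
  shows "bij_betw (\<lambda>z. (p n z, q n z)) (cell P n) (pairs A B n)"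
proof -
  have PO: "P \<in> Obj RC" and p: "p \<in> Hom RC P A" and q: "q \<in> Hom RC P B"
    and univ: "\<And>X f g. X \<in> Obj RC \<Longrightarrow> f \<in> Hom RC X A \<Longrightarrow> g \<in> Hom RC X B \<Longrightarrow>
      \<exists>!h. h \<in> Hom RC X P \<and> Comp RC X P A p h = f \<and> Comp RC X P B q h = g"
    using P by (auto simp: is_product_def)
  obtain E p' q' where E: "E \<in> Obj RC" and p': "p' \<in> Hom RC E A" and q': "q' \<in> Hom RC E B"
    and bij: "\<And>n. bij_betw (\<lambda>z. (p' n z, q' n z)) (cell E n) (pairs A B n)"
    by (rule fibre_product[OF A B]) blast
  obtain k where k: "k \<in> Hom RC E P" "Comp RC E P A p k = p'" "Comp RC E P B q k = q'"
    using univ[OF E p' q'] by blast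
  obtain h where h: "h \<in> Hom RC P E" "Comp RC P E A p' h = p" "Comp RC P E B q' h = q"
    using is_product_if_bij[OF A B E p' q' bij] PO p q by (simp add: is_product_def) metis
  have kh_hom: "Comp RC P E P k h \<in> Hom RC P P"
    using cat_comp[OF category_RC PO E PO h(1) k(1)] .
  \<comment> \<open>Both sides have the projections \<open>p\<close> and \<open>q\<close>, so the
    uniqueness clause of the product identifies them.\<close>
  have "Comp RC P E P k h = Ide RC P"
  proof -
    have "Comp RC P P A p (Comp RC P E P k h) = p" "Comp RC P P B q (Comp RC P E P k h) = q"
      using cat_assoc[OF category_RC PO E PO A h(1) k(1) p] cat_assoc[OF category_RC PO E PO B h(1) k(1) q] h k
      by simp_all
    then show ?thesis
      using univ[OF PO p q] kh_hom cat_ide[OF category_RC PO]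
        cat_ide_right[OF category_RC PO A p] cat_ide_right[OF category_RC PO B q] by blast
  qed
  then have kh: "k n (h n z) = z" if "z \<in> cell P n" for n z
    using that by (simp add: RC_Comp RC_Ide fun_eq_iff compose_def) metis
  note hD = RC_homD[OF PO E h(1)] and kD = RC_homD[OF E PO k(1)]
  have "bij_betw (h n) (cell P n) (cell E n)"
  proof (rule bij_betw_byWitness[where f' = "k n"])
    \<comment> \<open>For the other composite, injectivity of the pair of projections on the fibre
      product decides.\<close>
    show "\<forall>z\<in>cell E n. h n (k n z) = z"
    proof
      fix z assume z: "z \<in> cell E n"
      have "p' n (h n (k n z)) = p' n z" "q' n (h n (k n z)) = q' n z"
        using z kD(2)[OF z] fun_cong[OF fun_cong[OF h(2)], of n "k n z"] fun_cong[OF fun_cong[OF h(3)], of n "k n z"]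
          fun_cong[OF fun_cong[OF k(2)], of n z] fun_cong[OF fun_cong[OF k(3)], of n z]
        by (simp_all add: RC_Comp compose_eq)
      then show "h n (k n z) = z"
        using bij[of n] z hD(2)[OF kD(2)[OF z]] by (simp add: bij_betw_def inj_on_def)
    qed
  qed (use kh hD kD in auto)
  from bij_betw_trans[OF this bij[of n]]
  have "bij_betw ((\<lambda>z. (p' n z, q' n z)) \<circ> h n) (cell P n) (pairs A B n)" .
  moreover have "p' n (h n z) = p n z" "q' n (h n z) = q n z" if "z \<in> cell P n" for z
    using fun_cong[OF fun_cong[OF h(2)], of n z] fun_cong[OF fun_cong[OF h(3)], of n z] that
    by (simp_all add: RC_Comp compose_eq)
  ultimately show ?thesis
    by (simp add: comp_def cong: bij_betw_cong)
qed

section \<open>The chosen products and internal multiplications, elementwise\<close>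

lemma is_product_product:
  assumes "A \<in> Obj RC" "B \<in> Obj RC"
  shows "is_product RC A B (prod_obj RC A B, proj1 RC A B, proj2 RC A B)"
proof -
  obtain E p q where "is_product RC A B (E, p, q)"
    by (rule fibre_product[OF assms]) (use is_product_if_bij[OF assms] in blast)
  then have "is_product RC A B (product RC A B)"
    unfolding product_def by (rule someI)
  then show ?thesis by (simp add: prod_obj_def proj1_def proj2_def)
qed

lemma product_RC:
  assumes "A \<in> Obj RC" "B \<in> Obj RC"
  shows "prod_obj RC A B \<in> Obj RC"
    and "proj1 RC A B \<in> Hom RC (prod_obj RC A B) A"
    and "proj2 RC A B \<in> Hom RC (prod_obj RC A B) B"
    and "bij_betw (\<lambda>z. (proj1 RC A B n z, proj2 RC A B n z)) (cell (prod_obj RC A B) n) (pairs A B n)"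
  using is_product_product[OF assms] product_bij[OF assms is_product_product[OF assms]]
  by (auto simp: is_product_def)

text \<open>Meaningful for cells over the same simplex of \<open>W\<close>; elsewhere
  \<open>inv_into\<close> is arbitrary, hence the recurring side condition on
  \<open>ret\<close>.\<close>

definition pr where
  "pr A B n a b = inv_into (cell (prod_obj RC A B) n) (\<lambda>z. (proj1 RC A B n z, proj2 RC A B n z)) (a, b)"

lemma pr:
  assumes "A \<in> Obj RC" "B \<in> Obj RC" "a \<in> cell A n" "b \<in> cell B n" "ret A n a = ret B n b"
  shows "pr A B n a b \<in> cell (prod_obj RC A B) n"
    and "proj1 RC A B n (pr A B n a b) = a" and "proj2 RC A B n (pr A B n a b) = b"
proof -
  have *: "(a, b) \<in> (\<lambda>z. (proj1 RC A B n z, proj2 RC A B n z)) ` cell (prod_obj RC A B) n"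
    using product_RC(4)[OF assms(1,2), of n] assms(3-5) by (simp add: bij_betw_def pairs_def)
  show "pr A B n a b \<in> cell (prod_obj RC A B) n"
    unfolding pr_def by (rule inv_into_into[OF *])
  show "proj1 RC A B n (pr A B n a b) = a" "proj2 RC A B n (pr A B n a b) = b"
    using f_inv_into_f[OF *] unfolding pr_def by simp_all
qed

lemma prod_obj_eqI:
  assumes "A \<in> Obj RC" "B \<in> Obj RC"
    "z \<in> cell (prod_obj RC A B) n" "z' \<in> cell (prod_obj RC A B) n"
    "proj1 RC A B n z = proj1 RC A B n z'" "proj2 RC A B n z = proj2 RC A B n z'"
  shows "z = z'"
  using product_RC(4)[OF assms(1,2), of n] assms(3-) by (auto simp: bij_betw_def inj_on_def)

lemma proj_cell:
  assumes AB: "A \<in> Obj RC" "B \<in> Obj RC" and z: "z \<in> cell (prod_obj RC A B) n"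
  shows "proj1 RC A B n z \<in> cell A n" "proj2 RC A B n z \<in> cell B n"
    and "ret A n (proj1 RC A B n z) = ret (prod_obj RC A B) n z"
    and "ret B n (proj2 RC A B n z) = ret (prod_obj RC A B) n z"
    and "pr A B n (proj1 RC A B n z) (proj2 RC A B n z) = z"
proof -
  note P = product_RC[OF AB]
  show c: "proj1 RC A B n z \<in> cell A n" "proj2 RC A B n z \<in> cell B n"
    "ret A n (proj1 RC A B n z) = ret (prod_obj RC A B) n z"
    "ret B n (proj2 RC A B n z) = ret (prod_obj RC A B) n z"
    using RC_homD[OF P(1) AB(1) P(2)] RC_homD[OF P(1) AB(2) P(3)] z by simp_all
  show "pr A B n (proj1 RC A B n z) (proj2 RC A B n z) = z"
    by (rule prod_obj_eqI[OF AB])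
      (use z pr[OF AB c(1,2) trans[OF c(3) c(4)[symmetric]]] in simp_all)
qed

text \<open>The projections commute with \<open>ret\<close> and \<open>res\<close>, and they are
  jointly injective.\<close>

lemma pr_natural:
  assumes AB: "A \<in> Obj RC" "B \<in> Obj RC" and a: "a \<in> cell A n" and b: "b \<in> cell B n"
    and r: "ret A n a = ret B n b"
  shows "ret (prod_obj RC A B) n (pr A B n a b) = ret A n a"
    and "\<phi> \<in> ops m n \<Longrightarrow>
      res (prod_obj RC A B) n m \<phi> (pr A B n a b) = pr A B m (res A n m \<phi> a) (res B n m \<phi> b)"
proof -
  note P = product_RC[OF AB]
  note p = RC_homD[OF P(1) AB(1) P(2)] and q = RC_homD[OF P(1) AB(2) P(3)]
  note pr_ab = pr[OF AB a b r]
  show "ret (prod_obj RC A B) n (pr A B n a b) = ret A n a"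
    using p(4)[OF pr_ab(1)] pr_ab by simp
  assume \<phi>: "\<phi> \<in> ops m n"
  have ab: "res A n m \<phi> a \<in> cell A m" "res B n m \<phi> b \<in> cell B m"
    "ret A m (res A n m \<phi> a) = ret B m (res B n m \<phi> b)"
    using AB a b r \<phi> by (simp_all add: RC_objD)
  show "res (prod_obj RC A B) n m \<phi> (pr A B n a b) = pr A B m (res A n m \<phi> a) (res B n m \<phi> b)"
  proof (rule prod_obj_eqI[OF AB])
    show "res (prod_obj RC A B) n m \<phi> (pr A B n a b) \<in> cell (prod_obj RC A B) m"
      using \<phi> pr_ab RC_objD(1)[OF P(1)] by simp
  qed (use p(3)[OF \<phi> pr_ab(1)] q(3)[OF \<phi> pr_ab(1)] pr_ab pr[OF AB ab] in simp_all)
qed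

lemma pairing:
  assumes X: "X \<in> Obj RC" and AB: "A \<in> Obj RC" "B \<in> Obj RC"
    and f: "f \<in> Hom RC X A" and g: "g \<in> Hom RC X B"
  shows "pairing RC X A B f g \<in> Hom RC X (prod_obj RC A B)"
    and "x \<in> cell X n \<Longrightarrow> pairing RC X A B f g n x = pr A B n (f n x) (g n x)"
proof -
  let ?h = "pairing RC X A B f g"
  note P = product_RC[OF AB]
  have "\<exists>!h. h \<in> Hom RC X (prod_obj RC A B) \<and>
     Comp RC X (prod_obj RC A B) A (proj1 RC A B) h = f \<and>
     Comp RC X (prod_obj RC A B) B (proj2 RC A B) h = g"
    using is_product_product[OF AB] X f g by (simp add: is_product_def)
  from theI'[OF this]
  have h: "?h \<in> Hom RC X (prod_obj RC A B)"
     and p: "Comp RC X (prod_obj RC A B) A (proj1 RC A B) ?h = f"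
     and q: "Comp RC X (prod_obj RC A B) B (proj2 RC A B) ?h = g"
    by (simp_all add: pairing_def)
  show "?h \<in> Hom RC X (prod_obj RC A B)" by (rule h)
  assume x: "x \<in> cell X n"
  from proj_cell(5)[OF AB RC_homD(2)[OF X P(1) h x]]
  show "?h n x = pr A B n (f n x) (g n x)"
    using fun_cong[OF fun_cong[OF p], of n x] fun_cong[OF fun_cong[OF q], of n x] x
    by (simp add: RC_Comp compose_eq)
qed

text \<open>The internal multiplication read as a partial operation on cells, with the same proviso
  as for \<open>pr\<close>.\<close>

definition mul where
  "mul A m n a b = m n (pr A A n a b)"

lemma mult_pair:
  assumes X: "X \<in> Obj RC" and A: "A \<in> Obj RC"
    and m: "m \<in> Hom RC (prod_obj RC A A) A" and f: "f \<in> Hom RC X A" and g: "g \<in> Hom RC X A"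
  shows "mult_pair RC A m X f g \<in> Hom RC X A"
    and "x \<in> cell X n \<Longrightarrow> mult_pair RC A m X f g n x = mul A m n (f n x) (g n x)"
  unfolding mult_pair_def
  using cat_comp[OF category_RC X product_RC(1)[OF A A] A pairing(1)[OF X A A f g] m]
    pairing(2)[OF X A A f g]
  by (simp_all add: RC_Comp compose_eq mul_def)

lemma mul:
  assumes A: "A \<in> Obj RC" and m: "m \<in> Hom RC (prod_obj RC A A) A"
    and ab: "a \<in> cell A n" "b \<in> cell A n" "ret A n a = ret A n b"
  shows "mul A m n a b \<in> cell A n" "ret A n (mul A m n a b) = ret A n a"
    and "\<phi> \<in> ops l n \<Longrightarrow> res A n l \<phi> (mul A m n a b) = mul A m l (res A n l \<phi> a) (res A n l \<phi> b)"
proof -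
  note m = RC_homD[OF product_RC(1)[OF A A] A m] and p = pr[OF A A ab] and n = pr_natural[OF A A ab]
  show "mul A m n a b \<in> cell A n" "ret A n (mul A m n a b) = ret A n a"
    using m p n by (simp_all add: mul_def)
  assume \<phi>: "\<phi> \<in> ops l n"
  show "res A n l \<phi> (mul A m n a b) = mul A m l (res A n l \<phi> a) (res A n l \<phi> b)"
    using m(3)[OF \<phi> p(1)] n(2)[OF \<phi>] by (simp add: mul_def)
qed

section \<open>The terminal object and units\<close>

lemma terminal_obj: "(W, (\<lambda>n. \<lambda>w\<in>cells W n. w), (\<lambda>n. \<lambda>w\<in>cells W n. w)) \<in> Obj RC"
  using W by (intro RC_objI) auto

lemma ret_terminal_obj:
  "A \<in> Obj RC \<Longrightarrow> ret A \<in> Hom RC A (W, (\<lambda>n. \<lambda>w\<in>cells W n. w), (\<lambda>n. \<lambda>w\<in>cells W n. w))"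
  using RC_objD[of A] by (intro RC_homI[OF _ terminal_obj]) (auto simp: PiE_iff)

text \<open>\<open>W\<close> over itself is terminal because a morphism to it must agree with the
  retraction; so the choice in \<open>terminal\<close> has a witness.\<close>

lemma is_terminal_terminal: "is_terminal RC (terminal RC)"
proof -
  let ?T = "(W, (\<lambda>n. \<lambda>w\<in>cells W n. w), (\<lambda>n. \<lambda>w\<in>cells W n. w))"
  have "\<exists>!f. f \<in> Hom RC A ?T" if A: "A \<in> Obj RC" for A
  proof (rule ex1I[of _ "ret A"], rule ret_terminal_obj[OF A])
    fix f assume f: "f \<in> Hom RC A ?T"
    show "f = ret A"
      using RC_homD[OF A terminal_obj f]
      by (intro RC_hom_eqI[OF A terminal_obj f ret_terminal_obj[OF A]]) simp
  qed
  then have "is_terminal RC ?T" using terminal_obj by (simp add: is_terminal_def)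
  then show ?thesis unfolding terminal_def by (rule someI)
qed

lemma terminal_RC: "terminal RC \<in> Obj RC"
  using is_terminal_terminal by (simp add: is_terminal_def)

lemma to_terminal_RC: "A \<in> Obj RC \<Longrightarrow> to_terminal RC A \<in> Hom RC A (terminal RC)"
  unfolding to_terminal_def using is_terminal_terminal
  by (intro theI'[of "\<lambda>f. f \<in> Hom RC A (terminal RC)"]) (simp add: is_terminal_def)

text \<open>Section after retraction is an endomorphism of a terminal object, hence the identity. So
  every cell of the chosen terminal object lies in its section.\<close>

lemma sec_ret_terminal:
  assumes t: "t \<in> cell (terminal RC) n"
  shows "sec (terminal RC) n (ret (terminal RC) n t) = t"
proof -
  let ?T = "terminal RC"
  have h: "(\<lambda>n. \<lambda>t\<in>cell ?T n. sec ?T n (ret ?T n t)) \<in> Hom RC ?T ?T"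
    using RC_objD[OF terminal_RC] by (intro RC_homI[OF terminal_RC terminal_RC]) auto
  have "(\<lambda>n. \<lambda>t\<in>cell ?T n. sec ?T n (ret ?T n t)) = Ide RC ?T"
    using is_terminal_terminal terminal_RC h cat_ide[OF category_RC terminal_RC]
    unfolding is_terminal_def by blast
  from fun_cong[OF fun_cong[OF this], of n t] show ?thesis using t by (simp add: RC_Ide)
qed

text \<open>A unit \<open>e\<close> carries no data: morphisms preserve sections, and the terminal
  object consists of its section.\<close>

lemma Comp_to_terminal:
  assumes A: "A \<in> Obj RC" and e: "e \<in> Hom RC (terminal RC) A" and a: "a \<in> cell A n"
  shows "Comp RC A (terminal RC) A e (to_terminal RC A) n a = sec A n (ret A n a)"
proof -
  let ?T = "terminal RC" let ?t = "to_terminal RC A n a"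
  note t = RC_homD[OF A terminal_RC to_terminal_RC[OF A]]
  have "?t = sec ?T n (ret A n a)"
    using sec_ret_terminal[OF t(2)[OF a]] t(4)[OF a] by simp
  then show ?thesis
    using a RC_homD(5)[OF terminal_RC A e] RC_objD(2)[OF A a] by (simp add: RC_Comp compose_eq)
qed

section \<open>Internal abelian groups and groups on the fibres\<close>

lemma RC_hom_eq_iff:
  assumes "A \<in> Obj RC" "B \<in> Obj RC" "f \<in> Hom RC A B" "f' \<in> Hom RC A B"
  shows "f = f' \<longleftrightarrow> (\<forall>n. \<forall>y\<in>cell A n. f n y = f' n y)"
  using RC_hom_eqI[OF assms] by auto

text \<open>Each diagram is an equation between two morphisms into \<open>A\<close>, evaluated on
  cells. The cells of the iterated products are exactly the tuples of cells over a common simplex,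
  so the diagrams become laws for such tuples.\<close>

lemma abelian_group_object_iff:
  assumes A: "A \<in> Obj RC" and m: "m \<in> Hom RC (prod_obj RC A A) A"
    and e: "e \<in> Hom RC (terminal RC) A" and i: "i \<in> Hom RC A A"
  shows "abelian_group_object RC A m e i \<longleftrightarrow>
    (\<forall>n. \<forall>a\<in>cell A n. \<forall>b\<in>cell A n. \<forall>c\<in>cell A n. ret A n a = ret A n b \<longrightarrow> ret A n b = ret A n c \<longrightarrow>
      mul A m n (mul A m n a b) c = mul A m n a (mul A m n b c)) \<and>
    (\<forall>n. \<forall>a\<in>cell A n. \<forall>b\<in>cell A n. ret A n a = ret A n b \<longrightarrow> mul A m n b a = mul A m n a b) \<and>
    (\<forall>n. \<forall>a\<in>cell A n. mul A m n (sec A n (ret A n a)) a = a) \<and>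
    (\<forall>n. \<forall>a\<in>cell A n. mul A m n (i n a) a = sec A n (ret A n a))"
proof -
  let ?AA = "prod_obj RC A A" let ?AAA = "prod_obj RC ?AA A"
  have AA: "?AA \<in> Obj RC" using product_RC(1)[OF A A] .
  have AAA: "?AAA \<in> Obj RC" using product_RC(1)[OF AA A] .
  define a where "a = Comp RC ?AAA ?AA A (proj1 RC A A) (proj1 RC ?AA A)"
  define b where "b = Comp RC ?AAA ?AA A (proj2 RC A A) (proj1 RC ?AA A)"
  define c where "c = proj2 RC ?AA A"
  have a: "a \<in> Hom RC ?AAA A" and b: "b \<in> Hom RC ?AAA A" and c: "c \<in> Hom RC ?AAA A"
    using product_RC[OF A A] product_RC[OF AA A] A
    by (auto simp: a_def b_def c_def intro: cat_comp[OF category_RC, where y = ?AA])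
  note mp = mult_pair(1)[OF _ A m] and mp_eq = mult_pair(2)[OF _ A m]
  \<comment> \<open>Nested \<open>pr\<close> realises every compatible triple by a cell of the
    triple product; this gives the passage from the diagram to the law.\<close>
  have abc: "a n (pr ?AA A n (pr A A n x y) z) = x" "b n (pr ?AA A n (pr A A n x y) z) = y"
    "c n (pr ?AA A n (pr A A n x y) z) = z" "pr ?AA A n (pr A A n x y) z \<in> cell ?AAA n"
    if "x \<in> cell A n" "y \<in> cell A n" "z \<in> cell A n" "ret A n x = ret A n y" "ret A n y = ret A n z" for n x y z
    using that pr[OF A A, of x n y] pr[OF AA A, of "pr A A n x y" n z] pr_natural(1)[OF A A, of x n y]
    by (simp_all add: a_def b_def c_def RC_Comp compose_eq)
  have assoc: "mult_pair RC A m ?AAA (mult_pair RC A m ?AAA a b) c =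
      mult_pair RC A m ?AAA a (mult_pair RC A m ?AAA b c) \<longleftrightarrow>
    (\<forall>n. \<forall>a\<in>cell A n. \<forall>b\<in>cell A n. \<forall>c\<in>cell A n. ret A n a = ret A n b \<longrightarrow> ret A n b = ret A n c \<longrightarrow>
      mul A m n (mul A m n a b) c = mul A m n a (mul A m n b c))" (is "?l = ?r \<longleftrightarrow> ?Q")
  proof -
    have "?l = ?r \<longleftrightarrow> (\<forall>n. \<forall>z\<in>cell ?AAA n. ?l n z = ?r n z)"
      by (rule RC_hom_eq_iff[OF AAA A]) (intro mp AAA a b c)+
    also have "\<dots> \<longleftrightarrow> (\<forall>n. \<forall>z\<in>cell ?AAA n.
        mul A m n (mul A m n (a n z) (b n z)) (c n z) = mul A m n (a n z) (mul A m n (b n z) (c n z)))"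
      by (simp add: mp_eq[OF AAA] mp[OF AAA] a b c)
    also have "\<dots> \<longleftrightarrow> ?Q"
    proof
      assume L: "\<forall>n. \<forall>z\<in>cell ?AAA n.
        mul A m n (mul A m n (a n z) (b n z)) (c n z) = mul A m n (a n z) (mul A m n (b n z) (c n z))"
      show ?Q
      proof (intro allI ballI impI)
        fix n x y z assume "x \<in> cell A n" "y \<in> cell A n" "z \<in> cell A n" "ret A n x = ret A n y" "ret A n y = ret A n z"
        note * = abc[OF this]
        from L[rule_format, OF *(4)]
        show "mul A m n (mul A m n x y) z = mul A m n x (mul A m n y z)" by (simp add: *)
      qed
    next
      assume ?Q
      moreover have "a n z \<in> cell A n" "b n z \<in> cell A n" "c n z \<in> cell A n"
        "ret A n (a n z) = ret A n (b n z)" "ret A n (b n z) = ret A n (c n z)"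
        if "z \<in> cell ?AAA n" for n z
        using that RC_homD[OF AAA A a] RC_homD[OF AAA A b] RC_homD[OF AAA A c] by simp_all
      ultimately show "\<forall>n. \<forall>z\<in>cell ?AAA n.
        mul A m n (mul A m n (a n z) (b n z)) (c n z) = mul A m n (a n z) (mul A m n (b n z) (c n z))"
        by blast
    qed
    finally show ?thesis .
  qed
  have comm: "mult_pair RC A m ?AA (proj2 RC A A) (proj1 RC A A) = m \<longleftrightarrow>
    (\<forall>n. \<forall>a\<in>cell A n. \<forall>b\<in>cell A n. ret A n a = ret A n b \<longrightarrow> mul A m n b a = mul A m n a b)" (is "?l = m \<longleftrightarrow> ?Q")
  proof -
    note p = product_RC(2,3)[OF A A]
    have "?l = m \<longleftrightarrow> (\<forall>n. \<forall>z\<in>cell ?AA n. ?l n z = m n z)"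
      by (rule RC_hom_eq_iff[OF AA A]) (intro mp AA p m)+
    \<comment> \<open>The value \<open>m n z\<close> becomes a product of the two projections
      because \<open>z\<close> is the \<open>pr\<close> of them.\<close>
    also have "\<dots> \<longleftrightarrow> (\<forall>n. \<forall>z\<in>cell ?AA n.
        mul A m n (proj2 RC A A n z) (proj1 RC A A n z) = mul A m n (proj1 RC A A n z) (proj2 RC A A n z))"
      by (simp add: mp_eq[OF AA] p) (simp add: mul_def proj_cell[OF A A])
    also have "\<dots> \<longleftrightarrow> ?Q"
    proof
      assume L: "\<forall>n. \<forall>z\<in>cell ?AA n.
        mul A m n (proj2 RC A A n z) (proj1 RC A A n z) = mul A m n (proj1 RC A A n z) (proj2 RC A A n z)"
      show ?Q
      proof (intro allI ballI impI)
        fix n x y assume "x \<in> cell A n" "y \<in> cell A n" "ret A n x = ret A n y"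
        note * = pr[OF A A this]
        from L[rule_format, OF *(1)] show "mul A m n y x = mul A m n x y" by (simp add: *)
      qed
    next
      assume ?Q
      then show "\<forall>n. \<forall>z\<in>cell ?AA n.
        mul A m n (proj2 RC A A n z) (proj1 RC A A n z) = mul A m n (proj1 RC A A n z) (proj2 RC A A n z)"
        using proj_cell[OF A A] by simp
    qed
    finally show ?thesis .
  qed
  note I = cat_ide[OF category_RC A]
  have T: "Comp RC A (terminal RC) A e (to_terminal RC A) \<in> Hom RC A A"
    using cat_comp[OF category_RC A terminal_RC A to_terminal_RC[OF A] e] .
  have unit: "mult_pair RC A m A (Comp RC A (terminal RC) A e (to_terminal RC A)) (Ide RC A) = Ide RC A \<longleftrightarrow>
    (\<forall>n. \<forall>a\<in>cell A n. mul A m n (sec A n (ret A n a)) a = a)"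
    by (subst RC_hom_eq_iff[OF A A mp[OF A T I] I])
      (simp add: mp_eq[OF A T I] Comp_to_terminal[OF A e], simp add: RC_Ide)
  have inv: "mult_pair RC A m A i (Ide RC A) = Comp RC A (terminal RC) A e (to_terminal RC A) \<longleftrightarrow>
    (\<forall>n. \<forall>a\<in>cell A n. mul A m n (i n a) a = sec A n (ret A n a))"
    by (subst RC_hom_eq_iff[OF A A mp[OF A i I] T])
      (simp add: mp_eq[OF A i I] Comp_to_terminal[OF A e], simp add: RC_Ide)
  show ?thesis
    unfolding abelian_group_object_def Let_def a_def[symmetric] b_def[symmetric] c_def[symmetric]
      assoc comm unit inv
    using A m e i by blast
qed

text \<open>\<open>M\<close> depends on the simplex so that it may be an internal multiplication or
  one transported from a presheaf of groups.\<close>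

definition fibre_group where
  "fibre_group A M x = \<lparr>carrier = fib A x, monoid.mult = M x, one = sec A (fst x) (snd x)\<rparr>"

lemma fibre_group_simps [simp]:
  "carrier (fibre_group A M x) = fib A x"
  "monoid.mult (fibre_group A M x) = M x"
  "one (fibre_group A M x) = sec A (fst x) (snd x)"
  by (simp_all add: fibre_group_def)

lemma comm_group_fibre:
  assumes ab: "abelian_group_object RC A m e i" and x: "x \<in> Obj Simp"
  shows "comm_group (fibre_group A (\<lambda>x. mul A m (fst x)) x)"
proof -
  have A: "A \<in> Obj RC" and m: "m \<in> Hom RC (prod_obj RC A A) A"
    and e: "e \<in> Hom RC (terminal RC) A" and i: "i \<in> Hom RC A A"
    using ab by (auto simp: abelian_group_object_def)
  note * = ab[unfolded abelian_group_object_iff[OF A m e i]]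
  show ?thesis
  proof (rule comm_groupI, unfold fibre_group_simps)
    fix a assume a: "a \<in> fib A x"
    have "mul A m (fst x) (i (fst x) a) a = sec A (fst x) (snd x)" "i (fst x) a \<in> fib A x"
      using * a RC_homD[OF A A i] by (auto simp: fib_def)
    then show "\<exists>y\<in>fib A x. mul A m (fst x) y a = sec A (fst x) (snd x)" by blast
  next
    fix a b assume "a \<in> fib A x" "b \<in> fib A x"
    then show "mul A m (fst x) a b \<in> fib A x" "mul A m (fst x) a b = mul A m (fst x) b a"
      using * mul(1,2)[OF A m, of a "fst x" b] by (simp_all add: fib_def)
  next
    fix a b c assume "a \<in> fib A x" "b \<in> fib A x" "c \<in> fib A x"
    then show "mul A m (fst x) (mul A m (fst x) a b) c = mul A m (fst x) a (mul A m (fst x) b c)"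
      using conjunct1[OF *] by (simp add: fib_def)
  next
    fix a assume "a \<in> fib A x"
    then have "a \<in> cell A (fst x)" and snd_x: "snd x = ret A (fst x) a" by (simp_all add: fib_def)
    with * show "mul A m (fst x) (sec A (fst x) (snd x)) a = a"
      unfolding snd_x by blast
  qed (rule sec_fib[OF A x])
qed

text \<open>Compatibility with restriction is assumed for the multiplication only. Units are base
  points and so compatible already, and inverses are compatible because group homomorphisms preserve
  them.\<close>

lemma ex_abelian_group_object:
  assumes A: "A \<in> Obj RC"
    and grp: "\<And>x. x \<in> Obj Simp \<Longrightarrow> comm_group (fibre_group A M x)"
    and nat: "\<And>x y \<phi> a b. x \<in> Obj Simp \<Longrightarrow> y \<in> Obj Simp \<Longrightarrow> \<phi> \<in> Hom Simp y x \<Longrightarrow>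
      a \<in> fib A x \<Longrightarrow> b \<in> fib A x \<Longrightarrow>
      res A (fst x) (fst y) \<phi> (M x a b) = M y (res A (fst x) (fst y) \<phi> a) (res A (fst x) (fst y) \<phi> b)"
  obtains m e i where "abelian_group_object RC A m e i"
    and "\<And>x a b. x \<in> Obj Simp \<Longrightarrow> a \<in> fib A x \<Longrightarrow> b \<in> fib A x \<Longrightarrow> mul A m (fst x) a b = M x a b"
proof -
  let ?AA = "prod_obj RC A A" let ?T = "terminal RC"
  have AA: "?AA \<in> Obj RC" using product_RC(1)[OF A A] .
  have group: "group (fibre_group A M x)" if "x \<in> Obj Simp" for x
    using grp[OF that] by (rule comm_group.axioms(2))
  note closed = monoid.m_closed[OF group.is_monoid[OF group], simplified fibre_group_simps]
  have obj: "(n, ret A n a) \<in> Obj Simp" if "a \<in> cell A n" for n a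
    using that A by (simp add: RC_objD)
  have M: "M (n, ret A n a) a b \<in> fib A (n, ret A n a)"
    if "a \<in> cell A n" "b \<in> cell A n" "ret A n a = ret A n b" for n a b
    using that by (intro closed obj) (simp_all add: fib_def)
  have M_nat: "res A n l \<phi> (M (n, ret A n a) a b) =
      M (l, pull W n l \<phi> (ret A n a)) (res A n l \<phi> a) (res A n l \<phi> b)"
    if "\<phi> \<in> ops l n" "a \<in> cell A n" "b \<in> cell A n" "ret A n a = ret A n b" for n l \<phi> a b
    using nat[of "(n, ret A n a)" "(l, pull W n l \<phi> (ret A n a))" \<phi> a b] that W A
    by (simp add: RC_objD fib_def)
  \<comment> \<open>The base point is the unit, hence idempotent; this is what makes the
    multiplication \<open>m\<close> respect sections.\<close>
  have M_sec: "M (n, w) (sec A n w) (sec A n w) = sec A n w" if "w \<in> cells W n" for n w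
    using monoid.l_one[OF group.is_monoid[OF group[of "(n, w)"]], of "sec A n w"] that sec_fib[OF A, of "(n, w)"]
    by simp
  define m where "m = (\<lambda>n. \<lambda>z\<in>cell ?AA n. M (n, ret A n (proj1 RC A A n z)) (proj1 RC A A n z) (proj2 RC A A n z))"
  note P = proj_cell[OF A A]
  note p = RC_homD[OF AA A product_RC(2)[OF A A]] and q = RC_homD[OF AA A product_RC(3)[OF A A]]
  have Mz: "M (n, ret ?AA n z) (proj1 RC A A n z) (proj2 RC A A n z) \<in> fib A (n, ret ?AA n z)"
    if "z \<in> cell ?AA n" for n z
    using M[of "proj1 RC A A n z" n "proj2 RC A A n z"] P that by simp
  have m: "m \<in> Hom RC ?AA A"
  proof (rule RC_homI[OF AA A], goal_cases)
    case (1 n)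
    show ?case using Mz P by (auto simp: m_def fib_def)
  next
    case (2 l n \<phi> z)
    then show ?case
      using M_nat[OF 2(1), of "proj1 RC A A n z" "proj2 RC A A n z"] RC_objD[OF AA] RC_objD[OF A] p q
      by (simp add: m_def)
  next
    case (3 n z)
    then show ?case using Mz[OF 3] P by (simp add: m_def fib_def)
  next
    case (4 n w)
    then show ?case using M_sec p q by (simp add: m_def RC_objD[OF AA] RC_objD[OF A])
  qed
  \<comment> \<open>Passing through \<open>ret\<close> makes the unit independent of which terminal
    object was chosen.\<close>
  define e where "e = (\<lambda>n. \<lambda>t\<in>cell ?T n. sec A n (ret ?T n t))"
  have e: "e \<in> Hom RC ?T A"
    using RC_objD[OF A] RC_objD[OF terminal_RC] by (intro RC_homI[OF terminal_RC A]) (auto simp: e_def)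
  define i where "i = (\<lambda>n. \<lambda>a\<in>cell A n. m_inv (fibre_group A M (n, ret A n a)) a)"
  have inv: "m_inv (fibre_group A M (n, ret A n a)) a \<in> fib A (n, ret A n a)"
    "M (n, ret A n a) (m_inv (fibre_group A M (n, ret A n a)) a) a = sec A n (ret A n a)"
    if "a \<in> cell A n" for n a
    using group.inv_closed[OF group[OF obj[OF that]], of a] group.l_inv[OF group[OF obj[OF that]], of a] that
    by (simp_all add: fib_def)
  have i: "i \<in> Hom RC A A"
  proof (rule RC_homI[OF A A], goal_cases)
    case (2 l n \<phi> a)
    let ?x = "(n, ret A n a)" let ?y = "(l, pull W n l \<phi> (ret A n a))"
    have x: "?x \<in> Obj Simp" "?y \<in> Obj Simp" "\<phi> \<in> Hom Simp ?y ?x" "a \<in> fib A ?x"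
      using 2 A W by (simp_all add: RC_objD fib_def)
    \<comment> \<open>Restriction is a homomorphism of fibre groups, so it commutes with
      \<open>m_inv\<close>.\<close>
    have "group_hom (fibre_group A M ?x) (fibre_group A M ?y) (res A n l \<phi>)"
      using nat[OF x(1-3)] res_fib[OF A x(3)]
      by (intro group_hom.intro group_hom_axioms.intro group x(1,2)) (simp add: hom_def)
    from group_hom.hom_inv[OF this, of a] show ?case
      using 2 x(4) by (simp add: i_def RC_objD[OF A])
  next
    case (4 n w)
    \<comment> \<open>Inversion respects sections, as the unit is its own inverse.\<close>
    then have "m_inv (fibre_group A M (n, w)) \<one>\<^bsub>fibre_group A M (n, w)\<^esub> = \<one>\<^bsub>fibre_group A M (n, w)\<^esub>"
      by (intro monoid.inv_one group.is_monoid group) simp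
    with 4 show ?case by (simp add: i_def RC_objD[OF A])
  qed (use inv in \<open>auto simp: i_def fib_def\<close>)
  have mul: "mul A m n a b = M (n, ret A n a) a b"
    if "a \<in> cell A n" "b \<in> cell A n" "ret A n a = ret A n b" for n a b
    using pr[OF A A that] by (simp add: mul_def m_def)
  have in_fib: "b \<in> fib A (n, w)" if "b \<in> cell A n" "ret A n b = w" for n w b
    using that by (simp add: fib_def)
  have "abelian_group_object RC A m e i"
    unfolding abelian_group_object_iff[OF A m e i]
  proof (intro conjI allI ballI impI, goal_cases)
    case (1 n a b c)
    have "M (n, ret A n a) (M (n, ret A n a) a b) c = M (n, ret A n a) a (M (n, ret A n a) b c)"
      using monoid.m_assoc[OF group.is_monoid[OF group[OF obj[OF 1(1)]]], of a b c] 1 by (simp add: in_fib)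
    then show ?case
      using 1 M[of a n b] M[of b n c] by (simp add: mul fib_def)
  next
    case (2 n a b)
    then show ?case
      using comm_monoid.m_comm[OF comm_group.axioms(1)[OF grp[OF obj[OF 2(1)]]], of b a] by (simp add: mul in_fib)
  next
    case (3 n a)
    then show ?case
      using monoid.l_one[OF group.is_monoid[OF group[OF obj[OF 3]]], of a] by (simp add: mul in_fib RC_objD[OF A])
  next
    case (4 n a)
    then show ?case using inv[OF 4] by (simp add: mul i_def fib_def)
  qed
  moreover have "mul A m (fst x) a b = M x a b" if "x \<in> Obj Simp" "a \<in> fib A x" "b \<in> fib A x" for x a b
    using that mul[of a "fst x" b] by (simp add: fib_def)
  ultimately show thesis by (rule that)
qed

section \<open>Abelian group objects and presheaves of abelian groups\<close>

abbreviation "AbRC \<equiv> Ab_objects RC"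

abbreviation fmul where "fmul a n \<equiv> mul (fst a) (fst (snd a)) n"

section \<open>Homomorphisms of abelian group objects\<close>

lemma AbRC_obj_iff:
  "a \<in> Obj AbRC \<longleftrightarrow> abelian_group_object RC (fst a) (fst (snd a)) (fst (snd (snd a))) (snd (snd (snd a)))"
  by (auto simp: Ab_objects_def)

lemma AbRC_objD:
  assumes "a \<in> Obj AbRC"
  shows "fst a \<in> Obj RC" "fst (snd a) \<in> Hom RC (prod_obj RC (fst a) (fst a)) (fst a)"
  using assms by (simp_all add: AbRC_obj_iff abelian_group_object_def)

lemma AbRC_simps:
  "Ide AbRC a = Ide RC (fst a)"
  "Comp AbRC a b d = Comp RC (fst a) (fst b) (fst d)"
  by (simp_all add: Ab_objects_def split_beta)

text \<open>Two elements of one fibre are the projections of a cell of the product, and every cell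
  of the product arises so; hence the internal homomorphism equation is additivity on each
  fibre.\<close>

lemma AbRC_hom_iff:
  assumes a: "a \<in> Obj AbRC" and b: "b \<in> Obj AbRC"
  shows "f \<in> Hom AbRC a b \<longleftrightarrow> f \<in> Hom RC (fst a) (fst b) \<and>
    (\<forall>x\<in>Obj Simp. \<forall>u\<in>fib (fst a) x. \<forall>v\<in>fib (fst a) x.
      f (fst x) (fmul a (fst x) u v) = fmul b (fst x) (f (fst x) u) (f (fst x) v))"
proof -
  obtain A m ei where a': "a = (A, m, ei)" by (metis prod_cases3)
  obtain B m' ei' where b': "b = (B, m', ei')" by (metis prod_cases3)
  have A: "A \<in> Obj RC" and m: "m \<in> Hom RC (prod_obj RC A A) A"
    and B: "B \<in> Obj RC" and m': "m' \<in> Hom RC (prod_obj RC B B) B"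
    using AbRC_objD[OF a] AbRC_objD[OF b] by (simp_all add: a' b')
  let ?AA = "prod_obj RC A A"
  have AA: "?AA \<in> Obj RC" using product_RC(1)[OF A A] .
  note p = product_RC(2,3)[OF A A] and P = proj_cell[OF A A]
  have "Comp RC ?AA A B f m = mult_pair RC B m' ?AA (Comp RC ?AA A B f (proj1 RC A A)) (Comp RC ?AA A B f (proj2 RC A A)) \<longleftrightarrow>
    (\<forall>x\<in>Obj Simp. \<forall>u\<in>fib A x. \<forall>v\<in>fib A x.
      f (fst x) (mul A m (fst x) u v) = mul B m' (fst x) (f (fst x) u) (f (fst x) v))"
    (is "?l = ?r \<longleftrightarrow> ?Q") if f: "f \<in> Hom RC A B"
  proof -
    have fp: "Comp RC ?AA A B f (proj1 RC A A) \<in> Hom RC ?AA B" "Comp RC ?AA A B f (proj2 RC A A) \<in> Hom RC ?AA B"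
      "?l \<in> Hom RC ?AA B"
      using p m f A B AA by (auto intro: cat_comp[OF category_RC])
    have "?l = ?r \<longleftrightarrow> (\<forall>n. \<forall>z\<in>cell ?AA n. ?l n z = ?r n z)"
      by (rule RC_hom_eq_iff[OF AA B fp(3) mult_pair(1)[OF AA B m' fp(1,2)]])
    also have "\<dots> \<longleftrightarrow> (\<forall>n. \<forall>z\<in>cell ?AA n.
        f n (mul A m n (proj1 RC A A n z) (proj2 RC A A n z)) =
        mul B m' n (f n (proj1 RC A A n z)) (f n (proj2 RC A A n z)))"
      by (simp add: mult_pair(2)[OF AA B m' fp(1,2)]) (simp add: RC_Comp compose_eq mul_def P)
    also have "\<dots> \<longleftrightarrow> ?Q"
    proof
      assume L: "\<forall>n. \<forall>z\<in>cell ?AA n.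
        f n (mul A m n (proj1 RC A A n z) (proj2 RC A A n z)) =
        mul B m' n (f n (proj1 RC A A n z)) (f n (proj2 RC A A n z))"
      show ?Q
      proof (intro ballI)
        fix x u v assume "u \<in> fib A x" "v \<in> fib A x"
        then have "u \<in> cell A (fst x)" "v \<in> cell A (fst x)" "ret A (fst x) u = ret A (fst x) v"
          by (simp_all add: fib_def)
        note * = pr[OF A A this]
        from L[rule_format, OF *(1)]
        show "f (fst x) (mul A m (fst x) u v) = mul B m' (fst x) (f (fst x) u) (f (fst x) v)"
          by (simp add: *)
      qed
    next
      assume Q: ?Q
      show "\<forall>n. \<forall>z\<in>cell ?AA n.
        f n (mul A m n (proj1 RC A A n z) (proj2 RC A A n z)) =
        mul B m' n (f n (proj1 RC A A n z)) (f n (proj2 RC A A n z))"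
      proof (intro allI ballI)
        fix n z assume z: "z \<in> cell ?AA n"
        let ?x = "(n, ret ?AA n z)"
        have "?x \<in> Obj Simp" "proj1 RC A A n z \<in> fib A ?x" "proj2 RC A A n z \<in> fib A ?x"
          using z P RC_objD(2)[OF AA z] by (simp_all add: fib_def)
        with Q have "f (fst ?x) (mul A m (fst ?x) (proj1 RC A A n z) (proj2 RC A A n z)) =
          mul B m' (fst ?x) (f (fst ?x) (proj1 RC A A n z)) (f (fst ?x) (proj2 RC A A n z))" by blast
        then show "f n (mul A m n (proj1 RC A A n z) (proj2 RC A A n z)) =
          mul B m' n (f n (proj1 RC A A n z)) (f n (proj2 RC A A n z))" by simp
      qed
    qed
    finally show ?thesis .
  qed
  then show ?thesis by (auto simp: a' b' Ab_objects_def split_beta)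
qed

lemma RC_hom_fib:
  "A \<in> Obj RC \<Longrightarrow> B \<in> Obj RC \<Longrightarrow> f \<in> Hom RC A B \<Longrightarrow> z \<in> fib A x \<Longrightarrow> f (fst x) z \<in> fib B x"
  using RC_homD[of A B f] by (simp add: fib_def)

lemma fmul_fib:
  assumes "a \<in> Obj AbRC" "u \<in> fib (fst a) x" "v \<in> fib (fst a) x"
  shows "fmul a (fst x) u v \<in> fib (fst a) x"
  using assms(2,3) mul(1,2)[OF AbRC_objD[OF assms(1)], of u "fst x" v] by (simp add: fib_def)

lemma category_AbRC: "category AbRC"
proof (rule categoryI, goal_cases)
  case (1 a)
  then have "Ide RC (fst a) \<in> Hom RC (fst a) (fst a)"
    using cat_ide[OF category_RC] AbRC_objD(1) by blast
  moreover have "z \<in> cell (fst a) (fst x)" if "z \<in> fib (fst a) x" for z x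
    using that by (simp add: fib_def)
  ultimately show ?case
    using 1 fmul_fib[OF 1] by (simp add: AbRC_hom_iff[OF 1 1] AbRC_simps RC_Ide)
next
  case (2 a b d f g)
  note ab = 2(1-3)[THEN AbRC_objD(1)]
  note f = 2(4)[unfolded AbRC_hom_iff[OF 2(1,2)]] and g = 2(5)[unfolded AbRC_hom_iff[OF 2(2,3)]]
  have cell: "z \<in> cell (fst a) (fst x)" if "z \<in> fib (fst a) x" for z x
    using that by (simp add: fib_def)
  show ?case
    using f g RC_hom_fib[OF ab(1,2) conjunct1[OF f]] cell fmul_fib[OF 2(1)]
    by (simp add: AbRC_hom_iff[OF 2(1,3)] AbRC_simps cat_comp[OF category_RC ab] del: Simp_simps)
      (simp add: RC_Comp compose_eq del: Simp_simps)
next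
  case (3 a b f)
  then show ?case
    using cat_ide_right[OF category_RC] by (simp add: AbRC_hom_iff AbRC_simps AbRC_objD(1))
next
  case (4 a b f)
  then show ?case
    using cat_ide_left[OF category_RC] by (simp add: AbRC_hom_iff AbRC_simps AbRC_objD(1))
next
  case (5 a b c d f g h)
  then show ?case
    using cat_assoc[OF category_RC] by (simp add: AbRC_hom_iff AbRC_simps AbRC_objD(1))
qed

abbreviation "fgroup a \<equiv> fibre_group (fst a) (\<lambda>x. fmul a (fst x))"

definition group_fibres where
  "group_fibres a = fibre_functor (fgroup a) (fst a)"

lemma comm_group_fgroup: "a \<in> Obj AbRC \<Longrightarrow> x \<in> Obj Simp \<Longrightarrow> comm_group (fgroup a x)"
  unfolding AbRC_obj_iff by (rule comm_group_fibre)

lemma res_fmul: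
  assumes a: "a \<in> Obj AbRC" and "\<phi> \<in> Hom Simp y x" "u \<in> fib (fst a) x" "v \<in> fib (fst a) x"
  shows "res (fst a) (fst x) (fst y) \<phi> (fmul a (fst x) u v) =
    fmul a (fst y) (res (fst a) (fst x) (fst y) \<phi> u) (res (fst a) (fst x) (fst y) \<phi> v)"
  using assms(2-) by (intro mul(3)[OF AbRC_objD[OF a]]) (simp_all add: fib_def)

lemma is_functor_group_fibres:
  assumes a: "a \<in> Obj AbRC"
  shows "is_functor (opp Simp) (Ab_cat U) (group_fibres a)"
  unfolding group_fibres_def
proof (rule is_functor_fibre_functor[OF AbRC_objD(1)[OF a]], goal_cases)
  case (1 x)
  then show ?case using comm_group_fgroup[OF a] fib_in_universe[OF AbRC_objD(1)[OF a]] by simp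
next
  case (2 x y \<phi>)
  then show ?case
    by (simp add: hom_def res_fib[OF AbRC_objD(1)[OF a]] res_fmul[OF a] fmul_fib[OF a] del: Simp_simps)
qed simp_all

text \<open>The units of the fibre groups are the section values, so a homomorphism is pointed
  automatically and additivity is the only condition beyond \<open>fib_maps\<close>.\<close>

lemma nat_trans_group_fibres:
  assumes a: "a \<in> Obj AbRC" and b: "b \<in> Obj AbRC"
  shows "nat_trans (opp Simp) (Ab_cat U) (group_fibres a) (group_fibres b) =
    {\<theta> \<in> fib_maps (fst a) (fst b). \<forall>x\<in>Obj Simp. \<forall>u\<in>fib (fst a) x. \<forall>v\<in>fib (fst a) x.
      \<theta> x (fmul a (fst x) u v) = fmul b (fst x) (\<theta> x u) (\<theta> x v)}" (is "?L = ?R")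
proof -
  note A = AbRC_objD(1)[OF a] and B = AbRC_objD(1)[OF b]
  have *: "compose (fib (fst a) x) (\<theta> y) (\<lambda>z\<in>fib (fst a) x. res (fst a) (fst x) (fst y) \<phi> z) =
      compose (fib (fst a) x) (\<lambda>z\<in>fib (fst b) x. res (fst b) (fst x) (fst y) \<phi> z) (\<theta> x) \<longleftrightarrow>
     (\<forall>z\<in>fib (fst a) x. \<theta> y (res (fst a) (fst x) (fst y) \<phi> z) = res (fst b) (fst x) (fst y) \<phi> (\<theta> x z))"
    if "\<theta> x \<in> fib (fst a) x \<rightarrow> fib (fst b) x" for \<theta> x y \<phi>
    using that by (auto simp: compose_def fun_eq_iff Pi_iff)
  have one: "\<theta> (sec (fst a) (fst x) (snd x)) = sec (fst b) (fst x) (snd x)"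
    if "x \<in> Obj Simp" "\<theta> \<in> hom (fgroup a x) (fgroup b x)" for \<theta> x
    using hom_one[OF that(2)] comm_group_fgroup[OF a that(1)] comm_group_fgroup[OF b that(1)]
    by (simp add: comm_group_def)
  have hom: "\<theta> \<in> hom (fgroup a x) (fgroup b x) \<longleftrightarrow> \<theta> \<in> fib (fst a) x \<rightarrow> fib (fst b) x \<and>
    (\<forall>u\<in>fib (fst a) x. \<forall>v\<in>fib (fst a) x. \<theta> (fmul a (fst x) u v) = fmul b (fst x) (\<theta> u) (\<theta> v))" for \<theta> x
    by (simp add: hom_def)
  show ?thesis
  proof (intro equalityI subsetI)
    fix \<theta> assume \<theta>: "\<theta> \<in> ?L"
    have h: "\<theta> x \<in> hom (fgroup a x) (fgroup b x)" "\<theta> x \<in> extensional (fib (fst a) x)" if "x \<in> Obj Simp" for x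
      using nat_trans_mor[OF \<theta>, of x] that
      by (simp_all add: group_fibres_def fibre_functor_def del: Simp_simps)
    have n: "\<theta> y (res (fst a) (fst x) (fst y) \<phi> z) = res (fst b) (fst x) (fst y) \<phi> (\<theta> x z)"
      if "x \<in> Obj Simp" "y \<in> Obj Simp" "\<phi> \<in> Hom Simp y x" "z \<in> fib (fst a) x" for x y \<phi> z
      using nat_trans_natural[OF \<theta>, of x y \<phi>] h[OF that(1)] that
      by (simp add: group_fibres_def fibre_functor_def * hom del: Simp_simps)
    have ext: "\<theta> \<in> extensional (Obj Simp)"
      using nat_trans_extensional[OF \<theta>] by simp
    have "\<theta> \<in> fib_maps (fst a) (fst b)"
      using h n ext one by (simp add: fib_maps_def PiE_def Pi_iff hom del: Simp_simps)
    with h show "\<theta> \<in> ?R" by (simp add: hom del: Simp_simps)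
  next
    fix \<theta> assume "\<theta> \<in> ?R"
    then have "\<theta> \<in> extensional (Obj Simp)"
      and "\<And>x. x \<in> Obj Simp \<Longrightarrow> \<theta> x \<in> fib (fst a) x \<rightarrow> fib (fst b) x"
      and "\<And>x. x \<in> Obj Simp \<Longrightarrow> \<theta> x \<in> extensional (fib (fst a) x)"
      and "\<And>x y \<phi> z. x \<in> Obj Simp \<Longrightarrow> y \<in> Obj Simp \<Longrightarrow> \<phi> \<in> Hom Simp y x \<Longrightarrow> z \<in> fib (fst a) x \<Longrightarrow>
        \<theta> y (res (fst a) (fst x) (fst y) \<phi> z) = res (fst b) (fst x) (fst y) \<phi> (\<theta> x z)"
      and "\<And>x u v. x \<in> Obj Simp \<Longrightarrow> u \<in> fib (fst a) x \<Longrightarrow> v \<in> fib (fst a) x \<Longrightarrow>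
        \<theta> x (fmul a (fst x) u v) = fmul b (fst x) (\<theta> x u) (\<theta> x v)"
      by (simp_all add: fib_maps_def PiE_def Pi_iff del: Simp_simps)
    then show "\<theta> \<in> ?L"
      by (intro nat_transI) (simp_all add: group_fibres_def fibre_functor_def * hom del: Simp_simps)
  qed
qed

section \<open>The equivalence in the abelian case\<close>

definition group_fibres_functor where
  "group_fibres_functor = mk_functor AbRC group_fibres (\<lambda>a b. fibrewise (fst a))"

text \<open>Both sides are cut out of the pointed situation by additivity, and
  \<open>fibrewise\<close> preserves and reflects it; so the pointed bijection restricts.\<close>

lemma bij_betw_fibrewise_group:
  assumes a: "a \<in> Obj AbRC" and b: "b \<in> Obj AbRC"
  shows "bij_betw (fibrewise (fst a)) (Hom AbRC a b)
    (nat_trans (opp Simp) (Ab_cat U) (group_fibres a) (group_fibres b))"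
proof -
  note A = AbRC_objD(1)[OF a] and B = AbRC_objD(1)[OF b]
  have restrict: "bij_betw h {f \<in> X. P f} {g \<in> Y. Q g}"
    if "bij_betw h X Y" "\<And>f. f \<in> X \<Longrightarrow> Q (h f) \<longleftrightarrow> P f" for h :: "'x \<Rightarrow> 'y" and X Y P Q
    using that unfolding bij_betw_def inj_on_def by auto
  have H: "Hom AbRC a b = {f \<in> Hom RC (fst a) (fst b). \<forall>x\<in>Obj Simp. \<forall>u\<in>fib (fst a) x. \<forall>v\<in>fib (fst a) x.
      f (fst x) (fmul a (fst x) u v) = fmul b (fst x) (f (fst x) u) (f (fst x) v)}"
    using AbRC_hom_iff[OF a b] by blast
  show ?thesis
    unfolding H nat_trans_group_fibres[OF a b]
    by (rule restrict[OF bij_betw_fibrewise[OF A B]])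
      (simp add: fibrewise_def fmul_fib[OF a] del: Simp_simps)
qed

lemma is_functor_group_fibres_functor:
  "is_functor AbRC (Fun_cat (opp Simp) (Ab_cat U)) group_fibres_functor"
  unfolding group_fibres_functor_def
proof (rule is_functor_mk_functor, goal_cases)
  case (4 a b f)
  then show ?case
    using bij_betw_fibrewise_group[of a b] by (auto simp: bij_betw_def)
next
  case (5 a)
  then show ?case
    by (auto simp: AbRC_simps AbRC_objD fibrewise_Ide group_fibres_def fibre_functor_def
        simp del: Simp_simps intro!: restrict_ext)
next
  case (6 a b d f g)
  then show ?case
    by (simp add: AbRC_simps AbRC_objD AbRC_hom_iff fibrewise_Comp group_fibres_def fibre_functor_def
        cong: restrict_cong del: Simp_simps)
qed (simp_all add: cat_ide[OF category_AbRC] cat_comp[OF category_AbRC] is_functor_group_fibres)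

text \<open>The underlying sets of \<open>K\<close>, pointed by the units, are realised first; the
  group structures are then carried to the fibres along \<open>\<theta>\<close> and assembled into
  an abelian group object.\<close>

lemma ess_surj_group:
  assumes K: "is_functor (opp Simp) (Ab_cat U) K"
  shows "\<exists>a\<in>Obj AbRC. isomorphic (Fun_cat (opp Simp) (Ab_cat U)) (group_fibres a) K"
proof -
  let ?K = "FObj K"
  have K_obj: "comm_group (?K x)" "carrier (?K x) \<in> U" if "x \<in> Obj Simp" for x
    using functor_obj[OF K, of x] that by (simp_all del: Simp_simps)
  have K_group: "group (?K x)" if "x \<in> Obj Simp" for x
    using K_obj(1)[OF that] by (rule comm_group.axioms(2))
  note K_monoid = group.is_monoid[OF K_group]
  have K_mor: "FMor K x y \<phi> \<in> hom (?K x) (?K y)"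
    if "x \<in> Obj Simp" "y \<in> Obj Simp" "\<phi> \<in> Hom Simp y x" for x y \<phi>
    using functor_mor[OF K, of x y \<phi>] that by (simp del: Simp_simps)
  have K_ide: "FMor K x x (Ide Simp x) = (\<lambda>k\<in>carrier (?K x). k)" if "x \<in> Obj Simp" for x
    using functor_ide[OF K, of x] that by (simp del: Simp_simps)
  have K_comp: "FMor K x z (Comp Simp z y x \<psi> \<phi>) = compose (carrier (?K x)) (FMor K y z \<phi>) (FMor K x y \<psi>)"
    if "x \<in> Obj Simp" "y \<in> Obj Simp" "z \<in> Obj Simp" "\<psi> \<in> Hom Simp y x" "\<phi> \<in> Hom Simp z y" for x y z \<psi> \<phi>
    using functor_comp[OF K, of x y z \<psi> \<phi>] that by (simp del: Simp_simps)
  obtain A \<theta> where A: "A \<in> Obj RC"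
    and bij: "\<And>x. x \<in> Obj Simp \<Longrightarrow> bij_betw (\<theta> x) (fib A x) (carrier (?K x))"
    and pt: "\<And>x. x \<in> Obj Simp \<Longrightarrow> \<theta> x (sec A (fst x) (snd x)) = \<one>\<^bsub>?K x\<^esub>"
    and nat: "\<And>x y \<phi> z. x \<in> Obj Simp \<Longrightarrow> y \<in> Obj Simp \<Longrightarrow> \<phi> \<in> Hom Simp y x \<Longrightarrow> z \<in> fib A x \<Longrightarrow>
      \<theta> y (res A (fst x) (fst y) \<phi> z) = FMor K x y \<phi> (\<theta> x z)"
  proof (rule functor_realization[where F = "\<lambda>x. carrier (?K x)" and pt = "\<lambda>x. \<one>\<^bsub>?K x\<^esub>"
        and T = "\<lambda>x y \<phi>. FMor K x y \<phi>"], goal_cases)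
    case (2 x y \<phi> k)
    then show ?case using K_mor[of x y \<phi>] by (auto simp: hom_def)
  next
    case (6 x y \<phi>)
    then show ?case by (intro hom_one K_mor K_group)
  qed (auto simp: K_obj K_ide K_comp compose_eq monoid.one_closed[OF K_monoid] simp del: Simp_simps)
  define \<iota> where "\<iota> x = inv_into (fib A x) (\<theta> x)" for x
  have \<iota>: "\<iota> x k \<in> fib A x" "\<theta> x (\<iota> x k) = k" if "x \<in> Obj Simp" "k \<in> carrier (?K x)" for x k
    using bij[OF that(1)] that(2) unfolding \<iota>_def
    by (auto simp: bij_betw_def intro: inv_into_into f_inv_into_f)
  have \<iota>\<theta>: "\<iota> x (\<theta> x z) = z" if "x \<in> Obj Simp" "z \<in> fib A x" for x z
    using bij[OF that(1)] that(2) by (auto simp: \<iota>_def bij_betw_def)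
  have \<theta>: "\<theta> x z \<in> carrier (?K x)" if "x \<in> Obj Simp" "z \<in> fib A x" for x z
    using bij[OF that(1)] that(2) by (auto simp: bij_betw_def)
  \<comment> \<open>Every identity in a fibre is proved by applying \<open>\<theta>\<close> and
    calculating in the group of \<open>K\<close>.\<close>
  have inj: "u = v" if "\<theta> x u = \<theta> x v" "x \<in> Obj Simp" "u \<in> fib A x" "v \<in> fib A x" for x u v
    by (rule trans[OF \<iota>\<theta>[OF that(2,3), symmetric], unfolded that(1), OF \<iota>\<theta>[OF that(2,4)]])
  \<comment> \<open>The unique multiplication for which \<open>\<theta> x\<close> is a
    homomorphism.\<close>
  define M where "M x u v = \<iota> x (\<theta> x u \<otimes>\<^bsub>?K x\<^esub> \<theta> x v)" for x u v
  have M: "M x u v \<in> fib A x" "\<theta> x (M x u v) = \<theta> x u \<otimes>\<^bsub>?K x\<^esub> \<theta> x v"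
    if "x \<in> Obj Simp" "u \<in> fib A x" "v \<in> fib A x" for x u v
    using \<iota>[OF that(1) monoid.m_closed[OF K_monoid[OF that(1)] \<theta>[OF that(1,2)] \<theta>[OF that(1,3)]]]
    unfolding M_def .
  have grp: "comm_group (fibre_group A M x)" if x: "x \<in> Obj Simp" for x
  proof (rule comm_groupI, unfold fibre_group_simps, goal_cases)
    case (1 u v)
    then show ?case using M[OF x] by blast
  next
    case 2
    show ?case using sec_fib[OF A x] .
  next
    case (3 u v w)
    show ?case
      by (rule inj[OF _ x]) (use 3 in \<open>simp_all add: M[OF x] \<theta>[OF x] monoid.m_assoc[OF K_monoid[OF x]] del: Simp_simps\<close>)
  next
    case (4 u v)
    show ?case
      by (rule inj[OF _ x])
        (use 4 in \<open>simp_all add: M[OF x] \<theta>[OF x] comm_monoid.m_comm[OF comm_group.axioms(1)[OF K_obj(1)[OF x]]] del: Simp_simps\<close>)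
  next
    case (5 u)
    show ?case
      by (rule inj[OF _ x])
        (use 5 in \<open>simp_all add: M[OF x] \<theta>[OF x] pt[OF x] sec_fib[OF A x] monoid.l_one[OF K_monoid[OF x]] del: Simp_simps\<close>)
  next
    case (6 u)
    let ?v = "\<iota> x (inv\<^bsub>?K x\<^esub> \<theta> x u)"
    have v: "?v \<in> fib A x" "\<theta> x ?v = inv\<^bsub>?K x\<^esub> \<theta> x u"
      using \<iota>[OF x] group.inv_closed[OF K_group[OF x] \<theta>[OF x 6]] by blast+
    have "M x ?v u = sec A (fst x) (snd x)"
      by (rule inj[OF _ x])
        (use v 6 in \<open>simp_all add: M[OF x] \<theta>[OF x] pt[OF x] sec_fib[OF A x] group.l_inv[OF K_group[OF x]] del: Simp_simps\<close>)
    with v(1) show ?case by blast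
  qed
  have M_nat: "res A (fst x) (fst y) \<phi> (M x u v) = M y (res A (fst x) (fst y) \<phi> u) (res A (fst x) (fst y) \<phi> v)"
    if "x \<in> Obj Simp" "y \<in> Obj Simp" "\<phi> \<in> Hom Simp y x" "u \<in> fib A x" "v \<in> fib A x" for x y \<phi> u v
  proof (rule inj[OF _ that(2)])
    have "\<theta> y (res A (fst x) (fst y) \<phi> (M x u v)) = FMor K x y \<phi> (\<theta> x u \<otimes>\<^bsub>?K x\<^esub> \<theta> x v)"
      using that by (simp add: nat M del: Simp_simps)
    also have "\<dots> = FMor K x y \<phi> (\<theta> x u) \<otimes>\<^bsub>?K y\<^esub> FMor K x y \<phi> (\<theta> x v)"
      using that by (intro hom_mult[OF K_mor] \<theta>)
    also have "\<dots> = \<theta> y (M y (res A (fst x) (fst y) \<phi> u) (res A (fst x) (fst y) \<phi> v))"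
      using that by (simp add: nat M res_fib[OF A] del: Simp_simps)
    finally show "\<theta> y (res A (fst x) (fst y) \<phi> (M x u v)) =
      \<theta> y (M y (res A (fst x) (fst y) \<phi> u) (res A (fst x) (fst y) \<phi> v))" .
  qed (use that in \<open>simp_all add: M res_fib[OF A] del: Simp_simps\<close>)
  obtain m e i where ab: "abelian_group_object RC A m e i"
    and mul_M: "\<And>x u v. x \<in> Obj Simp \<Longrightarrow> u \<in> fib A x \<Longrightarrow> v \<in> fib A x \<Longrightarrow> mul A m (fst x) u v = M x u v"
    by (rule ex_abelian_group_object[OF A grp M_nat]) blast+
  define a where "a = (A, m, e, i)"
  have a: "a \<in> Obj AbRC" using ab by (simp add: a_def AbRC_obj_iff)
  have [simp]: "fst a = A" by (simp add: a_def)
  have fmul: "mul A (fst (snd a)) (fst x) u v = M x u v" if "x \<in> Obj Simp" "u \<in> fib A x" "v \<in> fib A x" for x u v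
    using mul_M[OF that] by (simp add: a_def)
  have "isomorphic (Fun_cat (opp Simp) (Ab_cat U)) (group_fibres a) K"
  proof (rule isomorphic_Fun_catI[OF category_Ab_cat is_functor_group_fibres[OF a] K,
        where a = "\<lambda>x. \<lambda>z\<in>fib A x. \<theta> x z" and b = "\<lambda>x. \<lambda>k\<in>carrier (?K x). \<iota> x k"],
        goal_cases)
    case (1 x)
    then show ?case
      by (simp add: group_fibres_def fibre_functor_def hom_def fmul M \<theta> del: Simp_simps)
  next
    case (2 x)
    \<comment> \<open>The inverse is multiplicative directly from the definition of
      \<open>M\<close>, as \<open>\<theta>\<close> undoes \<open>\<iota>\<close> on both
      factors.\<close>
    have "\<iota> x (k \<otimes>\<^bsub>?K x\<^esub> l) = M x (\<iota> x k) (\<iota> x l)" if "k \<in> carrier (?K x)" "l \<in> carrier (?K x)" for k l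
      using 2 that by (simp add: M_def \<iota> del: Simp_simps)
    with 2 show ?case
      by (simp add: group_fibres_def fibre_functor_def hom_def fmul \<iota> monoid.m_closed[OF K_monoid] del: Simp_simps)
  next
    case (5 x y \<phi>)
    then show ?case
      by (simp add: group_fibres_def fibre_functor_def compose_def \<theta> nat res_fib[OF A]
          cong: restrict_cong del: Simp_simps)
  qed (auto simp: group_fibres_def fibre_functor_def compose_def \<theta> \<iota> \<iota>\<theta>
      simp del: Simp_simps intro!: restrict_ext)
  with a show ?thesis by blast
qed

theorem equivalent_group:
  "equivalent_categories AbRC (Fun_cat (opp Simp) (Ab_cat U))"
proof (rule equivalent_categories_if_fully_faithful_surj[OF category_AbRC
      category_Fun_cat[OF category_Ab_cat] is_functor_group_fibres_functor])
  fix a b assume ab: "a \<in> Obj AbRC" "b \<in> Obj AbRC"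
  have "bij_betw (FMor group_fibres_functor a b) (Hom AbRC a b) X =
    bij_betw (fibrewise (fst a)) (Hom AbRC a b) X" for X
    by (rule bij_betw_cong) (simp add: group_fibres_functor_def ab)
  with bij_betw_fibrewise_group[OF ab] ab
  show "bij_betw (FMor group_fibres_functor a b) (Hom AbRC a b)
      (Hom (Fun_cat (opp Simp) (Ab_cat U)) (FObj group_fibres_functor a) (FObj group_fibres_functor b))"
    by (simp add: group_fibres_functor_def)
next
  fix K assume "K \<in> Obj (Fun_cat (opp Simp) (Ab_cat U))"
  then show "\<exists>a\<in>Obj AbRC. isomorphic (Fun_cat (opp Simp) (Ab_cat U)) (FObj group_fibres_functor a) K"
    using ess_surj_group[of K] by (simp add: group_fibres_functor_def cong: bex_cong)
qed

end

theorem proposition1p1p3: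
  fixes U :: "'u set set"
    and G :: "'g sgroup"
    and W :: "('u, 'g) gspace"
  assumes "set_universe U"
    and "simplicial_group G"
    and "W \<in> Obj (GsSet_cat U G)"
  shows "equivalent_categories (R_cat U W G)
           (Fun_cat (opp (Simp_cat G W)) (Pointed_set_cat U)) \<and>
         equivalent_categories (Ab_objects (R_cat U W G))
           (Fun_cat (opp (Simp_cat G W)) (Ab_cat U))"
proof -
  interpret retractive_spaces U G W
    using assms by unfold_locales
  show ?thesis
    unfolding R_cat_def using equivalent_pointed equivalent_group by blast
qed

end
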